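(* Let $n\ge1$ be an integer. The following are equivalent: 1. For every $k\ge n$ and every family of vectors $u_1,\dots,u_k\in\mathbb{R}^n$, the function $f:2^{[k]}\to[-\infty,\infty)$ defined for $S\subset[k]$ by $$f(S)=\log\Big|\sum_{i\in S}[0,u_i]\Big|=\log\sum_{I\subset S,\,|I|=n}|\det((u_i)_{i\in I})|$$ is submodular; that is, for all zonoids $A,B,C$ in $\mathbb{R}^n$ one has $|A|\,|A+B+C|\le|A+B|\,|A+C|$. 2. For every $k\ge n$, every family of vectors $u_1,\dots,u_k\in\mathbb{R}^n$ and every $u,v\in\mathbb{R}^n$, $$\sum_{|I|=n}|\det((u_i)_{i\in I})|\sum_{|I|=n-2}|\det(u,v,(u_i)_{i\in I})|\le\sum_{|I|=n-1}|\det(u,(u_i)_{i\in I})|\sum_{|I|=n-1}|\det(v,(u_i)_{i\in I})|,$$ where the sums run over subsets $I\subset[k]$ of the indicated cardinality. 3. For every zonoid $A$ in $\mathbb{R}^n$ and all linear subspaces $E,F$ of $\mathbb{R}^n$ with $E^\perp\subseteq F$, $$|A|\,|P_{E\cap F}A|\le|P_EA|\,|P_FA|.$$ 4. For every $m=1,\dots,n$, every zonoid $A$ in $\mathbb{R}^n$ and every orthonormal sequence $u_1,\dots,u_m$ in $\mathbb{R}^n$, $$|A|^{m-1}\big|P_{[u_1,\dots,u_m]^\perp}A\big|_{n-m}\le\prod_{i=1}^m\big|P_{u_i^\perp}A\big|_{n-1}.$$ 5. For every $m=1,\dots,n$ and all zonoids $A,B_1,\dots,B_m$ in $\mathbb{R}^n$,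 $$|A|^{m-1}V(A[n-m],B_1,\dots,B_m)\le\frac{n^m(n-m)!}{n!}\prod_{i=1}^mV(A[n-1],B_i).$$
   Context: A zonotope is a finite Minkowski sum of segments; a zonoid is a Hausdorff limit of zonotopes. $[k]=\{1,\dots,k\}$; $[0,u]$ is the segment from $0$ to $u$; $|A|$ is $n$-dimensional volume and $|\cdot|_m$ is $m$-dimensional volume; $|P_GA|$ is the $(\dim G)$-dimensional volume of the orthogonal projection $P_GA$ of $A$ onto the subspace $G$ (equal to $1$ if $G=\{0\}$). $[u_1,\dots,u_m]^\perp$ is the orthogonal complement of the span of $u_1,\dots,u_m$. $V$ is the mixed volume, normalized by $V(K,\dots,K)=|K|$, and $K[j]$ means $K$ repeated $j$ times. Conventions: $\log0=-\infty$, $0^0=1$, and a sum over sets of negative cardinality is empty (equal to $0$). A function $F:2^{[k]}\to[-\infty,\infty)$ is submodular if $F(S\cup T)+F(S\cap T)\le F(S)+F(T)$ for all $S,T\subset[k]$. *)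

theory Defs
  imports "HOL-Analysis.Analysis"
begin

text \<open>Minkowski sums of sets, binary and finite, are those of HOL-Library.Set_Algebras; in
  particular the sum over an empty index set is \<open>{0}\<close>.\<close>

definition zonotope :: "'a::euclidean_space set \<Rightarrow> bool" where
  "zonotope Z \<longleftrightarrow>
     (\<exists>(N::nat) (a::nat \<Rightarrow> 'a) (b::nat \<Rightarrow> 'a). Z = (\<Sum>i<N. closed_segment (a i) (b i)))"

definition hausdorff_dist :: "'a::metric_space set \<Rightarrow> 'a set \<Rightarrow> real" where
  "hausdorff_dist A B = max (SUP x\<in>A. infdist x B) (SUP y\<in>B. infdist y A)"

text \<open>The Hausdorff distance is a metric only on nonempty compact sets, so the limit is required
  to be one.\<close>

definition zonoid :: "'a::euclidean_space set \<Rightarrow> bool" where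
  "zonoid A \<longleftrightarrow> compact A \<and> A \<noteq> {} \<and>
     (\<exists>Z::nat \<Rightarrow> 'a set. (\<forall>j. zonotope (Z j)) \<and> (\<lambda>j. hausdorff_dist (Z j) A) \<longlonglongrightarrow> 0)"

text \<open>Unlike \<open>ln\<close> on \<open>real\<close>, this takes the value \<open>-\<infinity>\<close> at \<open>0\<close>.\<close>

definition elog :: "real \<Rightarrow> ereal" where
  "elog x = (if x \<le> 0 then -\<infinity> else ereal (ln x))"

definition submodular_on :: "'i set \<Rightarrow> ('i set \<Rightarrow> ereal) \<Rightarrow> bool" where
  "submodular_on X F \<longleftrightarrow> (\<forall>S. S \<subseteq> X \<longrightarrow> F S \<noteq> \<infinity>) \<and>
     (\<forall>S T. S \<subseteq> X \<longrightarrow> T \<subseteq> X \<longrightarrow> F (S \<union> T) + F (S \<inter> T) \<le> F S + F T)"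

text \<open>The determinant of the matrix whose columns are the vectors of a list of length
  \<open>CARD('n)\<close>. The columns are indexed by the type \<open>'n\<close> through an arbitrary enumeration of that
  type, on which the sign, but not the absolute value, depends.\<close>

definition det_vecs :: "(real^'n) list \<Rightarrow> real" where
  "det_vecs xs =
     (let e = (SOME e::'n \<Rightarrow> nat. bij_betw e UNIV {..<CARD('n)})
      in det (\<chi> i j. (xs ! e j) $ i))"

definition orth_proj :: "'a::euclidean_space set \<Rightarrow> 'a \<Rightarrow> 'a" where
  "orth_proj G x = (THE y. y \<in> G \<and> (\<forall>z\<in>G. orthogonal (x - y) z))"

definition orthonormal_basis :: "'a::euclidean_space set \<Rightarrow> 'a set \<Rightarrow> bool" where
  "orthonormal_basis G B \<longleftrightarrow>
     B \<subseteq> G \<and> pairwise orthogonal B \<and> (\<forall>b\<in>B. norm b = 1) \<and> span B = G"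

text \<open>\<open>dim G\<close>-dimensional Lebesgue measure on a subspace \<open>G\<close>, constructed like \<open>lborel\<close> but with an
  orthonormal basis of \<open>G\<close> in place of \<open>Basis\<close>; by rotation invariance the choice of that basis is
  immaterial. For \<open>G = {0}\<close> it is the Dirac measure at \<open>0\<close>.\<close>

definition lborel_subspace :: "'a::euclidean_space set \<Rightarrow> 'a measure" where
  "lborel_subspace G =
     (let B = (SOME B. orthonormal_basis G B)
      in distr (Pi\<^sub>M B (\<lambda>_. lborel :: real measure)) borel (\<lambda>f. \<Sum>b\<in>B. f b *\<^sub>R b))"

definition proj_vol :: "'a::euclidean_space set \<Rightarrow> 'a set \<Rightarrow> real" where
  "proj_vol G A = measure (lborel_subspace G) (orth_proj G ` A)"

text \<open>The mixed volume \<open>V(K\<^sub>0,\<dots>,K\<^sub>n\<^sub>-\<^sub>1)\<close> of a list of \<open>n = DIM('a)\<close> convex bodies: the family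
  \<open>W \<phi> = V(K\<^bsub>\<phi> 0\<^esub>,\<dots>,K\<^bsub>\<phi> (n - 1)\<^esub>)\<close> consists of the symmetric coefficients in Minkowski's expansion of
  \<open>|t\<^sub>0 K\<^sub>0 + \<dots> + t\<^sub>n\<^sub>-\<^sub>1 K\<^sub>n\<^sub>-\<^sub>1|\<close> as a homogeneous polynomial in \<open>t\<^sub>0,\<dots>,t\<^sub>n\<^sub>-\<^sub>1 \<ge> 0\<close>, which determines
  them. The normalization is \<open>V(K,\<dots>,K) = |K|\<close>.\<close>

definition mixed_volume :: "'a::euclidean_space set list \<Rightarrow> real" where
  "mixed_volume Ks =
     (let n = DIM('a); \<Phi> = {..<n} \<rightarrow>\<^sub>E {..<n}
      in THE v. \<exists>W :: (nat \<Rightarrow> nat) \<Rightarrow> real.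
           (\<forall>\<phi>\<in>\<Phi>. \<forall>p. p permutes {..<n} \<longrightarrow> W (\<phi> \<circ> p) = W \<phi>) \<and>
           (\<forall>t :: nat \<Rightarrow> real. (\<forall>i<n. 0 \<le> t i) \<longrightarrow>
              measure lborel (\<Sum>i<n. (\<lambda>x. t i *\<^sub>R x) ` (Ks ! i)) =
              (\<Sum>\<phi>\<in>\<Phi>. W \<phi> * (\<Prod>j<n. t (\<phi> j)))) \<and>
           v = W (restrict id {..<n}))"

definition all_equivalent :: "bool list \<Rightarrow> bool" where
  "all_equivalent Ps \<longleftrightarrow> (\<forall>P\<in>set Ps. \<forall>Q\<in>set Ps. P \<longleftrightarrow> Q)"

end

theory Submission
  imports Defs
begin

text \<open>Every condition is equivalent to the inequality \<open>[A] [A; x, y] \<le> [A; x] [A; y]\<close> for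
  zonotopes \<open>A\<close> and vectors \<open>x, y\<close>, where \<open>[A; v\<^sub>1, \<dots>, v\<^sub>m]\<close> is the sum of \<open>|det|\<close> over the families made
  of \<open>v\<^sub>1, \<dots>, v\<^sub>m\<close> and \<open>n - m\<close> generators of \<open>A\<close>. This number is a volume of a projection of \<open>A\<close> for orthonormal
  \<open>v\<^sub>i\<close>, a mixed volume up to a factor, and a coefficient of the polynomial \<open>|A + \<Sum> t\<^sub>i [0, v\<^sub>i]|\<close>. The
  inequality for two segments says that \<open>|A + [0, x]| / |A|\<close> decreases when segments are added to \<open>A\<close>, which
  gives submodularity; comparing the leading coefficients in submodularity for long segments then
  gives \<open>[A] [A; v, w] \<le> [A; v] [A; w]\<close> for lists \<open>v\<close> and \<open>w\<close>. The passage to zonoids is by continuity.\<close>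

section \<open>Determinants and mixed determinant sums\<close>

text \<open>The bracket is computed by deciding for each generator whether it is skipped or chosen.
  This recursion mirrors the geometric identity |A + [0, x]| = |A| + |P A + [0, x]|, with P the
  orthogonal projection along x, and so yields the volume formula for zonotopes. Projections need no
  theory of volume of their own: attaching the unit cube spanned by orthonormal vectors to a
  projection of A gives a body of full dimension, which is again a zonotope if A is one. The
  obstacle to comparing ratios of volumes is that volumes may vanish; monotonicity in the generators
  takes care of this. The conditions on projections give the pair inequality only for orthonormal x
  and y, and linear maps remove that restriction. Mixed volumes are given by a definite description,
  so for zonoids both existence and uniqueness of the Minkowski coefficients are at stake;
  polarization, which writes them as alternating sums of volumes, settles uniqueness and lets them
  pass to the limit. Brackets with more than n prescribed vectors are 0 by convention, which makes n
  = 1 fit the general pattern.\<close>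

definition absdet :: "(real^'n) list \<Rightarrow> real" where
  "absdet xs = (if length xs = CARD('n) then \<bar>det_vecs xs\<bar> else 0)"

text \<open>The enumeration chosen inside \<open>det_vecs\<close>, named so that positions in a list
  can be matched with indices of the matrix.\<close>

definition col_index :: "'n::finite \<Rightarrow> nat" where
  "col_index = (SOME e. bij_betw e UNIV {..<CARD('n)})"

lemma bij_betw_col_index: "bij_betw (col_index :: 'n::finite \<Rightarrow> nat) UNIV {..<CARD('n)}"
proof -
  have "\<exists>e::'n \<Rightarrow> nat. bij_betw e UNIV {..<CARD('n)}"
    using ex_bij_betw_finite_nat[of "UNIV :: 'n set"] by (simp add: atLeast0LessThan)
  then show ?thesis unfolding col_index_def by (rule someI_ex)
qed

lemma col_index_less: "col_index (j::'n::finite) < CARD('n)"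
  using bij_betw_col_index[where 'n='n] by (auto simp: bij_betw_def)

lemma col_index_eq_iff: "col_index (i::'n::finite) = col_index j \<longleftrightarrow> i = j"
  using bij_betw_col_index[where 'n='n] by (auto simp: bij_betw_def inj_on_def)

lemma obtain_col_index:
  assumes "m < CARD('n)" obtains j where "col_index (j::'n::finite) = m"
  using bij_betw_col_index[where 'n='n] assms by (metis bij_betw_def imageE lessThan_iff)

lemma det_vecs_cols: "det_vecs xs = det (\<chi> i j. (xs ! col_index j) $ i)"
  by (simp add: det_vecs_def col_index_def)

lemma det_vecs_rows: "det_vecs xs = det (\<chi> j. xs ! col_index j)"
proof -
  have "transpose (\<chi> j. xs ! col_index j) = (\<chi> i j. (xs ! col_index j) $ i)"
    by (simp add: transpose_def)
  then show ?thesis by (metis det_vecs_cols det_transpose)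
qed

lemma absdet_nonneg [simp]: "0 \<le> absdet xs"
  by (simp add: absdet_def)

text \<open>Conjugation by the enumeration turns a permutation of list positions into a permutation
  of the index type, and permuting rows changes a determinant only by a sign.\<close>

lemma absdet_mset_cong:
  fixes xs ys :: "(real^'n) list"
  assumes "mset xs = mset ys" shows "absdet xs = absdet ys"
proof (cases "length ys = CARD('n)")
  case True
  obtain p where p: "p permutes {..<length ys}" "permute_list p ys = xs"
    using mset_eq_permutation[OF assms] .
  define e where "e = (col_index :: 'n \<Rightarrow> nat)"
  have e: "bij_betw e UNIV {..<CARD('n)}" by (simp add: e_def bij_betw_col_index)
  define q where "q = inv e \<circ> p \<circ> e"
  have pb: "bij_betw p {..<CARD('n)} {..<CARD('n)}"
    using p(1) True by (simp add: permutes_imp_bij)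
  have "bij_betw (inv e) {..<CARD('n)} UNIV" using e by (rule bij_betw_inv_into)
  then have "bij_betw q UNIV UNIV"
    unfolding q_def using e pb by (meson bij_betw_trans)
  then have q: "q permutes UNIV" by (intro bij_imp_permutes) auto
  have eq: "e (q j) = p (e j)" for j
  proof -
    have "p (e j) \<in> {..<CARD('n)}" using e pb by (meson UNIV_I bij_betwE)
    then show ?thesis unfolding q_def o_def using e by (metis bij_betw_inv_into_right)
  qed
  have xs: "xs ! e j = ys ! e (q j)" for j
  proof -
    have "e j < length ys" using True col_index_less[of j] by (simp add: e_def)
    then have "permute_list p ys ! e j = ys ! p (e j)"
      by (rule permute_list_nth[OF p(1)])
    then show ?thesis using p(2) by (simp add: eq)
  qed
  have "det (\<chi> j. xs ! e j) = of_int (sign q) * det (\<chi> j. ys ! e j)"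
    using det_permute_rows[OF q, of "\<chi> j. ys ! e j"] unfolding xs vec_lambda_beta .
  moreover have "\<bar>of_int (sign q)\<bar> = (1::real)"
    by (simp add: sign_def)
  ultimately show ?thesis
    using assms mset_eq_length[OF assms]
    by (simp add: absdet_def det_vecs_rows e_def abs_mult)
next
  case False
  then show ?thesis using mset_eq_length[OF assms] by (simp add: absdet_def)
qed

text \<open>The vector \<open>x\<close> also occurs in the tail, hence as another row of the matrix,
  so this is an elementary row operation.\<close>

lemma absdet_add_scale:
  fixes M :: "(real^'n) list"
  assumes "x \<in> set M" shows "absdet ((y + c *\<^sub>R x) # M) = absdet (y # M)"
proof (cases "Suc (length M) = CARD('n)")
  case True
  obtain m where m: "m < length M" "M ! m = x" using assms by (meson in_set_conv_nth)
  obtain i where i: "col_index (i::'n) = 0" using obtain_col_index[of 0, where 'n='n] by auto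
  obtain j where j: "col_index (j::'n) = Suc m" using obtain_col_index[of "Suc m", where 'n='n] m True by auto
  have ij: "i \<noteq> j" using i j by auto
  define A where "A = (\<chi> j::'n. (y # M) ! col_index j)"
  have "(\<chi> j::'n. ((y + c *\<^sub>R x) # M) ! col_index j) =
        (\<chi> k. if k = i then row i A + c *s row j A else row k A)"
  proof (subst vec_eq_iff, rule allI)
    fix k
    show "(\<chi> j::'n. ((y + c *\<^sub>R x) # M) ! col_index j) $ k =
          (\<chi> k. if k = i then row i A + c *s row j A else row k A) $ k"
    proof (cases "k = i")
      case True
      then show ?thesis
        using i j m by (simp add: row_def A_def scalar_mult_eq_scaleR vec_eq_iff)
    next
      case False
      then have "col_index k \<noteq> 0" using i col_index_eq_iff by metis
      then obtain r where "col_index k = Suc r" using not0_implies_Suc by blast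
      then show ?thesis using False by (simp add: row_def A_def vec_eq_iff)
    qed
  qed
  then have "det_vecs ((y + c *\<^sub>R x) # M) = det A"
    using det_row_operation[OF ij, of A c] by (simp add: det_vecs_rows)
  then show ?thesis using True by (simp add: absdet_def det_vecs_rows A_def)
next
  case False
  then show ?thesis by (simp add: absdet_def)
qed

lemma absdet_scale:
  fixes M :: "(real^'n) list"
  shows "absdet ((c *\<^sub>R x) # M) = \<bar>c\<bar> * absdet (x # M)"
proof (cases "Suc (length M) = CARD('n)")
  case True
  obtain i where i: "col_index (i::'n) = 0" using obtain_col_index[of 0, where 'n='n] by auto
  have *: "(\<chi> k::'n. (z # M) ! col_index k) =
        (\<chi> k. if k = i then z else M ! (col_index k - 1))" for z
  proof (subst vec_eq_iff, rule allI)
    fix k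
    show "(\<chi> k::'n. (z # M) ! col_index k) $ k =
        (\<chi> k. if k = i then z else M ! (col_index k - 1)) $ k"
    proof (cases "k = i")
      case False
      then have "col_index k \<noteq> 0" using i col_index_eq_iff by metis
      then show ?thesis using False by (cases "col_index k") auto
    qed (simp add: i)
  qed
  have "det_vecs ((c *\<^sub>R x) # M) = c * det_vecs (x # M)"
    unfolding det_vecs_rows * using det_row_mul[of i c "\<lambda>_. x" "\<lambda>k. M ! (col_index k - 1)"]
    unfolding scalar_mult_eq_scaleR .
  then show ?thesis using True by (simp add: absdet_def abs_mult)
next
  case False
  then show ?thesis by (simp add: absdet_def)
qed

lemma absdet_add_span:
  fixes M :: "(real^'n) list"
  assumes "d \<in> span (set M)" shows "absdet ((y + d) # M) = absdet (y # M)"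
  using assms
proof (induction arbitrary: y rule: span_induct_alt)
  case (step c x d)
  have "absdet ((y + (c *\<^sub>R x + d)) # M) = absdet (((y + d) + c *\<^sub>R x) # M)"
    by (simp add: algebra_simps)
  also have "\<dots> = absdet ((y + d) # M)" using absdet_add_scale[OF step(1)] .
  also have "\<dots> = absdet (y # M)" by (rule step.IH)
  finally show ?case .
qed simp

lemma absdet_span_eq_0:
  fixes M :: "(real^'n) list"
  assumes "d \<in> span (set M)" shows "absdet (d # M) = 0"
  using absdet_add_span[OF assms, of 0] absdet_scale[of 0 d M] by simp

lemma absdet_linear:
  fixes xs :: "(real^'n) list"
  assumes "linear f" shows "absdet (map f xs) = \<bar>det (matrix f)\<bar> * absdet xs"
proof (cases "length xs = CARD('n)")
  case True
  have "(\<chi> i j::'n. (map f xs ! col_index j) $ i) = matrix f ** (\<chi> i j::'n. (xs ! col_index j) $ i)"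
  proof -
    have "f (xs ! col_index j) $ i = (\<Sum>k\<in>UNIV. matrix f $ i $ k * (xs ! col_index j) $ k)" for i and j::'n
      using fun_cong[OF matrix_vector_mul(2)[OF assms], of "xs ! col_index j"]
      by (simp add: matrix_vector_mult_def vec_eq_iff)
    moreover have "map f xs ! col_index (j::'n) = f (xs ! col_index j)" for j
      using True col_index_less[of j] by simp
    ultimately show ?thesis by (simp add: vec_eq_iff matrix_matrix_mult_def)
  qed
  then show ?thesis using True by (simp add: absdet_def det_vecs_cols det_mul abs_mult)
qed (simp add: absdet_def)

section \<open>Mixed determinant sums and their invariance properties\<close>

text \<open>\<open>zdet vs us\<close> is \<open>[A; vs]\<close> for the zonotope \<open>A\<close> generated by \<open>us\<close>.\<close>

primrec zdet :: "(real^'n) list \<Rightarrow> (real^'n) list \<Rightarrow> real" where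
  "zdet vs [] = absdet vs"
| "zdet vs (u # us) = zdet vs us + zdet (u # vs) us"

lemma zdet_nonneg [simp]: "0 \<le> zdet vs us"
  by (induction us arbitrary: vs) auto

lemma zdet_mset_cong: "mset vs = mset vs' \<Longrightarrow> zdet vs us = zdet vs' us"
proof (induction us arbitrary: vs vs')
  case (Cons u us)
  have "zdet vs us = zdet vs' us" using Cons.prems by (rule Cons.IH)
  moreover have "zdet (u # vs) us = zdet (u # vs') us"
    using Cons.prems by (intro Cons.IH) simp
  ultimately show ?case by simp
qed (auto intro: absdet_mset_cong)

text \<open>Transfers a proportionality from single determinants to their sums. The hypothesis
  speaks of every list containing \<open>vs\<close> because the recursion keeps moving generators
  into the list of prescribed vectors.\<close>

lemma zdet_head_cong:
  assumes "\<And>M. set vs \<subseteq> set M \<Longrightarrow> absdet (a # M) = c * absdet (b # M)"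
  shows "zdet (a # vs) us = c * zdet (b # vs) us"
  using assms
proof (induction us arbitrary: vs)
  case (Cons u us)
  have "zdet (a # u # vs) us = c * zdet (b # u # vs) us"
    using Cons.prems by (intro Cons.IH) auto
  moreover have "zdet (u # a # vs) us = zdet (a # u # vs) us" "zdet (u # b # vs) us = zdet (b # u # vs) us"
    by (rule zdet_mset_cong; simp)+
  moreover have "zdet (a # vs) us = c * zdet (b # vs) us"
    using Cons.prems by (rule Cons.IH)
  ultimately show ?case by (simp add: distrib_left)
qed simp

lemma zdet_add_span:
  assumes "d \<in> span (set vs)" shows "zdet ((y + d) # vs) us = zdet (y # vs) us"
proof -
  have "zdet ((y + d) # vs) us = 1 * zdet (y # vs) us"
    using assms span_mono by (intro zdet_head_cong) (auto intro!: absdet_add_span)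
  then show ?thesis by simp
qed

lemma zdet_scale: "zdet ((c *\<^sub>R x) # vs) us = \<bar>c\<bar> * zdet (x # vs) us"
  by (rule zdet_head_cong) (rule absdet_scale)

lemma zdet_span_eq_0:
  assumes "d \<in> span (set vs)" shows "zdet (d # vs) us = 0"
  using zdet_add_span[OF assms, of 0 us] zdet_scale[of 0 d vs us] by simp

lemma zdet_linear:
  assumes "linear f" shows "zdet (map f vs) (map f us) = \<bar>det (matrix f)\<bar> * zdet vs us"
proof (induction us arbitrary: vs)
  case (Cons u us)
  show ?case using Cons.IH[of vs] Cons.IH[of "u # vs"] by (simp add: distrib_left)
qed (simp add: absdet_linear[OF assms])

text \<open>Generators count only modulo the span of the prescribed vectors. This is the algebraic
  reason why a bracket measures a projection: generators may be replaced by their components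
  orthogonal to \<open>vs\<close>.\<close>

lemma zdet_map_mod_span:
  assumes "\<And>u. u \<in> set us \<Longrightarrow> f u - u \<in> span (set vs)"
  shows "zdet vs (map f us) = zdet vs us"
  using assms
proof (induction us arbitrary: vs)
  case (Cons u us)
  have sub: "span (set vs) \<subseteq> span (set (f u # vs))" by (rule span_mono) auto
  have "zdet (f u # vs) (map f us) = zdet (f u # vs) us"
    using Cons.prems sub by (intro Cons.IH) auto
  also have "\<dots> = zdet (u # vs) us"
    using zdet_add_span[of "f u - u" vs u us] Cons.prems by simp
  finally show ?case using Cons.IH[of vs] Cons.prems by simp
qed simp

lemma zdet_length_gt:
  assumes "length vs > CARD('n)" shows "zdet (vs :: (real^'n) list) us = 0"
  using assms by (induction us arbitrary: vs) (auto simp: absdet_def)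

lemma zdet_append_mono: "zdet vs us \<le> zdet vs (ws @ us)"
  by (induction ws) (auto intro: order_trans)

text \<open>Every determinant with a zero column vanishes. Padding with zeros makes any list long
  enough for the requirement k \<ge> n.\<close>

lemma zdet_zeros: "zdet vs (us @ replicate r 0) = zdet vs us"
proof -
  have "zdet vs (replicate r 0) = zdet vs []" for vs :: "(real^'n) list"
    by (induction r arbitrary: vs) (simp_all add: absdet_span_eq_0 span_zero)
  then show ?thesis by (induction us arbitrary: vs) auto
qed

text \<open>The induction inserts a new minimum, which becomes the head of the sorted list and thus
  fits the recursion of \<open>zdet\<close>; subsets with and without it correspond to choosing and
  skipping.\<close>

lemma zdet_subset_sum:
  fixes u :: "nat \<Rightarrow> real^'n"
  assumes "finite S"
  shows "zdet vs (map u (sorted_list_of_set S)) =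
    (\<Sum>I\<in>Pow S. absdet (vs @ map u (sorted_list_of_set I)))"
  using assms
proof (induction S arbitrary: vs rule: finite_linorder_min_induct)
  case (insert b A)
  have b: "b \<notin> A" using insert.hyps by blast
  have [simp]: "sorted_list_of_set (insert b I) = b # sorted_list_of_set I" if "I \<subseteq> A" for I
  proof -
    have "finite I" using that insert.hyps(1) finite_subset by blast
    moreover have "\<forall>x\<in>I. b < x" using that insert.hyps by blast
    ultimately show ?thesis
      by (subst sorted_list_of_set_insert_remove) (auto simp: insort_is_Cons order.strict_implies_order)
  qed
  have "(\<Sum>I\<in>Pow (insert b A). absdet (vs @ map u (sorted_list_of_set I))) =
        (\<Sum>I\<in>Pow A. absdet (vs @ map u (sorted_list_of_set I))) +
        (\<Sum>I\<in>insert b ` Pow A. absdet (vs @ map u (sorted_list_of_set I)))"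
    unfolding Pow_insert using insert.hyps(1) b by (intro sum.union_disjoint) auto
  also have "(\<Sum>I\<in>insert b ` Pow A. absdet (vs @ map u (sorted_list_of_set I))) =
        (\<Sum>I\<in>Pow A. absdet (vs @ map u (sorted_list_of_set (insert b I))))"
    using b by (subst sum.reindex) (auto simp: inj_on_def)
  also have "\<dots> = (\<Sum>I\<in>Pow A. absdet ((u b # vs) @ map u (sorted_list_of_set I)))"
    by (intro sum.cong refl absdet_mset_cong) auto
  finally show ?case using insert.IH[of vs] insert.IH[of "u b # vs"] by simp
qed simp

text \<open>Subsets of the wrong size drop out because \<open>absdet\<close> is 0 there. The
  cardinality is compared in \<open>int\<close>: with more than n prescribed vectors no subset
  qualifies, whereas a truncated difference would admit the empty one.\<close>

lemma zdet_card_sum: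
  fixes u :: "nat \<Rightarrow> real^'n"
  assumes "finite S"
  shows "zdet vs (map u (sorted_list_of_set S)) =
    (\<Sum>I\<in>{I. I \<subseteq> S \<and> int (card I) = int CARD('n) - int (length vs)}.
       \<bar>det_vecs (vs @ map u (sorted_list_of_set I))\<bar>)"
proof -
  have "(\<Sum>I\<in>Pow S. absdet (vs @ map u (sorted_list_of_set I))) =
     (\<Sum>I\<in>{I. I \<subseteq> S \<and> int (card I) = int CARD('n) - int (length vs)}.
       \<bar>det_vecs (vs @ map u (sorted_list_of_set I))\<bar>)"
    using assms by (intro sum.mono_neutral_cong_right) (auto simp: absdet_def)
  then show ?thesis by (simp add: zdet_subset_sum[OF assms])
qed

section \<open>The volume of a zonotope\<close>

lemma compact_set_plus:
  fixes S T :: "'a::real_normed_vector set"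
  assumes "compact S" "compact T" shows "compact (S + T)"
proof -
  have "S + T = {x + y | x y. x \<in> S \<and> y \<in> T}" by (auto simp: set_plus_def)
  then show ?thesis using compact_sums[OF assms] by simp
qed

lemma linear_image_set_plus:
  assumes "linear f" shows "f ` (S + T) = f ` S + f ` T"
proof (intro set_eqI iffI)
  fix z assume "z \<in> f ` S + f ` T"
  then obtain a b where "a \<in> S" "b \<in> T" "z = f a + f b" by (auto elim!: set_plus_elim)
  then show "z \<in> f ` (S + T)"
    by (intro image_eqI[of _ _ "a + b"]) (auto simp: linear_add[OF assms])
qed (auto elim!: set_plus_elim simp: linear_add[OF assms] intro!: set_plus_intro imageI)

lemma compact_measurable_lborel: "compact S \<Longrightarrow> S \<in> fmeasurable lborel"
  by (simp add: fmeasurable_compact)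

lemma emeasure_lborel_translation:
  fixes S :: "'a::euclidean_space set"
  assumes "S \<in> sets borel" shows "emeasure lborel ((+) a ` S) = emeasure lborel S"
proof -
  have "emeasure lborel S = emeasure (distr lborel borel ((+) (- a))) S"
    by (simp add: lborel_distr_plus)
  also have "\<dots> = emeasure lborel ((+) (- a) -` S)"
    using assms by (subst emeasure_distr) auto
  also have "(+) (- a) -` S = (+) a ` S"
    by (auto simp: image_iff intro!: bexI[of _ "- a + x" for x])
  finally show ?thesis by simp
qed

lemma sets_borel_translation:
  fixes S :: "'a::euclidean_space set"
  assumes "S \<in> sets borel" shows "(+) a ` S \<in> sets borel"
proof -
  have "(+) a ` S = (+) (- a) -` S \<inter> space borel"
    by (auto simp: image_iff intro!: bexI[of _ "- a + x" for x])
  also have "\<dots> \<in> sets borel" using assms by (intro measurable_sets[of _ borel borel]) auto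
  finally show ?thesis .
qed

lemma measure_lborel_translation:
  fixes S :: "'a::euclidean_space set"
  assumes "compact S" shows "measure lborel ((+) a ` S) = measure lborel S"
  using emeasure_lborel_translation[of S a] assms by (simp add: measure_def borel_compact)

section \<open>The volume gained by adding a segment\<close>

text \<open>Fubini's theorem along \<open>x\<close> in disguise: on every line parallel to \<open>x\<close> meeting \<open>K\<close>, the sets
  \<open>(K + [0,x]) - K\<close> and \<open>P K + [0,x)\<close> are half-open segments of the same length as \<open>x\<close>, so that they
  are equidecomposable by integer translations along \<open>x\<close>.\<close>

lemma measure_plus_segment:
  fixes K :: "'a::euclidean_space set"
  assumes K: "compact K" "convex K" and x: "x \<noteq> 0"
  shows "measure lborel (K + closed_segment 0 x) = measure lborel K +
    measure lborel ((\<lambda>z. z - ((z \<bullet> x) / (x \<bullet> x)) *\<^sub>R x) ` K + closed_segment 0 x)"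
proof -
  define l where "l z = (z \<bullet> x) / (x \<bullet> x)" for z
  define P where "P z = z - l z *\<^sub>R x" for z
  have xx: "x \<bullet> x \<noteq> 0" using x by simp
  have l_add: "l (z + c *\<^sub>R x) = l z + c" for z c
    using xx by (simp add: l_def inner_add_left add_divide_distrib)
  have P_add: "P (z + c *\<^sub>R x) = P z" for z c
    by (simp add: P_def l_add algebra_simps)
  have l_P: "l (P z) = 0" for z
    using xx by (simp add: l_def P_def inner_diff_left)
  have decomp: "z = P z + l z *\<^sub>R x" for z by (simp add: P_def)
  have cont_l: "continuous_on A l" for A unfolding l_def by (intro continuous_intros) (use xx in auto)
  have cont_P: "continuous_on A P" for A unfolding P_def by (intro continuous_intros cont_l)
  have seg: "closed_segment 0 x = {t *\<^sub>R x | t. 0 \<le> t \<and> t \<le> 1}"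
    by (auto simp: closed_segment_def)
  define Q where "Q = P ` K"
  have cQ: "compact Q" unfolding Q_def by (intro compact_continuous_image cont_P K)
  define U where "U = K + closed_segment 0 x"
  have cU: "compact U" unfolding U_def by (intro compact_set_plus K compact_segment)
  have KU: "K \<subseteq> U" unfolding U_def by (intro set_zero_plus2[of "closed_segment 0 x" K, simplified add.commute]) simp
  define S where "S = U - K"
  have S_borel: "S \<in> sets borel" unfolding S_def using cU K by (intro sets.Diff borel_compact)
  \<comment> \<open>Half-open, so that every line parallel to \<open>x\<close> over \<open>Q\<close>
    meets \<open>R\<close> in exactly one representative of each class modulo integer multiples of
    \<open>x\<close>.\<close>
  define R where "R = {z. P z \<in> Q \<and> 0 \<le> l z \<and> l z < 1}"
  have P_borel: "P -` Q \<in> sets borel"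
    using measurable_sets[OF borel_measurable_continuous_onI[OF cont_P] borel_compact[OF cQ]] by simp
  have [measurable]: "l \<in> borel_measurable borel" by (intro borel_measurable_continuous_onI cont_l)
  have R_borel: "R \<in> sets borel"
  proof -
    have "R = P -` Q \<inter> {z \<in> space borel. 0 \<le> l z \<and> l z < 1}" by (auto simp: R_def)
    also have "\<dots> \<in> sets borel"
    proof (rule sets.Int[OF P_borel])
      show "{z \<in> space borel. 0 \<le> l z \<and> l z < 1} \<in> sets borel" by measurable
    qed
    finally show ?thesis .
  qed
  define T where "T k = {z \<in> R. z + of_int k *\<^sub>R x \<in> S}" for k :: int
  have T_borel: "T k \<in> sets borel" for k
  proof -
    have "T k = R \<inter> (+) (- of_int k *\<^sub>R x) ` S"
      by (auto simp: T_def image_iff algebra_simps intro!: bexI[of _ "z + of_int k *\<^sub>R x" for z])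
    then show ?thesis using R_borel sets_borel_translation[OF S_borel] by (metis sets.Int)
  qed
  \<comment> \<open>In the parameter \<open>s\<close>, the line meets \<open>K\<close> in a compact
    interval [a, b] and \<open>U\<close> in [a, b + 1]. Hence it meets \<open>S\<close> in (b, b +
    1], which contains exactly one integer, and the same holds after every shift of \<open>z\<close>
    along \<open>x\<close>.\<close>
  have fibre: "\<exists>b. \<forall>s. z + s *\<^sub>R x \<in> S \<longleftrightarrow> b < s \<and> s \<le> b + 1" if "P z \<in> Q" for z
  proof -
    define J where "J = {s. z + s *\<^sub>R x \<in> K}"
    obtain y where y: "y \<in> K" "P z = P y" using \<open>P z \<in> Q\<close> unfolding Q_def by blast
    have "z + (l y - l z) *\<^sub>R x = P z + l y *\<^sub>R x" by (simp add: P_def algebra_simps)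
    then have "z + (l y - l z) *\<^sub>R x = y" unfolding y(2) by (simp add: P_def)
    then have J_ne: "J \<noteq> {}" unfolding J_def using y(1) by (metis (mono_tags) empty_Collect_eq)
    have "J = (\<lambda>w. l w - l z) ` (K \<inter> P -` {P z})"
    proof (intro set_eqI iffI)
      fix s assume "s \<in> J"
      then show "s \<in> (\<lambda>w. l w - l z) ` (K \<inter> P -` {P z})"
        by (intro image_eqI[of _ _ "z + s *\<^sub>R x"]) (auto simp: J_def l_add P_add)
    next
      fix s assume "s \<in> (\<lambda>w. l w - l z) ` (K \<inter> P -` {P z})"
      then obtain w where w: "w \<in> K" "P w = P z" "s = l w - l z" by auto
      have "z + s *\<^sub>R x = P z + l w *\<^sub>R x" by (simp add: w P_def algebra_simps)
      also have "\<dots> = w" unfolding w(2)[symmetric] by (simp add: P_def)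
      finally have "z + s *\<^sub>R x = w" .
      then show "s \<in> J" using w by (simp add: J_def)
    qed
    moreover have "closed (P -` {P z})"
      using continuous_closed_vimage[of "{P z}" P] cont_P[of UNIV]
      by (simp add: continuous_on_eq_continuous_at)
    ultimately have "compact J"
      using K(1) by (auto intro!: compact_continuous_image continuous_intros cont_l)
    moreover have "convex J"
      unfolding J_def
    proof (rule convexI, clarify)
      fix s t u v :: real
      assume *: "z + s *\<^sub>R x \<in> K" "z + t *\<^sub>R x \<in> K" "0 \<le> u" "0 \<le> v" "u + v = 1"
      have "u *\<^sub>R (z + s *\<^sub>R x) + v *\<^sub>R (z + t *\<^sub>R x) = (u + v) *\<^sub>R z + (u * s + v * t) *\<^sub>R x"
        by (simp add: algebra_simps)
      then show "z + (u *\<^sub>R s + v *\<^sub>R t) *\<^sub>R x \<in> K" using convexD[OF K(2) *] *(5) by simp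
    qed
    ultimately obtain a b where ab: "J = {a..b}"
      using connected_compact_interval_1[of J] convex_connected by blast
    have "a \<le> b" using J_ne ab by simp
    have "z + s *\<^sub>R x \<in> U \<longleftrightarrow> a \<le> s \<and> s \<le> b + 1" for s
    proof
      assume "z + s *\<^sub>R x \<in> U"
      then obtain t w where t: "0 \<le> t" "t \<le> 1" "w \<in> K" "z + s *\<^sub>R x = w + t *\<^sub>R x"
        unfolding U_def seg by (auto elim!: set_plus_elim)
      then have "z + (s - t) *\<^sub>R x = w" by (simp add: algebra_simps)
      then have "s - t \<in> J" using t by (simp add: J_def)
      then show "a \<le> s \<and> s \<le> b + 1" using ab t by auto
    next
      assume s: "a \<le> s \<and> s \<le> b + 1"
      \<comment> \<open>The least amount by which \<open>s\<close> must be moved back to be at most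
        \<open>b\<close>.\<close>
      define t where "t = max 0 (s - b)"
      have "s - t \<in> J" "0 \<le> t" "t \<le> 1" using s \<open>a \<le> b\<close> by (auto simp: t_def ab)
      then have "z + (s - t) *\<^sub>R x \<in> K" "t *\<^sub>R x \<in> closed_segment 0 x" by (auto simp: J_def seg)
      then have "(z + (s - t) *\<^sub>R x) + t *\<^sub>R x \<in> U" unfolding U_def by (rule set_plus_intro)
      then show "z + s *\<^sub>R x \<in> U" by (simp add: algebra_simps)
    qed
    moreover have "z + s *\<^sub>R x \<in> K \<longleftrightarrow> a \<le> s \<and> s \<le> b" for s
      using ab by (auto simp: J_def)
    ultimately have "\<forall>s. z + s *\<^sub>R x \<in> S \<longleftrightarrow> b < s \<and> s \<le> b + 1"
      using \<open>a \<le> b\<close> by (auto simp: S_def)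
    then show ?thesis by blast
  qed
  have S_Q: "P w \<in> Q" if "w \<in> S" for w
  proof -
    obtain t v where "v \<in> K" "w = v + t *\<^sub>R x"
      using \<open>w \<in> S\<close> unfolding S_def U_def seg by (auto elim!: set_plus_elim)
    then show ?thesis by (simp add: P_add Q_def)
  qed
  have R_eq: "R = (\<Union>k. T k)"
  proof -
    have "\<exists>k::int. z + of_int k *\<^sub>R x \<in> S" if "z \<in> R" for z
    proof -
      obtain b where b: "\<And>s. z + s *\<^sub>R x \<in> S \<longleftrightarrow> b < s \<and> s \<le> b + 1"
        using fibre[of z] \<open>z \<in> R\<close> by (auto simp: R_def)
      \<comment> \<open>The unique integer in (b, b + 1].\<close>
      have "z + of_int (\<lfloor>b\<rfloor> + 1) *\<^sub>R x \<in> S" unfolding b by linarith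
      then show ?thesis by blast
    qed
    then show ?thesis by (auto simp: T_def)
  qed
  have T_disj: "disjoint_family T"
    unfolding disjoint_family_on_def
  proof (intro ballI impI)
    fix k m :: int assume "k \<noteq> m"
    have False if zT: "z \<in> T k" "z \<in> T m" for z
    proof -
      obtain b where b: "\<And>s. z + s *\<^sub>R x \<in> S \<longleftrightarrow> b < s \<and> s \<le> b + 1"
        using fibre[of z] zT by (auto simp: R_def T_def)
      then have "b < k" "k \<le> b + 1" "b < m" "m \<le> b + 1" using zT by (auto simp: T_def)
      then show False using \<open>k \<noteq> m\<close> by linarith
    qed
    then show "T k \<inter> T m = {}" by blast
  qed
  define T' where "T' k = (+) (of_int k *\<^sub>R x) ` T k" for k :: int
  \<comment> \<open>Since \<open>l\<close> takes values in [0, 1) on \<open>R\<close>, the integer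
    part of \<open>l\<close> recovers the translation. So the translated pieces are
    disjoint.\<close>
  have l_T': "\<lfloor>l w\<rfloor> = k" if "w \<in> T' k" for w k
    using that by (auto simp: T'_def T_def R_def l_add add.commute[of "_ *\<^sub>R x"] floor_eq_iff)
  have S_eq: "S = (\<Union>k. T' k)"
  proof (intro set_eqI iffI)
    fix w assume w: "w \<in> S"
    define z where "z = w + (- of_int \<lfloor>l w\<rfloor>) *\<^sub>R x"
    have "P z \<in> Q" "l z = l w - of_int \<lfloor>l w\<rfloor>" unfolding z_def P_add l_add using S_Q[OF w] by auto
    then have "z \<in> R" unfolding R_def by (simp; linarith)
    moreover have wz: "w = of_int \<lfloor>l w\<rfloor> *\<^sub>R x + z" by (simp add: z_def)
    ultimately have "z \<in> T \<lfloor>l w\<rfloor>" using w by (simp add: T_def add.commute)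
    then show "w \<in> (\<Union>k. T' k)" using wz unfolding T'_def by blast
  next
    fix w assume "w \<in> (\<Union>k. T' k)"
    then show "w \<in> S" by (auto simp: T'_def T_def add.commute)
  qed
  have T'_disj: "disjoint_family T'"
    unfolding disjoint_family_on_def using l_T' by blast
  have T'_borel: "T' k \<in> sets borel" for k
    unfolding T'_def by (intro sets_borel_translation T_borel)
  have "emeasure lborel S = (\<integral>\<^sup>+k. emeasure lborel (T' k) \<partial>count_space UNIV)"
    unfolding S_eq using T'_disj T'_borel by (intro emeasure_UN_countable) auto
  also have "\<dots> = (\<integral>\<^sup>+k. emeasure lborel (T k) \<partial>count_space UNIV)"
    unfolding T'_def by (simp add: emeasure_lborel_translation T_borel)
  also have "\<dots> = emeasure lborel R"
    unfolding R_eq using T_disj T_borel by (intro emeasure_UN_countable[symmetric]) auto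
  finally have SR: "measure lborel S = measure lborel R" by (simp add: measure_def)
  have "measure lborel U = measure lborel K + measure lborel S"
    unfolding S_def using compact_measurable_lborel[OF cU] compact_measurable_lborel[OF K(1)] KU
    by (subst measure_Diff) (auto simp: fmeasurable_def)
  \<comment> \<open>The closed prism exceeds the half-open one only within the hyperplane where
    \<open>l\<close> is 1, a null set.\<close>
  moreover have "measure lborel (Q + closed_segment 0 x) = measure lborel R"
  proof -
    have Q_seg: "Q + closed_segment 0 x = {z. P z \<in> Q \<and> 0 \<le> l z \<and> l z \<le> 1}"
    proof (intro set_eqI iffI)
      fix z assume "z \<in> Q + closed_segment 0 x"
      then obtain q t where q: "q \<in> Q" "z = q + t *\<^sub>R x" "0 \<le> t" "t \<le> 1"
        unfolding seg by (auto elim!: set_plus_elim)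
      have "l q = 0" using q(1) l_P by (auto simp: Q_def)
      moreover from this have "P q = q" by (simp add: P_def)
      ultimately show "z \<in> {z. P z \<in> Q \<and> 0 \<le> l z \<and> l z \<le> 1}" using q by (simp add: P_add l_add)
    next
      fix z assume "z \<in> {z. P z \<in> Q \<and> 0 \<le> l z \<and> l z \<le> 1}"
      then have "P z + l z *\<^sub>R x \<in> Q + closed_segment 0 x" by (auto simp: seg intro!: set_plus_intro)
      then show "z \<in> Q + closed_segment 0 x" using decomp[of z] by simp
    qed
    have cQs: "compact (Q + closed_segment 0 x)" by (intro compact_set_plus cQ compact_segment)
    have "l z = 1 \<longleftrightarrow> x \<bullet> z = x \<bullet> x" for z
      using xx by (simp add: l_def inner_commute divide_eq_eq)
    then have "negligible {z. l z = 1}" using negligible_hyperplane[of x "x \<bullet> x"] x by simp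
    moreover have "(Q + closed_segment 0 x - R) \<union> (R - (Q + closed_segment 0 x)) \<subseteq> {z. l z = 1}"
      unfolding Q_seg R_def by auto
    ultimately have "negligible ((Q + closed_segment 0 x - R) \<union> (R - (Q + closed_segment 0 x)))"
      by (rule negligible_subset)
    then have "measure lebesgue (Q + closed_segment 0 x) = measure lebesgue R"
      using measure_negligible_symdiff[of "Q + closed_segment 0 x" R] cQs
      by (simp add: fmeasurableD lmeasurable_compact)
    then show ?thesis using cQs R_borel by (simp add: measure_completion borel_compact)
  qed
  ultimately show ?thesis using SR by (simp add: U_def Q_def P_def l_def)
qed


section \<open>Invariance of Lebesgue measure under orthogonal transformations\<close>

text \<open>Rotation invariance of Lebesgue measure on \<open>real^'n\<close> is only available for a well-ordered type
  \<open>'n\<close>; the following copy of a finite type is one.\<close>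

typedef 'n ordered_index = "UNIV :: 'n set" by simp

lemma bij_Rep_ordered_index: "bij Rep_ordered_index"
  by (metis Abs_ordered_index_inverse Rep_ordered_index_inverse UNIV_I bijI')

instantiation ordered_index :: (finite) "{finite, wellorder}"
begin

definition less_eq_ordered_index :: "'a ordered_index \<Rightarrow> 'a ordered_index \<Rightarrow> bool" where
  "x \<le> y \<longleftrightarrow> col_index (Rep_ordered_index x) \<le> col_index (Rep_ordered_index y)"

definition less_ordered_index :: "'a ordered_index \<Rightarrow> 'a ordered_index \<Rightarrow> bool" where
  "x < y \<longleftrightarrow> col_index (Rep_ordered_index x) < col_index (Rep_ordered_index y)"

instance
proof
  show "finite (UNIV :: 'a ordered_index set)"
    using bij_betw_finite[OF bij_Rep_ordered_index[where 'a='a]] by simp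
next
  fix P :: "'a ordered_index \<Rightarrow> bool" and a
  assume step: "\<And>x. (\<And>y. y < x \<Longrightarrow> P y) \<Longrightarrow> P x"
  show "P a"
    by (induction "col_index (Rep_ordered_index a)" arbitrary: a rule: less_induct)
      (auto intro: step simp: less_ordered_index_def)
qed (auto simp: less_eq_ordered_index_def less_ordered_index_def col_index_eq_iff Rep_ordered_index_inject)

end

lemma prod_Basis_cart: "(\<Prod>b\<in>Basis. f b) = (\<Prod>i\<in>UNIV. f (axis i 1 :: real^'n))"
proof -
  have B: "(Basis :: (real^'n) set) = range (\<lambda>i. axis i 1)" by (auto simp: Basis_vec_def)
  have "inj (\<lambda>i::'n. axis i (1::real))" by (auto simp: inj_on_def axis_eq_axis)
  from prod.reindex[OF this, of f] show ?thesis unfolding B o_def .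
qed

definition to_ordered :: "real^'n \<Rightarrow> real^('n ordered_index)" where
  "to_ordered v = (\<chi> i. v $ Rep_ordered_index i)"

definition of_ordered :: "real^('n ordered_index) \<Rightarrow> real^'n" where
  "of_ordered v = (\<chi> i. v $ Abs_ordered_index i)"

lemma of_to_ordered [simp]: "of_ordered (to_ordered v) = v" "to_ordered (of_ordered w) = w"
  by (simp_all add: to_ordered_def of_ordered_def vec_eq_iff Abs_ordered_index_inverse
      Rep_ordered_index_inverse)

lemma linear_to_ordered: "linear to_ordered" "linear of_ordered"
  by (auto intro!: linearI simp: to_ordered_def of_ordered_def vec_eq_iff)

lemma inner_to_ordered: "to_ordered v \<bullet> to_ordered (w::real^'n) = v \<bullet> w"
  using sum.reindex_bij_betw[OF bij_Rep_ordered_index, of "\<lambda>i. v $ i * w $ i"]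
  by (simp add: inner_vec_def to_ordered_def)

lemma borel_measurable_to_ordered [measurable]:
  "(to_ordered :: real^'n \<Rightarrow> _) \<in> borel_measurable borel"
  "(of_ordered :: _ \<Rightarrow> real^'n) \<in> borel_measurable borel"
  using linear_to_ordered
  by (auto intro!: borel_measurable_continuous_onI linear_continuous_on simp: linear_conv_bounded_linear)

text \<open>Renaming coordinates turns boxes into boxes with the same side lengths, and Lebesgue
  measure is determined by its values on boxes.\<close>

lemma distr_to_ordered: "distr lborel borel (to_ordered :: real^'n \<Rightarrow> _) = lborel"
proof (rule lborel_eqI[symmetric])
  fix l u :: "real^('n ordered_index)"
  assume lu: "\<And>b. b \<in> Basis \<Longrightarrow> l \<bullet> b \<le> u \<bullet> b"
  then have lu': "l $ i \<le> u $ i" for i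
    by (metis axis_in_Basis_iff cart_eq_inner_axis Basis_real_def singletonI)
  have "to_ordered -` box l u = box (of_ordered l) (of_ordered u)"
    by (auto simp: mem_box_cart to_ordered_def of_ordered_def)
      (metis Abs_ordered_index_inverse Rep_ordered_index_inverse UNIV_I)+
  then have "emeasure (distr lborel borel to_ordered) (box l u) =
      emeasure lborel (box (of_ordered l) (of_ordered u))"
    by (simp add: emeasure_distr)
  also have "\<dots> = (\<Prod>b\<in>Basis. (of_ordered u - of_ordered l) \<bullet> b)"
    using lu' by (intro emeasure_lborel_box) (auto simp: Basis_vec_def inner_axis of_ordered_def)
  also have "(\<Prod>b\<in>Basis. (of_ordered u - of_ordered l) \<bullet> b) = (\<Prod>i\<in>UNIV. u $ Abs_ordered_index i - l $ Abs_ordered_index i)"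
    by (simp add: prod_Basis_cart inner_axis of_ordered_def)
  also have "\<dots> = (\<Prod>i\<in>UNIV. u $ i - l $ i)"
    using prod.reindex_bij_betw[OF bij_Rep_ordered_index,
        of "\<lambda>i. u $ Abs_ordered_index i - l $ Abs_ordered_index i"]
    by (simp add: Rep_ordered_index_inverse)
  also have "\<dots> = (\<Prod>b\<in>Basis. (u - l) \<bullet> b)"
    by (simp add: prod_Basis_cart inner_axis)
  finally show "emeasure (distr lborel borel to_ordered) (box l u) = (\<Prod>b\<in>Basis. (u - l) \<bullet> b)" .
qed simp

text \<open>The preimage of a box is its image under the inverse of \<open>T\<close>, which is again
  orthogonal and therefore preserves its volume.\<close>

lemma distr_lborel_orthogonal_wellorder:
  fixes T :: "real^'n::{finite,wellorder} \<Rightarrow> real^'n::_"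
  assumes T: "orthogonal_transformation T"
  shows "distr lborel borel T = lborel"
proof (rule lborel_eqI[symmetric])
  have [measurable]: "T \<in> borel_measurable borel"
    using orthogonal_transformation_linear[OF T]
    by (auto intro!: borel_measurable_continuous_onI linear_continuous_on simp: linear_conv_bounded_linear)
  fix l u :: "real^'n::_"
  assume lu: "\<And>b. b \<in> Basis \<Longrightarrow> l \<bullet> b \<le> u \<bullet> b"
  have inv: "orthogonal_transformation (inv T)" using T by (rule orthogonal_transformation_inv)
  have pre: "T -` box l u = inv T ` box l u"
    using orthogonal_transformation_bij[OF T] by (simp add: bij_vimage_eq_inv_image)
  have pre_borel: "T -` box l u \<in> sets borel"
    using measurable_sets[of T borel borel "box l u"] by simp
  have "measure lebesgue (inv T ` box l u) = measure lebesgue (box l u)"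
    by (rule measure_orthogonal_image[OF inv]) simp
  moreover have "inv T ` box l u \<in> lmeasurable"
    by (rule measurable_orthogonal_image[OF inv]) simp
  ultimately have "emeasure lebesgue (inv T ` box l u) = emeasure lebesgue (box l u)"
    by (metis emeasure_eq_measure2 lmeasurable_box)
  then have "emeasure lborel (inv T ` box l u) = emeasure lborel (box l u)"
    using pre_borel by (simp flip: pre)
  then show "emeasure (distr lborel borel T) (box l u) = (\<Prod>b\<in>Basis. (u - l) \<bullet> b)"
    using lu by (simp add: emeasure_distr pre emeasure_lborel_box)
qed simp

text \<open>Renaming coordinates is a measure-preserving isometry, so conjugation by it reduces the
  claim to an orthogonal transformation over the well-ordered copy of the index type.\<close>

lemma distr_lborel_orthogonal:
  fixes T :: "real^'n \<Rightarrow> real^'n"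
  assumes T: "orthogonal_transformation T"
  shows "distr lborel borel T = lborel"
proof -
  define T' where "T' = to_ordered \<circ> T \<circ> of_ordered"
  have lin: "linear T" using T by (rule orthogonal_transformation_linear)
  have "orthogonal_transformation T'"
    unfolding orthogonal_transformation_def T'_def
  proof (intro conjI allI)
    show "linear (to_ordered \<circ> T \<circ> of_ordered)" by (intro linear_compose linear_to_ordered lin)
    show "(to_ordered \<circ> T \<circ> of_ordered) v \<bullet> (to_ordered \<circ> T \<circ> of_ordered) w = v \<bullet> w" for v w
      using T inner_to_ordered[of "of_ordered v" "of_ordered w"]
      by (simp add: inner_to_ordered orthogonal_transformation_def)
  qed
  then have T': "distr lborel borel T' = lborel" by (rule distr_lborel_orthogonal_wellorder)
  have [measurable]: "T \<in> borel_measurable borel" using lin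
    by (auto intro!: borel_measurable_continuous_onI linear_continuous_on simp: linear_conv_bounded_linear)
  have [measurable]: "T' \<in> borel_measurable borel" unfolding T'_def by measurable
  have "lborel = distr (lborel :: (real^'n) measure) borel (of_ordered \<circ> to_ordered)"
    by (simp add: o_def distr_id2)
  also have "\<dots> = distr (distr lborel borel to_ordered) borel of_ordered"
    by (subst distr_distr) auto
  also have "\<dots> = distr lborel borel of_ordered" by (simp add: distr_to_ordered)
  finally have of: "distr lborel borel of_ordered = (lborel :: (real^'n) measure)" ..
  have "T = of_ordered \<circ> T' \<circ> to_ordered" by (simp add: T'_def o_def)
  then have "distr lborel borel T = distr (distr (distr lborel borel to_ordered) borel T') borel of_ordered"
    by (simp add: distr_distr o_assoc)
  also have "\<dots> = lborel" by (simp add: distr_to_ordered T' of)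
  finally show ?thesis .
qed

lemma measure_orthogonal_image_lborel:
  fixes T :: "real^'n \<Rightarrow> real^'n"
  assumes T: "orthogonal_transformation T" and S: "compact S"
  shows "measure lborel (T ` S) = measure lborel S"
proof -
  have lin: "linear T" using T by (rule orthogonal_transformation_linear)
  have cont: "continuous_on A T" for A using lin by (simp add: linear_continuous_on linear_conv_bounded_linear)
  have [measurable]: "T \<in> borel_measurable borel" using cont by (rule borel_measurable_continuous_onI)
  have "compact (T ` S)" using S cont by (rule compact_continuous_image[rotated])
  then have "emeasure (distr lborel borel T) (T ` S) = emeasure lborel (T -` (T ` S))"
    by (simp add: emeasure_distr borel_compact)
  also have "T -` (T ` S) = S"
    using orthogonal_transformation_inj[OF T] by (simp add: inj_vimage_image_eq)
  finally show ?thesis by (simp add: distr_lborel_orthogonal[OF T] measure_def)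
qed

text \<open>Up to translation, the zonotope with the given generators. A list admits repeated
  generators, and its recursion runs parallel to that of \<open>zdet\<close>.\<close>

definition seg_sum :: "'a::real_normed_vector list \<Rightarrow> 'a set" where
  "seg_sum us = sum_list (map (closed_segment 0) us)"

lemma seg_sum_simps [simp]:
  "seg_sum [] = {0}"
  "seg_sum (u # us) = closed_segment 0 u + seg_sum us"
  by (simp_all add: seg_sum_def)

lemma seg_sum_append: "seg_sum (us @ vs) = seg_sum us + seg_sum vs"
  by (simp add: seg_sum_def)

lemma compact_seg_sum [simp]: "compact (seg_sum us)"
  by (induction us) (auto intro: compact_set_plus)

lemma convex_seg_sum [simp]: "convex (seg_sum us)"
  by (induction us) (auto intro: convex_set_plus)

lemma zero_in_seg_sum [simp]: "0 \<in> seg_sum us"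
proof (induction us)
  case (Cons u us)
  have "0 + 0 \<in> closed_segment 0 u + seg_sum us" using Cons by (intro set_plus_intro) auto
  then show ?case by simp
qed simp

lemma seg_sum_ne [simp]: "seg_sum us \<noteq> {}"
  using zero_in_seg_sum by blast

lemma seg_sum_linear_image:
  assumes "linear f" shows "f ` seg_sum us = seg_sum (map f us)"
proof (induction us)
  case (Cons u us)
  have "f ` closed_segment 0 u = closed_segment 0 (f u)"
    using closed_segment_linear_image[OF assms, of 0 u] linear_0[OF assms] by simp
  then show ?case using Cons by (simp add: linear_image_set_plus[OF assms])
qed (simp add: linear_0[OF assms])

lemma seg_sum_subset_span: "seg_sum us \<subseteq> span (set us)"
proof (induction us)
  case (Cons u us)
  have "closed_segment 0 u \<subseteq> span (set (u # us))"
    by (auto simp: closed_segment_def intro: span_scale span_base)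
  moreover have "seg_sum us \<subseteq> span (set (u # us))"
    using Cons span_mono[of "set us" "set (u # us)"] by auto
  ultimately show ?case by (auto elim!: set_plus_elim intro: span_add)
qed simp

lemma mem_seg_sum_iff:
  "z \<in> seg_sum us \<longleftrightarrow>
    (\<exists>t. (\<forall>i<length us. 0 \<le> t i \<and> t i \<le> (1::real)) \<and> z = (\<Sum>i<length us. t i *\<^sub>R us ! i))"
proof (induction us arbitrary: z)
  case (Cons u us)
  show ?case
  proof
    assume "z \<in> seg_sum (u # us)"
    then obtain s w where s: "0 \<le> s" "s \<le> (1::real)" "w \<in> seg_sum us" "z = s *\<^sub>R u + w"
      by (auto simp: closed_segment_def elim!: set_plus_elim)
    then obtain t where t: "\<forall>i<length us. 0 \<le> t i \<and> t i \<le> (1::real)"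
      "w = (\<Sum>i<length us. t i *\<^sub>R us ! i)" using Cons by auto
    have "\<forall>i<length (u # us). 0 \<le> case_nat s t i \<and> case_nat s t i \<le> (1::real)"
      using s t by (auto split: nat.split)
    moreover have "z = (\<Sum>i<length (u # us). case_nat s t i *\<^sub>R (u # us) ! i)"
      using s t by (simp add: sum.lessThan_Suc_shift del: sum.lessThan_Suc)
    ultimately show "\<exists>t. (\<forall>i<length (u # us). 0 \<le> t i \<and> t i \<le> (1::real)) \<and>
        z = (\<Sum>i<length (u # us). t i *\<^sub>R (u # us) ! i)" by blast
  next
    assume "\<exists>t. (\<forall>i<length (u # us). 0 \<le> t i \<and> t i \<le> (1::real)) \<and>
        z = (\<Sum>i<length (u # us). t i *\<^sub>R (u # us) ! i)"
    then obtain t where t: "\<forall>i<Suc (length us). 0 \<le> t i \<and> t i \<le> (1::real)"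
      "z = t 0 *\<^sub>R u + (\<Sum>i<length us. t (Suc i) *\<^sub>R us ! i)"
      by (auto simp: sum.lessThan_Suc_shift simp del: sum.lessThan_Suc)
    have "(\<Sum>i<length us. t (Suc i) *\<^sub>R us ! i) \<in> seg_sum us"
      unfolding Cons using t by (intro exI[of _ "\<lambda>i. t (Suc i)"]) auto
    moreover have "t 0 *\<^sub>R u \<in> closed_segment 0 u"
      using t by (auto simp: closed_segment_def)
    ultimately show "z \<in> seg_sum (u # us)" using t by auto
  qed
qed simp

text \<open>The box is the image of the unit cube under \<open>g\<close>, which is a diagonal
  stretching \<open>D\<close> by the edge lengths followed by an orthogonal map \<open>T\<close>
  onto the edge directions. Both sides equal the product of the edge lengths, because
  \<open>T\<close> preserves volume and has determinant of absolute value 1.\<close>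

lemma measure_orthogonal_box:
  fixes xs :: "(real^'n) list"
  assumes len: "length xs = CARD('n)" and xs: "distinct xs" "pairwise orthogonal (set xs)" "0 \<notin> set xs"
  shows "measure lborel (seg_sum xs) = absdet xs"
proof -
  define y where "y j = xs ! col_index j" for j :: 'n
  define N where "N j = norm (y j)" for j
  have y_mem: "y j \<in> set xs" for j using len col_index_less[of j] by (simp add: y_def)
  have N_pos: "N j > 0" for j using y_mem[of j] xs(3) by (auto simp: N_def)
  have y_inner: "y i \<bullet> y j = (if i = j then (N i)\<^sup>2 else 0)" for i j
  proof (cases "i = j")
    case False
    then have "y i \<noteq> y j"
      using xs(1) len col_index_less[of i] col_index_less[of j]
      by (simp add: y_def nth_eq_iff_index_eq col_index_eq_iff)
    then show ?thesis using xs(2) y_mem False by (auto simp: pairwise_def orthogonal_def)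
  qed (simp add: N_def power2_norm_eq_inner)
  define T where "T v = (\<Sum>j\<in>UNIV. (v $ j / N j) *\<^sub>R y j)" for v :: "real^'n"
  define D where "D v = (\<chi> j. N j * v $ j)" for v :: "real^'n"
  define g where "g v = (\<Sum>j\<in>UNIV. v $ j *\<^sub>R y j)" for v :: "real^'n"
  have linT: "linear T"
    unfolding T_def
    by (intro linearI) (auto simp: algebra_simps sum.distrib scaleR_sum_right add_divide_distrib)
  have linD: "linear D"
    unfolding D_def by (intro linearI) (auto simp: algebra_simps vec_eq_iff)
  have "T v \<bullet> T w = v \<bullet> w" for v w
  proof -
    have "T v \<bullet> T w = (\<Sum>i\<in>UNIV. \<Sum>j\<in>UNIV. (v $ i / N i) * (w $ j / N j) * (y i \<bullet> y j))"
      unfolding T_def inner_sum_left inner_sum_right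
      by (rule trans[OF sum.swap]) (simp add: mult_ac)
    also have "\<dots> = (\<Sum>i\<in>UNIV. (v $ i / N i) * (w $ i / N i) * (N i)\<^sup>2)"
      unfolding y_inner by (simp add: if_distrib[of "\<lambda>c. _ * c"] sum.delta cong: if_cong)
    also have "\<dots> = v \<bullet> w"
      using N_pos by (auto simp: inner_vec_def power2_eq_square less_imp_neq[symmetric] intro!: sum.cong)
    finally show ?thesis .
  qed
  then have T: "orthogonal_transformation T" using linT by (simp add: orthogonal_transformation_def)
  have g: "g = T \<circ> D"
    using N_pos by (auto simp: g_def T_def D_def fun_eq_iff less_imp_neq[symmetric])
  have D_cbox: "D ` cbox 0 1 = cbox 0 (\<chi> j. N j)"
  proof (intro set_eqI iffI)
    fix z assume "z \<in> cbox 0 (\<chi> j. N j)"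
    then show "z \<in> D ` cbox 0 1"
      using N_pos by (intro image_eqI[of _ _ "\<chi> j. z $ j / N j"])
        (auto simp: D_def mem_box_cart vec_eq_iff less_imp_neq[symmetric] less_imp_le)
  qed (use N_pos in \<open>auto simp: D_def mem_box_cart mult_left_le less_imp_le\<close>)
  have "g ` cbox 0 1 = seg_sum xs"
  proof (intro set_eqI iffI)
    fix z assume "z \<in> g ` cbox 0 1"
    then obtain v where v: "v \<in> cbox 0 1" "z = g v" by blast
    define t where "t i = v $ (inv col_index i :: 'n)" for i
    have inv: "inv col_index (col_index j) = j" for j :: 'n
      using bij_betw_col_index[where 'n='n] by (simp add: bij_betw_def)
    have "z = (\<Sum>j\<in>(UNIV::'n set). t (col_index j) *\<^sub>R xs ! col_index j)"
      by (simp add: v g_def t_def inv y_def)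
    also have "\<dots> = (\<Sum>i<CARD('n). t i *\<^sub>R xs ! i)"
      by (rule sum.reindex_bij_betw[OF bij_betw_col_index])
    finally show "z \<in> seg_sum xs"
      unfolding mem_seg_sum_iff len using v
      by (intro exI[of _ t]) (auto simp: t_def mem_box_cart)
  next
    fix z assume "z \<in> seg_sum xs"
    then obtain t where t: "\<forall>i<CARD('n). 0 \<le> t i \<and> t i \<le> (1::real)" "z = (\<Sum>i<CARD('n). t i *\<^sub>R xs ! i)"
      unfolding mem_seg_sum_iff len by auto
    have "z = g (\<chi> j. t (col_index j))"
      unfolding t g_def y_def
      using sum.reindex_bij_betw[OF bij_betw_col_index[where 'n='n], of "\<lambda>i. t i *\<^sub>R xs ! i"] by simp
    moreover have "(\<chi> j. t (col_index j)) \<in> cbox 0 (1::real^'n)"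
      using t col_index_less[where 'n='n] by (simp add: mem_box_cart)
    ultimately show "z \<in> g ` cbox 0 1" by blast
  qed
  then have "measure lborel (seg_sum xs) = measure lborel (T ` cbox 0 (\<chi> j. N j))"
    unfolding g image_comp[symmetric] D_cbox by simp
  also have "\<dots> = measure lborel (cbox 0 (\<chi> j. N j))"
    by (rule measure_orthogonal_image_lborel[OF T compact_cbox])
  also have "\<dots> = (\<Prod>j\<in>UNIV. N j)"
  proof -
    have "0 \<in> cbox 0 (\<chi> j. N j)" using N_pos by (simp add: mem_box_cart less_imp_le)
    then have "cbox 0 (\<chi> j. N j) \<noteq> {}" by blast
    then show ?thesis by (simp add: content_cbox_cart)
  qed
  also have "\<dots> = \<bar>det (matrix D)\<bar>"
  proof -
    have "det (matrix D) = (\<Prod>j\<in>UNIV. matrix D $ j $ j)"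
      by (rule det_diagonal) (simp add: matrix_def D_def axis_def)
    then show ?thesis using N_pos by (simp add: matrix_def D_def axis_def prod_nonneg less_imp_le)
  qed
  also have "\<dots> = \<bar>det (matrix g)\<bar>"
    using T by (simp add: g matrix_compose linT linD det_mul abs_mult)
  also have "matrix g = (\<chi> i j. (xs ! col_index j) $ i)"
    by (simp add: matrix_def g_def axis_def y_def if_distrib[of "\<lambda>c. c *\<^sub>R _"] sum.delta cong: if_cong)
  finally show ?thesis using len by (simp add: absdet_def det_vecs_cols)
qed

text \<open>The list \<open>vs\<close> is a box already split off and \<open>us\<close> are
  generators orthogonal to it. Removing \<open>x\<close> from \<open>us\<close>,
  \<open>measure_plus_segment\<close> splits the volume into the part without \<open>x\<close> and
  the part where everything is projected along \<open>x\<close> and \<open>x\<close> has become a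
  further edge of the box. These are the two branches of \<open>zdet\<close>.\<close>

lemma measure_seg_sum_orthogonal:
  fixes vs us :: "(real^'n) list"
  assumes "distinct vs" "pairwise orthogonal (set vs)" "0 \<notin> set vs"
    and "\<And>u v. u \<in> set us \<Longrightarrow> v \<in> set vs \<Longrightarrow> orthogonal u v"
  shows "measure lborel (seg_sum (vs @ us)) = zdet vs us"
  using assms
proof (induction "length us" arbitrary: vs us)
  case 0
  have ind: "independent (set vs)" using 0 by (intro pairwise_orthogonal_independent) auto
  have "length vs = card (set vs)" using 0 by (simp add: distinct_card)
  then have len: "length vs \<le> CARD('n)" using independent_bound[OF ind] by simp
  show ?case
  proof (cases "length vs = CARD('n)")
    case True
    then show ?thesis using 0 by (simp add: measure_orthogonal_box)
  next
    case False
    \<comment> \<open>With fewer than n edges the box is flat, so its volume is 0, as is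
      \<open>absdet\<close> by its default value.\<close>
    have "dim (seg_sum vs) \<le> length vs"
      using dim_mono[OF seg_sum_subset_span[of vs]] dim_le_card'[of "set vs"] card_length[of vs] by simp
    then have "negligible (seg_sum vs)" using False len by (intro negligible_lowdim) simp
    then have "measure lebesgue (seg_sum vs) = 0" by (rule negligible_imp_measure0)
    then show ?thesis using 0 False compact_seg_sum[of vs]
      by (simp add: absdet_def measure_completion borel_compact)
  qed
next
  case (Suc k)
  then obtain x us' where us: "us = x # us'" by (cases us) auto
  have IH: "measure lborel (seg_sum (vs @ us')) = zdet vs us'"
    using Suc.hyps(2) Suc.prems by (intro Suc.hyps(1)) (auto simp: us)
  have reorder: "seg_sum (vs @ us) = seg_sum (vs @ us') + closed_segment 0 x"
    by (simp add: us seg_sum_append ac_simps)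
  show ?case
  proof (cases "x = 0")
    case True
    then show ?thesis using IH by (simp add: us seg_sum_append zdet_span_eq_0 span_zero)
  next
    case False
    define P where "P z = z - ((z \<bullet> x) / (x \<bullet> x)) *\<^sub>R x" for z
    have lin: "linear P"
      unfolding P_def by (intro linearI) (auto simp: algebra_simps inner_add_left add_divide_distrib)
    have Pv: "P v = v" if "v \<in> set vs" for v
      using Suc.prems(4)[of x v] that by (simp add: us P_def orthogonal_def inner_commute)
    have Px: "P z \<bullet> x = 0" for z
      using False by (simp add: P_def inner_diff_left)
    have "measure lborel (seg_sum (vs @ us)) = measure lborel (seg_sum (vs @ us')) +
        measure lborel (P ` seg_sum (vs @ us') + closed_segment 0 x)"
      unfolding reorder P_def using False by (intro measure_plus_segment) auto
    also have "P ` seg_sum (vs @ us') + closed_segment 0 x = seg_sum ((x # vs) @ map P us')"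
    proof -
      have "P ` seg_sum (vs @ us') = seg_sum vs + seg_sum (map P us')"
        using Pv unfolding seg_sum_linear_image[OF lin] by (simp add: map_idI seg_sum_append)
      then show ?thesis by (simp add: seg_sum_append ac_simps)
    qed
    also have "measure lborel (seg_sum ((x # vs) @ map P us')) = zdet (x # vs) (map P us')"
    proof (rule Suc.hyps(1))
      show "k = length (map P us')" using Suc.hyps(2) by (simp add: us)
      have *: "orthogonal x v" if "v \<in> set vs" for v using Suc.prems(4) that by (simp add: us)
      then have "x \<notin> set vs" using False by (metis orthogonal_self)
      then show "distinct (x # vs)" using Suc.prems by simp
      show "pairwise orthogonal (set (x # vs))"
        using * Suc.prems(2) by (auto simp: pairwise_insert orthogonal_commute)
      show "0 \<notin> set (x # vs)" using False Suc.prems by simp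
      fix u v assume u: "u \<in> set (map P us')" and v: "v \<in> set (x # vs)"
      then obtain y where y: "y \<in> set us'" "u = P y" by auto
      show "orthogonal u v"
      proof (cases "v = x")
        case True then show ?thesis using y Px by (simp add: orthogonal_def)
      next
        case False
        then have "v \<in> set vs" using v by simp
        then have "y \<bullet> v = 0" "x \<bullet> v = 0" using Suc.prems(4) y by (auto simp: us orthogonal_def)
        then show ?thesis by (simp add: y P_def orthogonal_def inner_diff_left)
      qed
    qed
    \<comment> \<open>The projection alters each generator by a multiple of \<open>x\<close>, which
      now belongs to the prescribed vectors.\<close>
    also have "zdet (x # vs) (map P us') = zdet (x # vs) us'"
    proof (rule zdet_map_mod_span)
      fix u assume "u \<in> set us'"
      have "P u - u = (- ((u \<bullet> x) / (x \<bullet> x))) *\<^sub>R x" by (simp add: P_def)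
      then show "P u - u \<in> span (set (x # vs))"
        by (simp only:) (intro span_scale span_base; simp)
    qed
    finally show ?thesis using IH by (simp add: us)
  qed
qed

theorem measure_seg_sum:
  fixes us :: "(real^'n) list"
  shows "measure lborel (seg_sum us) = zdet [] us"
  using measure_seg_sum_orthogonal[of "[]" us] by simp

section \<open>Volumes of projections\<close>

definition orthonormal :: "'a::euclidean_space list \<Rightarrow> bool" where
  "orthonormal vs \<longleftrightarrow> distinct vs \<and> pairwise orthogonal (set vs) \<and> (\<forall>v\<in>set vs. norm v = 1)"

text \<open>For orthonormal \<open>vs\<close> this is the orthogonal projection onto the complement
  of their span; the explicit formula makes linearity and the difference from the identity
  immediate.\<close>

definition proj_along :: "'a::euclidean_space list \<Rightarrow> 'a \<Rightarrow> 'a" where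
  "proj_along vs z = z - (\<Sum>v\<in>set vs. (z \<bullet> v) *\<^sub>R v)"

lemma linear_proj_along: "linear (proj_along vs)"
  unfolding proj_along_def
  by (intro linearI) (auto simp: algebra_simps inner_add_left sum.distrib scaleR_sum_right)

lemma proj_along_diff_in_span: "proj_along vs z - z \<in> span (set vs)"
proof -
  have "(\<Sum>v\<in>set vs. (z \<bullet> v) *\<^sub>R v) \<in> span (set vs)"
    by (intro span_sum span_scale span_base)
  then show ?thesis using span_neg by (simp add: proj_along_def)
qed

lemma orthonormal_inner:
  assumes "orthonormal vs" "v \<in> set vs" "w \<in> set vs"
  shows "v \<bullet> w = (if v = w then 1 else 0)"
  using assms by (auto simp: orthonormal_def pairwise_def orthogonal_def norm_eq_1)

lemma proj_along_inner:
  assumes "orthonormal vs" "v \<in> set vs" shows "proj_along vs z \<bullet> v = 0"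
proof -
  have "(\<Sum>w\<in>set vs. (z \<bullet> w) * (w \<bullet> v)) = (\<Sum>w\<in>set vs. if w = v then z \<bullet> v else 0)"
    using orthonormal_inner[OF assms(1) _ assms(2)] by (intro sum.cong) auto
  then show ?thesis using assms(2) by (simp add: proj_along_def inner_diff_left inner_sum_left)
qed

lemma mem_orthogonal_comp_span:
  "x \<in> orthogonal_comp (span S) \<longleftrightarrow> (\<forall>v\<in>S. x \<bullet> v = 0)"
proof
  assume "x \<in> orthogonal_comp (span S)"
  then show "\<forall>v\<in>S. x \<bullet> v = 0"
    by (auto simp: orthogonal_comp_def orthogonal_def inner_commute span_base)
next
  assume *: "\<forall>v\<in>S. x \<bullet> v = 0"
  have "orthogonal x y" if "y \<in> span S" for y
    by (rule orthogonal_to_span[OF that]) (use * in \<open>auto simp: orthogonal_def\<close>)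
  then show "x \<in> orthogonal_comp (span S)"
    by (auto simp: orthogonal_comp_def orthogonal_commute)
qed

lemma orth_proj_orthogonal_comp:
  assumes "orthonormal vs"
  shows "orth_proj (orthogonal_comp (span (set vs))) z = proj_along vs z"
  unfolding orth_proj_def
proof (rule the_equality)
  let ?G = "orthogonal_comp (span (set vs))"
  have G: "proj_along vs z \<in> ?G"
    using proj_along_inner[OF assms] by (simp add: mem_orthogonal_comp_span)
  have orth: "orthogonal (z - proj_along vs z) w" if "w \<in> ?G" for w
  proof -
    have "z - proj_along vs z \<in> span (set vs)"
      using span_neg[OF proj_along_diff_in_span[of vs z]] by simp
    then show ?thesis using that by (simp add: orthogonal_comp_def)
  qed
  show "proj_along vs z \<in> ?G \<and> (\<forall>w\<in>?G. orthogonal (z - proj_along vs z) w)"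
    using G orth by blast
  fix y assume y: "y \<in> ?G \<and> (\<forall>w\<in>?G. orthogonal (z - y) w)"
  have "y - proj_along vs z \<in> ?G"
    using y G subspace_orthogonal_comp by (blast intro: subspace_diff)
  then have "orthogonal (z - y) (y - proj_along vs z)"
    "orthogonal (z - proj_along vs z) (y - proj_along vs z)" using y orth by auto
  then have "orthogonal (y - proj_along vs z) (y - proj_along vs z)"
    by (simp add: orthogonal_def inner_diff_left)
  then show "y = proj_along vs z" by (simp add: orthogonal_self)
qed

section \<open>Volumes of projections as volumes of prisms\<close>

lemma borel_vimage_inner:
  fixes d :: "'a::euclidean_space"
  assumes "A \<in> sets borel" shows "(\<lambda>z. z \<bullet> d) -` A \<in> sets borel"
  using measurable_sets[OF _ assms, of "\<lambda>z. z \<bullet> d" borel] by simp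

text \<open>Lebesgue measure is the image of a product measure. Arbitrary Borel sides are allowed
  because measurable rectangles will be used to identify a product measure.\<close>

lemma emeasure_lborel_Basis_rectangle:
  assumes "\<And>b. b \<in> Basis \<Longrightarrow> A b \<in> sets borel"
  shows "emeasure lborel {z::'a::euclidean_space. \<forall>b\<in>Basis. z \<bullet> b \<in> A b} = (\<Prod>b\<in>Basis. emeasure lborel (A b :: real set))"
proof -
  interpret product_sigma_finite "\<lambda>_::'a. lborel :: real measure" ..
  have B: "{z::'a. \<forall>b\<in>Basis. z \<bullet> b \<in> A b} \<in> sets borel"
  proof -
    have "{z::'a. \<forall>b\<in>Basis. z \<bullet> b \<in> A b} = (\<Inter>b\<in>Basis. (\<lambda>z. z \<bullet> b) -` A b \<inter> space borel)"
      by auto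
    also have "\<dots> \<in> sets borel"
      using assms by (intro sets.finite_INT measurable_sets[of _ borel borel]) auto
    finally show ?thesis .
  qed
  have "emeasure lborel {z::'a. \<forall>b\<in>Basis. z \<bullet> b \<in> A b} =
    emeasure (\<Pi>\<^sub>M b\<in>Basis. lborel)
      ((\<lambda>f. \<Sum>b\<in>Basis. f b *\<^sub>R b) -` {z::'a. \<forall>b\<in>Basis. z \<bullet> b \<in> A b} \<inter> space (\<Pi>\<^sub>M b\<in>Basis. lborel))"
    by (subst lborel_eq, subst emeasure_distr) (use B in auto)
  also have "(\<lambda>f. \<Sum>b\<in>Basis. f b *\<^sub>R b) -` {z::'a. \<forall>b\<in>Basis. z \<bullet> b \<in> A b} \<inter> space (\<Pi>\<^sub>M b\<in>Basis. lborel)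
     = Pi\<^sub>E Basis A"
    by (auto simp: space_PiM PiE_iff)
  also have "emeasure (\<Pi>\<^sub>M b\<in>Basis. lborel) (Pi\<^sub>E Basis A) = (\<Prod>b\<in>Basis. emeasure lborel (A b))"
    using assms by (intro emeasure_PiM) auto
  finally show ?thesis .
qed

text \<open>A bijection from \<open>Basis\<close> to \<open>D\<close> extends to an orthogonal
  transformation \<open>T\<close>, and the preimage under \<open>T\<close> of the rectangle has its
  sides along \<open>Basis\<close>.\<close>

lemma emeasure_lborel_orthonormal_rectangle:
  fixes D :: "(real^'n) set"
  assumes D: "pairwise orthogonal D" "\<And>d. d \<in> D \<Longrightarrow> norm d = 1" "span D = UNIV"
    and A: "\<And>d. d \<in> D \<Longrightarrow> A d \<in> sets borel"
  shows "emeasure lborel {z. \<forall>d\<in>D. z \<bullet> d \<in> A d} = (\<Prod>d\<in>D. emeasure lborel (A d :: real set))"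
proof -
  have "0 \<notin> D" using D(2) by force
  then have ind: "independent D" using D by (intro pairwise_orthogonal_independent) auto
  have finD: "finite D" using independent_bound[OF ind] by simp
  have "card D = DIM(real^'n)"
    using ind D(3) by (metis dim_UNIV dim_span_eq_card_independent)
  then have D_ne: "D \<noteq> {}" and "card (Basis :: (real^'n) set) = card D" by auto
  then obtain \<phi> where \<phi>: "bij_betw \<phi> (Basis :: (real^'n) set) D"
    using finite_same_card_bij[OF finite_Basis finD] by blast
  define T where "T z = (\<Sum>b\<in>Basis. (z \<bullet> b) *\<^sub>R \<phi> b)" for z :: "real^'n"
  have \<phi>_inner: "\<phi> b \<bullet> \<phi> c = (if b = c then 1 else 0)" if "b \<in> Basis" "c \<in> Basis" for b c
  proof -
    have "\<phi> b \<in> D" "\<phi> c \<in> D" "\<phi> b = \<phi> c \<longleftrightarrow> b = c"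
      using \<phi> that by (auto simp: bij_betw_def inj_on_eq_iff)
    then show ?thesis using D(1,2) by (auto simp: pairwise_def orthogonal_def norm_eq_1)
  qed
  have T_inner: "T z \<bullet> \<phi> b = z \<bullet> b" if "b \<in> Basis" for z b
  proof -
    have "T z \<bullet> \<phi> b = (\<Sum>c\<in>Basis. (z \<bullet> c) * (\<phi> c \<bullet> \<phi> b))" by (simp add: T_def inner_sum_left)
    also have "\<dots> = (\<Sum>c\<in>Basis. if c = b then z \<bullet> b else 0)"
      using that by (intro sum.cong) (auto simp: \<phi>_inner)
    finally show ?thesis using that by simp
  qed
  have linT: "linear T"
    unfolding T_def by (intro linearI) (auto simp: algebra_simps inner_add_left sum.distrib scaleR_sum_right)
  have "T z \<bullet> T w = z \<bullet> w" for z w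
  proof -
    have "T z \<bullet> T w = (\<Sum>b\<in>Basis. (w \<bullet> b) * (T z \<bullet> \<phi> b))"
      by (subst (2) T_def) (simp add: inner_sum_right)
    also have "\<dots> = (\<Sum>b\<in>Basis. (z \<bullet> b) * (w \<bullet> b))" by (simp add: T_inner mult.commute)
    also have "\<dots> = z \<bullet> w" by (rule euclidean_inner[symmetric])
    finally show ?thesis .
  qed
  then have T: "orthogonal_transformation T" using linT by (simp add: orthogonal_transformation_def)
  have Tm: "T \<in> borel_measurable borel" using linT
    by (auto intro!: borel_measurable_continuous_onI linear_continuous_on simp: linear_conv_bounded_linear)
  have rect: "{z. \<forall>d\<in>D. z \<bullet> d \<in> A d} \<in> sets borel"
  proof -
    have "{z. \<forall>d\<in>D. z \<bullet> d \<in> A d} = (\<Inter>d\<in>D. (\<lambda>z. z \<bullet> d) -` A d \<inter> space borel)"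
      by auto
    also have "\<dots> \<in> sets borel"
    proof (rule sets.finite_INT[OF finD])
      show "D \<noteq> {}" by (rule D_ne)
    qed (use A borel_vimage_inner in auto)
    finally show ?thesis .
  qed
  have "emeasure lborel {z. \<forall>d\<in>D. z \<bullet> d \<in> A d} = emeasure (distr lborel borel T) {z. \<forall>d\<in>D. z \<bullet> d \<in> A d}"
    by (simp add: distr_lborel_orthogonal[OF T])
  also have "\<dots> = emeasure lborel (T -` {z. \<forall>d\<in>D. z \<bullet> d \<in> A d})"
    using Tm rect by (simp add: emeasure_distr)
  also have "T -` {z. \<forall>d\<in>D. z \<bullet> d \<in> A d} = {z. \<forall>b\<in>Basis. z \<bullet> b \<in> A (\<phi> b)}"
    using \<phi> T_inner by (auto simp: bij_betw_def)
  also have "emeasure lborel \<dots> = (\<Prod>b\<in>Basis. emeasure lborel (A (\<phi> b)))"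
    using A \<phi> by (intro emeasure_lborel_Basis_rectangle) (auto simp: bij_betw_def)
  also have "\<dots> = (\<Prod>d\<in>D. emeasure lborel (A d))"
    by (rule prod.reindex_bij_betw[OF \<phi>])
  finally show ?thesis .
qed

text \<open>The right side is the volume of a prism with the projection as base and the unit cube
  spanned by \<open>vs\<close> as fibre. The basis \<open>B\<close> behind
  \<open>lborel_subspace\<close> is an arbitrary choice; together with \<open>vs\<close> it forms an
  orthonormal basis of the whole space, in which the prism is a product.\<close>

lemma proj_vol_eq_measure:
  fixes vs :: "(real^'n) list"
  assumes vs: "orthonormal vs" and A: "compact A"
  shows "proj_vol (orthogonal_comp (span (set vs))) A = measure lborel (proj_along vs ` A + seg_sum vs)"
proof -
  define G where "G = orthogonal_comp (span (set vs))"
  define B where "B = (SOME B. orthonormal_basis G B)"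
  define C where "C = set vs"
  have subG: "subspace G" unfolding G_def by (rule subspace_orthogonal_comp)
  have "\<exists>B. orthonormal_basis G B"
    using orthonormal_basis_subspace[OF subG] unfolding orthonormal_basis_def by metis
  then have "orthonormal_basis G B" unfolding B_def by (rule someI_ex)
  then have B: "B \<subseteq> G" "pairwise orthogonal B" "\<And>b. b \<in> B \<Longrightarrow> norm b = 1" "span B = G"
    by (auto simp: orthonormal_basis_def)
  have C: "pairwise orthogonal C" "\<And>c. c \<in> C \<Longrightarrow> norm c = 1" "finite C"
    using vs by (auto simp: orthonormal_def C_def)
  have BC: "b \<bullet> c = 0" "c \<bullet> b = 0" if "b \<in> B" "c \<in> C" for b c
  proof -
    show "b \<bullet> c = 0" using B(1) that by (auto simp: G_def C_def mem_orthogonal_comp_span)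
    then show "c \<bullet> b = 0" by (simp add: inner_commute)
  qed
  have disj: "B \<inter> C = {}"
  proof -
    have False if "b \<in> B" "b \<in> C" for b using BC(1)[OF that] B(3)[OF that(1)] by (simp add: norm_eq_1)
    then show ?thesis by blast
  qed
  define D where "D = B \<union> C"
  have D: "pairwise orthogonal D" "\<And>d. d \<in> D \<Longrightarrow> norm d = 1"
  proof -
    show "pairwise orthogonal D"
      using B(2) C(1) BC by (auto simp: D_def pairwise_def orthogonal_def)
    show "norm d = 1" if "d \<in> D" for d using that B(3) C(2) by (auto simp: D_def)
  qed
  have proj_G: "proj_along vs z \<in> G" for z
    using proj_along_inner[OF vs] by (simp add: G_def mem_orthogonal_comp_span)
  have spanD: "span D = UNIV"
  proof -
    have "z \<in> span D" for z
    proof -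
      have "proj_along vs z \<in> span D" using proj_G[of z] B(4) span_mono[of B D] by (auto simp: D_def)
      moreover have "proj_along vs z - z \<in> span D"
        using proj_along_diff_in_span[of vs z] span_mono[of C D] by (auto simp: D_def C_def)
      ultimately have "proj_along vs z - (proj_along vs z - z) \<in> span D" by (rule span_diff)
      then show ?thesis by simp
    qed
    then show ?thesis by blast
  qed
  have finD: "finite D"
    using D by (intro finiteI_independent pairwise_orthogonal_independent) force+
  then have finB: "finite B" by (simp add: D_def)
  have expand: "(\<Sum>b\<in>B. (z \<bullet> b) *\<^sub>R b) + (\<Sum>c\<in>C. (z \<bullet> c) *\<^sub>R c) = z" for z
  proof -
    have "(\<Sum>d\<in>D. (z \<bullet> d) *\<^sub>R d) = z"
      using D spanD finD by (intro orthonormal_basis_expand) auto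
    then show ?thesis unfolding D_def using finB C(3) disj by (simp add: sum.union_disjoint)
  qed
  have proj_B: "(\<Sum>b\<in>B. (z \<bullet> b) *\<^sub>R b) = proj_along vs z" for z
    using expand[of z] unfolding proj_along_def C_def[symmetric] by (simp add: eq_diff_eq)
  define slab where "slab = {z. \<forall>c\<in>C. z \<bullet> c \<in> {0..1}}"
  have closed_slab: "closed slab"
  proof -
    have "slab = (\<Inter>c\<in>C. {z. 0 \<le> c \<bullet> z} \<inter> {z. c \<bullet> z \<le> 1})" by (auto simp: slab_def inner_commute)
    then show ?thesis using closed_halfspace_ge[of 0] closed_halfspace_le[of _ 1]
      by (auto intro!: closed_INT closed_Int)
  qed
  then have slab_borel: "slab \<in> sets borel" by simp
  interpret product_sigma_finite "\<lambda>_::real^'n. lborel :: real measure" ..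
  define r where "r z = (\<lambda>b\<in>B. z \<bullet> b)" for z :: "real^'n"
  have r_meas: "r \<in> measurable borel (\<Pi>\<^sub>M b\<in>B. lborel)"
    unfolding r_def by (intro measurable_restrict) auto
  \<comment> \<open>The coordinates along \<open>B\<close> push Lebesgue measure on the slab forward
    to the product measure. Both agree on rectangles, since each direction in \<open>C\<close>
    contributes the factor 1, the length of the unit interval.\<close>
  have nu: "distr (density lborel (indicator slab)) (\<Pi>\<^sub>M b\<in>B. lborel) r = (\<Pi>\<^sub>M b\<in>B. lborel)"
  proof (rule PiM_eqI[OF finB])
    fix X :: "real^'n \<Rightarrow> real set" assume X: "\<And>b. b \<in> B \<Longrightarrow> X b \<in> sets lborel"
    have PiX: "Pi\<^sub>E B X \<in> sets (\<Pi>\<^sub>M b\<in>B. lborel)"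
      using X finB by (intro sets_PiM_I_finite) auto
    define Y where "Y d = (if d \<in> B then X d else {0..1})" for d
    have "emeasure (distr (density lborel (indicator slab)) (\<Pi>\<^sub>M b\<in>B. lborel) r) (Pi\<^sub>E B X) =
       emeasure (density lborel (indicator slab)) (r -` Pi\<^sub>E B X)"
      using r_meas PiX by (subst emeasure_distr) auto
    also have "\<dots> = emeasure lborel (slab \<inter> r -` Pi\<^sub>E B X)"
      using slab_borel measurable_sets[OF r_meas PiX] by (subst emeasure_restricted) auto
    also have "slab \<inter> r -` Pi\<^sub>E B X = {z. \<forall>d\<in>D. z \<bullet> d \<in> Y d}"
      using disj by (auto simp: slab_def r_def D_def Y_def PiE_iff)
    also have "emeasure lborel \<dots> = (\<Prod>d\<in>D. emeasure lborel (Y d))"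
      using D spanD X by (intro emeasure_lborel_orthonormal_rectangle) (auto simp: Y_def)
    also have "\<dots> = (\<Prod>d\<in>B. emeasure lborel (Y d)) * (\<Prod>d\<in>C. emeasure lborel (Y d))"
      unfolding D_def using finB C(3) disj by (rule prod.union_disjoint)
    also have "(\<Prod>d\<in>C. emeasure lborel (Y d)) = 1"
      using disj by (intro prod.neutral) (auto simp: Y_def)
    also have "(\<Prod>d\<in>B. emeasure lborel (Y d)) = (\<Prod>b\<in>B. emeasure lborel (X b))"
      by (simp add: Y_def)
    finally show "emeasure (distr (density lborel (indicator slab)) (\<Pi>\<^sub>M b\<in>B. lborel) r) (Pi\<^sub>E B X) =
       (\<Prod>b\<in>B. emeasure lborel (X b))" by simp
  qed simp
  define PA where "PA = proj_along vs ` A"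
  have "compact PA"
    unfolding PA_def using A linear_proj_along
    by (intro compact_continuous_image linear_continuous_on) (simp_all add: linear_conv_bounded_linear)
  then have PA_borel: "PA \<in> sets borel" by (rule borel_compact)
  define q where "q f = (\<Sum>b\<in>B. f b *\<^sub>R b)" for f :: "real^'n \<Rightarrow> real"
  have q_meas: "q \<in> measurable (\<Pi>\<^sub>M b\<in>B. lborel) borel"
    unfolding q_def by measurable
  have "orth_proj G ` A = PA"
    unfolding G_def PA_def by (simp add: orth_proj_orthogonal_comp[OF vs])
  then have "proj_vol G A = measure (distr (\<Pi>\<^sub>M b\<in>B. lborel) borel q) PA"
    by (simp add: proj_vol_def lborel_subspace_def B_def[symmetric] q_def[abs_def] Let_def)
  also have "\<dots> = measure (distr (density lborel (indicator slab)) borel (q \<circ> r)) PA"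
    by (subst nu[symmetric], subst distr_distr) (use q_meas r_meas in auto)
  also have "emeasure (distr (density lborel (indicator slab)) borel (q \<circ> r)) PA =
      emeasure (density lborel (indicator slab)) ((q \<circ> r) -` PA)"
    using measurable_comp[OF r_meas q_meas] PA_borel by (subst emeasure_distr) auto
  then have "measure (distr (density lborel (indicator slab)) borel (q \<circ> r)) PA =
      measure lborel (slab \<inter> (q \<circ> r) -` PA)"
    using slab_borel measurable_sets[OF measurable_comp[OF r_meas q_meas] PA_borel]
    by (simp add: measure_def emeasure_restricted)
  also have "slab \<inter> (q \<circ> r) -` PA = PA + seg_sum vs"
  proof -
    have qr: "(q \<circ> r) z = proj_along vs z" for z
      by (simp add: q_def r_def proj_B[symmetric])
    have len: "(\<Sum>i<length vs. f (vs ! i)) = (\<Sum>c\<in>C. f c)" for f :: "real^'n \<Rightarrow> real^'n"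
      using vs sum.reindex_bij_betw[OF bij_betw_nth[of vs "{..<length vs}" "set vs"], of f]
      by (simp add: orthonormal_def C_def)
    show ?thesis
    proof (intro set_eqI iffI)
      fix z assume z: "z \<in> slab \<inter> (q \<circ> r) -` PA"
      have "(\<Sum>c\<in>C. (z \<bullet> c) *\<^sub>R c) \<in> seg_sum vs"
        unfolding mem_seg_sum_iff
        using z by (intro exI[of _ "\<lambda>i. z \<bullet> vs ! i"])
          (auto simp: slab_def C_def len[of "\<lambda>c. (z \<bullet> c) *\<^sub>R c", unfolded C_def])
      moreover have "proj_along vs z \<in> PA" using z qr by simp
      ultimately have "proj_along vs z + (\<Sum>c\<in>C. (z \<bullet> c) *\<^sub>R c) \<in> PA + seg_sum vs" by blast
      then show "z \<in> PA + seg_sum vs" by (simp add: proj_along_def C_def)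
    next
      fix z assume "z \<in> PA + seg_sum vs"
      then obtain p w where pw: "p \<in> PA" "w \<in> seg_sum vs" "z = p + w" by (auto elim!: set_plus_elim)
      obtain x where x: "p = proj_along vs x" using pw(1) by (auto simp: PA_def)
      obtain t where t: "\<forall>i<length vs. 0 \<le> t i \<and> t i \<le> (1::real)" "w = (\<Sum>i<length vs. t i *\<^sub>R vs ! i)"
        using pw(2) unfolding mem_seg_sum_iff by auto
      have zc: "z \<bullet> vs ! i = t i" if "i < length vs" for i
      proof -
        have "w \<bullet> vs ! i = (\<Sum>j<length vs. t j * (vs ! j \<bullet> vs ! i))"
          by (simp add: t inner_sum_left)
        also have "\<dots> = (\<Sum>j<length vs. if j = i then t i else 0)"
          using that vs orthonormal_inner[OF vs]
          by (intro sum.cong) (auto simp: orthonormal_def nth_eq_iff_index_eq)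
        also have "\<dots> = t i" using that by simp
        finally have "w \<bullet> vs ! i = t i" .
        moreover have "p \<bullet> vs ! i = 0" using that by (simp add: x proj_along_inner[OF vs])
        ultimately show ?thesis by (simp add: pw(3) inner_add_left)
      qed
      have "z \<in> slab" using t(1) zc by (auto simp: slab_def C_def in_set_conv_nth)
      moreover have "proj_along vs z = p"
      proof -
        have "(\<Sum>c\<in>C. (z \<bullet> c) *\<^sub>R c) = (\<Sum>i<length vs. (z \<bullet> vs ! i) *\<^sub>R vs ! i)"
          using len[of "\<lambda>c. (z \<bullet> c) *\<^sub>R c"] by simp
        also have "\<dots> = w" unfolding t(2) using zc by (intro sum.cong) auto
        finally show ?thesis by (simp add: proj_along_def C_def pw(3))
      qed
      ultimately show "z \<in> slab \<inter> (q \<circ> r) -` PA" using pw(1) qr by simp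
    qed
  qed
  finally show ?thesis by (simp add: G_def PA_def)
qed

text \<open>After projection the generators are orthogonal to \<open>vs\<close>, so the volume
  formula with a split-off box applies, and the bracket does not notice the projection.\<close>

lemma proj_along_seg_sum_volume:
  fixes vs :: "(real^'n) list"
  assumes vs: "orthonormal vs"
  shows "measure lborel (proj_along vs ` seg_sum us + seg_sum vs) = zdet vs us"
proof -
  have "proj_along vs ` seg_sum us + seg_sum vs = seg_sum (vs @ map (proj_along vs) us)"
    by (simp add: seg_sum_linear_image[OF linear_proj_along] seg_sum_append ac_simps)
  also have "measure lborel \<dots> = zdet vs (map (proj_along vs) us)"
    using vs proj_along_inner[OF vs]
    by (intro measure_seg_sum_orthogonal) (auto simp: orthonormal_def orthogonal_def)
  also have "\<dots> = zdet vs us"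
    by (intro zdet_map_mod_span proj_along_diff_in_span)
  finally show ?thesis .
qed

section \<open>Zonoids as Hausdorff limits\<close>

lemma singleton_set_plus: "{a} + S = (+) a ` S"
  by (auto simp: set_plus_def)

lemma zonotope_iff:
  "zonotope Z \<longleftrightarrow> (\<exists>a us. Z = {a} + seg_sum us)"
proof
  assume "zonotope Z"
  then obtain N a b where Z: "Z = (\<Sum>i<(N::nat). closed_segment (a i) (b i))"
    unfolding zonotope_def by blast
  have seg: "closed_segment x y = {x} + closed_segment 0 (y - x)" for x y :: 'a
    using closed_segment_translation[of x 0 "y - x"] by (simp add: singleton_set_plus)
  have "(\<Sum>i<N. closed_segment (a i) (b i)) =
      {\<Sum>i<N. a i} + seg_sum (map (\<lambda>i. b i - a i) [0..<N])" for N
  proof (induction N)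
    case (Suc N)
    have "{x} + {y} = {x + y}" for x y :: 'a by (auto simp: set_plus_def)
    then have "{\<Sum>i<Suc N. a i} = {\<Sum>i<N. a i} + {a N}" by simp
    moreover have "(\<Sum>i<Suc N. closed_segment (a i) (b i)) =
        ({\<Sum>i<N. a i} + seg_sum (map (\<lambda>i. b i - a i) [0..<N])) + ({a N} + closed_segment 0 (b N - a N))"
      using Suc seg[of "a N" "b N"] by simp
    ultimately show ?case by (simp add: seg_sum_append ac_simps)
  qed simp
  then show "\<exists>a us. Z = {a} + seg_sum us" unfolding Z by blast
next
  assume "\<exists>a us. Z = {a} + seg_sum us"
  then obtain a us where Z: "Z = {a} + seg_sum us" by blast
  \<comment> \<open>The translation by \<open>a\<close> is supplied by the degenerate segment from
    \<open>a\<close> to \<open>a\<close>.\<close>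
  define ps where "ps = (a, a) # map (Pair 0) us"
  have "Z = (\<Sum>x\<leftarrow>ps. closed_segment (fst x) (snd x))"
    by (simp add: Z seg_sum_def o_def ps_def)
  also have "\<dots> = (\<Sum>i<length ps. closed_segment (fst (ps ! i)) (snd (ps ! i)))"
    by (simp add: sum_list_sum_nth atLeast0LessThan)
  finally show "zonotope Z" unfolding zonotope_def
    by (intro exI[of _ "length ps"] exI[of _ "\<lambda>i. fst (ps ! i)"] exI[of _ "\<lambda>i. snd (ps ! i)"])
qed

lemma zonotope_seg_sum [simp]: "zonotope (seg_sum us)"
  unfolding zonotope_iff by (intro exI[of _ 0] exI[of _ us]) simp

lemma zonotope_plus:
  assumes "zonotope X" "zonotope Y" shows "zonotope (X + Y)"
proof -
  obtain a us b vs where X: "X = {a} + seg_sum us" and Y: "Y = {b} + seg_sum vs"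
    using assms zonotope_iff by metis
  have "{a} + {b} = {a + b}" by (auto simp: set_plus_def)
  moreover have "X + Y = ({a} + {b}) + seg_sum (us @ vs)"
    by (simp add: X Y seg_sum_append ac_simps)
  ultimately show ?thesis unfolding zonotope_iff by auto
qed

lemma zonotope_linear_image:
  assumes "linear f" "zonotope X" shows "zonotope (f ` X)"
proof -
  obtain a us where "X = {a} + seg_sum us" using assms zonotope_iff by metis
  then have "f ` X = {f a} + seg_sum (map f us)"
    by (simp add: linear_image_set_plus assms seg_sum_linear_image)
  then show ?thesis unfolding zonotope_iff by blast
qed

lemma zonotope_compact: "zonotope Z \<Longrightarrow> compact Z"
  unfolding zonotope_iff by (auto intro!: compact_set_plus)

lemma zonotope_nonempty: "zonotope Z \<Longrightarrow> Z \<noteq> {}"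
  unfolding zonotope_iff singleton_set_plus by auto

lemma measure_translate_seg_sum:
  fixes us :: "(real^'n) list"
  shows "measure lborel ({a} + seg_sum us) = zdet [] us"
  by (simp add: singleton_set_plus measure_lborel_translation measure_seg_sum)

text \<open>Hausdorff convergence in terms of parallel bodies. In this form it passes to Minkowski
  sums and linear images by plain inclusions, without suprema of real functions that require bounded
  nonempty domains.\<close>

definition hconv :: "(nat \<Rightarrow> 'a::real_normed_vector set) \<Rightarrow> 'a set \<Rightarrow> bool" where
  "hconv X A \<longleftrightarrow> (\<forall>e>0. \<forall>\<^sub>F j in sequentially. X j \<subseteq> A + cball 0 e \<and> A \<subseteq> X j + cball 0 e)"

lemma hconv_const: "hconv (\<lambda>_. A) A"
  by (auto simp: hconv_def intro!: set_zero_plus2[where A = "cball 0 e" for e, simplified add.commute])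

lemma cball_plus_cball: "cball 0 d + cball 0 e \<subseteq> cball (0::'a::real_normed_vector) (d + e)"
proof
  fix z :: 'a assume "z \<in> cball 0 d + cball 0 e"
  then obtain x y where "norm x \<le> d" "norm y \<le> e" "z = x + y" by (auto elim!: set_plus_elim)
  then show "z \<in> cball 0 (d + e)" using norm_triangle_mono[of x d y e] by simp
qed

lemma hconv_plus:
  assumes "hconv X A" "hconv Y B" shows "hconv (\<lambda>j. X j + Y j) (A + B)"
  unfolding hconv_def
proof (intro allI impI)
  fix e :: real assume e: "e > 0"
  have *: "(A + cball 0 (e/2)) + (B + cball 0 (e/2)) \<subseteq> (A + B) + cball 0 e" for A B :: "'a set"
  proof -
    have "(A + cball 0 (e/2)) + (B + cball 0 (e/2)) = (A + B) + (cball 0 (e/2) + cball 0 (e/2))"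
      by (simp add: ac_simps)
    also have "\<dots> \<subseteq> (A + B) + cball 0 (e/2 + e/2)" by (intro set_plus_mono2 cball_plus_cball order_refl)
    finally show ?thesis by simp
  qed
  have "\<forall>\<^sub>F j in sequentially. X j \<subseteq> A + cball 0 (e/2) \<and> A \<subseteq> X j + cball 0 (e/2)"
    "\<forall>\<^sub>F j in sequentially. Y j \<subseteq> B + cball 0 (e/2) \<and> B \<subseteq> Y j + cball 0 (e/2)"
    using assms e by (simp_all add: hconv_def)
  then show "\<forall>\<^sub>F j in sequentially. X j + Y j \<subseteq> (A + B) + cball 0 e \<and> A + B \<subseteq> (X j + Y j) + cball 0 e"
  proof eventually_elim
    case (elim j)
    have "X j + Y j \<subseteq> (A + cball 0 (e/2)) + (B + cball 0 (e/2))" using elim by (intro set_plus_mono2) auto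
    moreover have "A + B \<subseteq> (X j + cball 0 (e/2)) + (Y j + cball 0 (e/2))" using elim by (intro set_plus_mono2) auto
    ultimately show ?case using * by blast
  qed
qed

lemma hconv_sum:
  assumes "finite J" "\<And>i. i \<in> J \<Longrightarrow> hconv (X i) (A i)"
  shows "hconv (\<lambda>j. \<Sum>i\<in>J. X i j) (\<Sum>i\<in>J. A i)"
  using assms by (induction rule: finite_induct) (auto intro: hconv_plus hconv_const)

lemma hconv_linear_image:
  fixes f :: "'a::euclidean_space \<Rightarrow> 'b::real_normed_vector"
  assumes f: "linear f" and "hconv X A" shows "hconv (\<lambda>j. f ` X j) (f ` A)"
  unfolding hconv_def
proof (intro allI impI)
  fix e :: real assume e: "e > 0"
  obtain B where B: "B > 0" "\<And>x. norm (f x) \<le> B * norm x" using linear_bounded_pos[OF f] by blast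
  have *: "f ` S \<subseteq> f ` T + cball 0 e" if "S \<subseteq> T + cball 0 (e/B)" for S T :: "'a set"
  proof -
    have "f ` cball 0 (e/B) \<subseteq> cball 0 e"
    proof clarsimp
      fix x :: 'a assume "norm x \<le> e / B"
      then have "B * norm x \<le> e" using B(1) by (simp add: field_simps)
      then show "norm (f x) \<le> e" using B(2)[of x] by linarith
    qed
    moreover have "f ` S \<subseteq> f ` T + f ` cball 0 (e/B)"
      using image_mono[OF that, of f] by (simp add: linear_image_set_plus[OF f])
    ultimately show ?thesis using set_plus_mono2[of "f ` T" "f ` T"] by blast
  qed
  have "\<forall>\<^sub>F j in sequentially. X j \<subseteq> A + cball 0 (e/B) \<and> A \<subseteq> X j + cball 0 (e/B)"
    using assms(2) e B by (simp add: hconv_def)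
  then show "\<forall>\<^sub>F j in sequentially. f ` X j \<subseteq> f ` A + cball 0 e \<and> f ` A \<subseteq> f ` X j + cball 0 e"
    by eventually_elim (use * in blast)
qed

lemma subset_plus_cball_if_SUP_infdist_less:
  fixes A B :: "'a::euclidean_space set"
  assumes "compact A" "B \<noteq> {}" "(SUP x\<in>A. infdist x B) < e"
  shows "A \<subseteq> B + cball 0 e"
proof
  fix x assume x: "x \<in> A"
  have "bdd_above ((\<lambda>x. infdist x B) ` A)"
    using assms(1) by (intro bounded_imp_bdd_above compact_imp_bounded compact_continuous_image
      continuous_intros)
  then have "infdist x B < e" using cSUP_upper[OF x] assms(3) by (meson le_less_trans)
  then obtain b where b: "b \<in> B" "dist x b < e"
    using cINF_less_iff[of B "dist x" e] assms(2) by (auto simp: infdist_notempty)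
  then have "b + (x - b) \<in> B + cball 0 e" by (intro set_plus_intro) (auto simp: dist_norm norm_minus_commute)
  then show "x \<in> B + cball 0 e" by simp
qed

lemma hconv_if_hausdorff_dist_tendsto:
  fixes A :: "'a::euclidean_space set"
  assumes "compact A" "A \<noteq> {}" "\<And>j. compact (X j)" "\<And>j. X j \<noteq> {}"
    and "(\<lambda>j. hausdorff_dist (X j) A) \<longlonglongrightarrow> 0"
  shows "hconv X A"
  unfolding hconv_def
proof (intro allI impI)
  fix e :: real assume "e > 0"
  then have "\<forall>\<^sub>F j in sequentially. hausdorff_dist (X j) A < e"
    using assms(5) by (rule order_tendstoD(2)[rotated])
  then show "\<forall>\<^sub>F j in sequentially. X j \<subseteq> A + cball 0 e \<and> A \<subseteq> X j + cball 0 e"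
  proof eventually_elim
    case (elim j)
    then have "(SUP x\<in>X j. infdist x A) < e" "(SUP y\<in>A. infdist y (X j)) < e"
      by (auto simp: hausdorff_dist_def)
    then show ?case using assms by (intro conjI subset_plus_cball_if_SUP_infdist_less) auto
  qed
qed

lemma zonoidE:
  assumes "zonoid A"
  obtains X where "compact A" "\<And>j. zonotope (X j)" "hconv X A"
proof -
  obtain Z where Z: "\<And>j. zonotope (Z j)" "(\<lambda>j. hausdorff_dist (Z j) A) \<longlonglongrightarrow> 0"
    using assms unfolding zonoid_def by blast
  have "hconv Z A"
    using assms Z zonotope_compact zonotope_nonempty
    by (intro hconv_if_hausdorff_dist_tendsto) (auto simp: zonoid_def)
  then show ?thesis using that Z assms by (auto simp: zonoid_def)
qed

lemma zonotope_imp_zonoid: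
  assumes "zonotope Z" shows "zonoid Z"
proof -
  have Z: "compact Z" "Z \<noteq> {}" using assms zonotope_compact zonotope_nonempty by auto
  then have "hausdorff_dist Z Z = 0" by (simp add: hausdorff_dist_def cong: SUP_cong)
  then show ?thesis unfolding zonoid_def using assms Z by (intro conjI exI[of _ "\<lambda>_. Z"]) auto
qed

section \<open>Continuity of volume along zonotopes\<close>

lemma zdet_scaleR_mono:
  assumes "0 \<le> c" "c \<le> 1"
  shows "zdet M (map ((*\<^sub>R) c) qs @ us) \<le> zdet M (qs @ us)"
proof (induction qs arbitrary: M)
  case (Cons q qs)
  have "c * zdet (q # M) (map ((*\<^sub>R) c) qs @ us) \<le> 1 * zdet (q # M) (qs @ us)"
    using assms Cons.IH by (intro mult_mono) auto
  then show ?case using Cons.IH[of M] assms(1) by (simp add: zdet_scale)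
qed simp

text \<open>On the unit interval, a polynomial with nonnegative coefficients is at most its constant
  term plus \<open>c\<close> times its value at 1.\<close>

lemma zdet_scaleR_le:
  assumes "0 \<le> c" "c \<le> 1"
  shows "zdet M (map ((*\<^sub>R) c) qs @ us) \<le> zdet M us + c * zdet M (qs @ us)"
proof (induction qs arbitrary: M)
  case (Cons q qs)
  have "c * zdet (q # M) (map ((*\<^sub>R) c) qs @ us) \<le> c * zdet (q # M) (qs @ us)"
    using assms zdet_scaleR_mono by (intro mult_left_mono) auto
  then show ?case using Cons.IH[of M] assms(1) by (simp add: zdet_scale distrib_left)
qed (use assms in simp)

text \<open>The right side is the cube with edges of length \<open>2 * e\<close> centred at the
  origin. The factor \<open>e\<close> is kept outside the generators so that
  \<open>zdet_scaleR_le\<close> can be applied to it.\<close>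

lemma cball_subset_cube:
  fixes bs :: "'a::euclidean_space list"
  assumes bs: "distinct bs" "set bs = Basis" and e: "e > 0"
  shows "cball 0 e \<subseteq> {- (e *\<^sub>R (\<Sum>b\<in>Basis. b))} + seg_sum (map ((*\<^sub>R) e) (map ((*\<^sub>R) 2) bs))"
proof
  fix x :: 'a assume "x \<in> cball 0 e"
  then have x: "\<bar>x \<bullet> b\<bar> \<le> e" if "b \<in> Basis" for b using that Basis_le_norm[of b x] by simp
  define t where "t i = (x \<bullet> bs ! i + e) / (2 * e)" for i
  have t: "0 \<le> t i" "t i \<le> 1" if "i < length bs" for i
  proof -
    have "bs ! i \<in> Basis" using that bs(2) nth_mem by blast
    from x[OF this] show "0 \<le> t i" "t i \<le> 1" using e by (auto simp: t_def field_simps)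
  qed
  have te: "t i * (e * 2) = x \<bullet> bs ! i + e" for i using e by (simp add: t_def)
  have "(\<Sum>i<length bs. t i *\<^sub>R map ((*\<^sub>R) e) (map ((*\<^sub>R) 2) bs) ! i) =
      (\<Sum>i<length bs. (x \<bullet> bs ! i + e) *\<^sub>R bs ! i)"
    by (intro sum.cong) (auto simp: te)
  also have "\<dots> = (\<Sum>b\<in>Basis. (x \<bullet> b + e) *\<^sub>R b)"
    using sum.reindex_bij_betw[OF bij_betw_nth[of bs "{..<length bs}" "set bs"], of "\<lambda>b. (x \<bullet> b + e) *\<^sub>R b"] bs
    by simp
  also have "\<dots> = x + e *\<^sub>R (\<Sum>b\<in>Basis. b)"
    by (simp add: scaleR_left_distrib sum.distrib euclidean_representation scaleR_sum_right)
  finally have "x + e *\<^sub>R (\<Sum>b\<in>Basis. b) \<in> seg_sum (map ((*\<^sub>R) e) (map ((*\<^sub>R) 2) bs))"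
    unfolding mem_seg_sum_iff using t by (intro exI[of _ t]) simp
  then show "x \<in> {- (e *\<^sub>R (\<Sum>b\<in>Basis. b))} + seg_sum (map ((*\<^sub>R) e) (map ((*\<^sub>R) 2) bs))"
    unfolding singleton_set_plus by (intro image_eqI[of _ _ "x + e *\<^sub>R (\<Sum>b\<in>Basis. b)"]) auto
qed

text \<open>The parallel bodies decrease to \<open>A\<close> because \<open>A\<close> is closed, and
  measure is continuous from above. It bounds the volumes of approximating sets from above.\<close>

lemma measure_cball_plus_tendsto:
  fixes A :: "'a::euclidean_space set"
  assumes "compact A"
  shows "(\<lambda>k. measure lborel (A + cball 0 (1 / real (Suc k)))) \<longlonglongrightarrow> measure lborel A"
proof -
  let ?S = "\<lambda>k. A + cball 0 (1 / real (Suc k))"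
  have "(\<Inter>k. ?S k) = A"
  proof (intro set_eqI iffI)
    fix x assume x: "x \<in> (\<Inter>k. ?S k)"
    have inf: "infdist x A \<le> 1 / real (Suc k)" for k
    proof -
      obtain a y where "a \<in> A" "norm y \<le> 1 / real (Suc k)" "x = a + y"
        using x by (auto elim!: set_plus_elim dest!: spec[of _ k])
      then show ?thesis using infdist_le2[of a A x] by (simp add: dist_norm)
    qed
    have "infdist x A \<le> 0"
      by (rule LIMSEQ_le_const[OF LIMSEQ_inverse_real_of_nat]) (use inf in \<open>auto simp: inverse_eq_divide\<close>)
    then have "infdist x A = 0" using infdist_nonneg[of x A] by simp
    moreover have "A \<noteq> {}" using x by auto
    ultimately show "x \<in> A" using assms compact_imp_closed in_closed_iff_infdist_zero by blast
  next
    fix x assume "x \<in> A"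
    then have "x + 0 \<in> ?S k" for k by (intro set_plus_intro) auto
    then show "x \<in> (\<Inter>k. ?S k)" by simp
  qed
  moreover have "(\<lambda>k. measure lborel (?S k)) \<longlonglongrightarrow> measure lborel (\<Inter>k. ?S k)"
  proof (rule Lim_measure_decseq)
    have cS: "compact (?S k)" for k using assms by (intro compact_set_plus) auto
    then show "range ?S \<subseteq> sets lborel" by (auto intro: borel_compact)
    show "emeasure lborel (?S k) \<noteq> \<infinity>" for k
      using compact_measurable_lborel[OF cS[of k]] by (auto simp: fmeasurable_def)
    show "decseq ?S"
    proof (intro antimonoI set_plus_mono2 order_refl subset_cball)
      fix m n :: nat assume "m \<le> n"
      then show "1 / real (Suc n) \<le> 1 / real (Suc m)" by (intro frac_le) auto
    qed
  qed
  ultimately show ?thesis by simp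
qed

text \<open>The limit cannot lose volume because the polynomial \<open>e \<mapsto> |X + eQ|\<close>, \<open>Q\<close> a cube, has nonnegative
  coefficients for a zonotope \<open>X\<close>, hence is at most \<open>|X| + e |X + Q|\<close> on \<open>[0,1]\<close>.\<close>

theorem measure_tendsto_zonotopes:
  fixes A :: "(real^'n) set"
  assumes A: "compact A" and X: "\<And>j. zonotope (X j)" and conv: "hconv X A"
  shows "(\<lambda>j. measure lborel (X j)) \<longlonglongrightarrow> measure lborel A"
proof (rule tendstoI)
  fix e :: real assume e: "e > 0"
  obtain bs :: "(real^'n) list" where bs: "set bs = Basis" "distinct bs"
    using finite_distinct_list[OF finite_Basis] by blast
  define qs where "qs = map ((*\<^sub>R) 2) bs"
  \<comment> \<open>A fixed compact set that contains \<open>X j\<close> plus the cube of edge 2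
    centred at the origin as soon as \<open>X j\<close> lies within distance 1 of \<open>A\<close>.
    Its volume bounds the linear error term uniformly in \<open>j\<close>.\<close>
  define L where "L = A + cball 0 1 + ({- (\<Sum>b\<in>Basis. b)} + seg_sum qs)"
  have cL: "compact L" unfolding L_def using A by (intro compact_set_plus) auto
  define M where "M = measure lborel L"
  have M: "M \<ge> 0" by (simp add: M_def)
  \<comment> \<open>At most 1, for the estimate on the unit interval and the inclusion in
    \<open>L\<close>; the other bound makes \<open>d * M\<close> less than \<open>e\<close>.\<close>
  define d where "d = min 1 (e / (2 * (M + 1)))"
  have d: "0 < d" "d \<le> 1" "d * M < e"
  proof -
    show "0 < d" "d \<le> 1" using e M by (auto simp: d_def)
    have "d * M \<le> e / (2 * (M + 1)) * M" using M by (intro mult_right_mono) (auto simp: d_def)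
    also have "\<dots> < e" using e M by (simp add: field_simps) (smt (verit) mult_nonneg_nonneg)
    finally show "d * M < e" .
  qed
  have "\<forall>\<^sub>F k in sequentially. measure lborel (A + cball 0 (1 / real (Suc k))) < measure lborel A + e"
    using order_tendstoD(2)[OF measure_cball_plus_tendsto[OF A]] e by simp
  then obtain k where k: "measure lborel (A + cball 0 (1 / real (Suc k))) < measure lborel A + e"
    by (auto simp: eventually_sequentially)
  have "\<forall>\<^sub>F j in sequentially. X j \<subseteq> A + cball 0 (1 / real (Suc k)) \<and> A \<subseteq> X j + cball 0 (1 / real (Suc k))"
    "\<forall>\<^sub>F j in sequentially. X j \<subseteq> A + cball 0 d \<and> A \<subseteq> X j + cball 0 d"
    using conv d unfolding hconv_def by auto
  then show "\<forall>\<^sub>F j in sequentially. dist (measure lborel (X j)) (measure lborel A) < e"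
  proof eventually_elim
    case (elim j)
    have Xc: "compact (X j)" using X zonotope_compact by blast
    have "measure lborel (X j) \<le> measure lborel (A + cball 0 (1 / real (Suc k)))"
      using elim A Xc by (intro measure_mono_fmeasurable compact_measurable_lborel compact_set_plus)
        (auto simp: borel_compact)
    then have upper: "measure lborel (X j) < measure lborel A + e" using k by linarith
    obtain a us where Xj: "X j = {a} + seg_sum us" using X zonotope_iff by metis
    define c where "c = - (\<Sum>b\<in>Basis. b :: real^'n)"
    have sing: "{x} + {y} = {x + y}" for x y :: "real^'n" by (auto simp: set_plus_def)
    have plus: "X j + ({v} + seg_sum ws) = {a + v} + seg_sum (ws @ us)" for v ws
    proof -
      have "X j + ({v} + seg_sum ws) = ({a} + {v}) + seg_sum (ws @ us)"
        by (simp add: Xj seg_sum_append ac_simps)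
      then show ?thesis by (simp add: sing)
    qed
    \<comment> \<open>Lower bound for the volume of \<open>X j\<close>: the ball is replaced by a
      cube so that the enlarged set is again a zonotope and its volume a bracket.\<close>
    have "A \<subseteq> X j + cball 0 d" using elim by blast
    also have "\<dots> \<subseteq> X j + ({d *\<^sub>R c} + seg_sum (map ((*\<^sub>R) d) qs))"
      using cball_subset_cube[OF bs(2,1) d(1)] by (intro set_plus_mono2) (auto simp: c_def qs_def)
    finally have "A \<subseteq> {a + d *\<^sub>R c} + seg_sum (map ((*\<^sub>R) d) qs @ us)" by (simp add: plus)
    then have "measure lborel A \<le> measure lborel ({a + d *\<^sub>R c} + seg_sum (map ((*\<^sub>R) d) qs @ us))"
      using A by (intro measure_mono_fmeasurable compact_measurable_lborel compact_set_plus)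
        (auto simp: borel_compact)
    also have "\<dots> \<le> zdet [] us + d * zdet [] (qs @ us)"
      unfolding measure_translate_seg_sum using d by (intro zdet_scaleR_le) auto
    also have "zdet [] us = measure lborel (X j)" by (simp add: Xj measure_translate_seg_sum)
    also have "zdet [] (qs @ us) = measure lborel (X j + ({c} + seg_sum qs))"
      by (simp add: plus measure_translate_seg_sum)
    also have "\<dots> \<le> M"
      unfolding M_def
    proof (intro measure_mono_fmeasurable compact_measurable_lborel cL)
      have "X j \<subseteq> A + cball 0 d" using elim by blast
      also have "\<dots> \<subseteq> A + cball 0 1" using d by (intro set_plus_mono2) auto
      finally show "X j + ({c} + seg_sum qs) \<subseteq> L"
        unfolding L_def c_def by (intro set_plus_mono2 order_refl)
      show "X j + ({c} + seg_sum qs) \<in> sets lborel"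
        using Xc by (auto intro!: borel_compact compact_set_plus)
    qed
    finally have "measure lborel A \<le> measure lborel (X j) + d * M"
      using d(1) by (simp add: mult_left_mono)
    then show ?case using upper d(3) by (simp add: dist_real_def abs_less_iff)
  qed
qed

text \<open>As the volume of a prism, a projection volume inherits the convergence of volumes: the
  prism over a projected zonotope is itself a zonotope, and it converges to the prism over the
  projection of \<open>A\<close>.\<close>

lemma proj_vol_tendsto:
  fixes A :: "(real^'n) set"
  assumes vs: "orthonormal vs" and A: "compact A" and X: "\<And>j. zonotope (X j)" and conv: "hconv X A"
  shows "(\<lambda>j. proj_vol (orthogonal_comp (span (set vs))) (X j)) \<longlonglongrightarrow>
    proj_vol (orthogonal_comp (span (set vs))) A"
proof -
  have "compact (proj_along vs ` A)"
    using A linear_proj_along[of vs]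
    by (intro compact_continuous_image linear_continuous_on) (simp_all add: linear_conv_bounded_linear)
  then have "(\<lambda>j. measure lborel (proj_along vs ` X j + seg_sum vs)) \<longlonglongrightarrow>
      measure lborel (proj_along vs ` A + seg_sum vs)"
    using X conv
    by (intro measure_tendsto_zonotopes compact_set_plus zonotope_plus zonotope_linear_image
        hconv_plus hconv_const hconv_linear_image linear_proj_along) auto
  then show ?thesis
    unfolding proj_vol_eq_measure[OF vs A] proj_vol_eq_measure[OF vs zonotope_compact[OF X]] .
qed

lemma proj_vol_zonotope:
  fixes us :: "(real^'n) list"
  assumes vs: "orthonormal vs"
  shows "proj_vol (orthogonal_comp (span (set vs))) ({a} + seg_sum us) = zdet vs us"
proof -
  have "proj_along vs ` ({a} + seg_sum us) + seg_sum vs =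
      (+) (proj_along vs a) ` (proj_along vs ` seg_sum us + seg_sum vs)"
    by (simp add: linear_image_set_plus[OF linear_proj_along] add.assoc flip: singleton_set_plus)
  moreover have "compact (proj_along vs ` seg_sum us + seg_sum vs)"
    by (intro compact_set_plus) (simp_all add: seg_sum_linear_image[OF linear_proj_along])
  moreover have "compact ({a} + seg_sum us)" by (intro compact_set_plus) auto
  ultimately show ?thesis
    by (simp add: proj_vol_eq_measure[OF vs] measure_lborel_translation proj_along_seg_sum_volume[OF vs])
qed

section \<open>Consequences of the inequality for two segments\<close>

lemma seg_sum_mset_cong: "mset us = mset vs \<Longrightarrow> seg_sum us = seg_sum vs"
  unfolding seg_sum_def by (metis mset_map sum_mset_sum_list)

text \<open>Evident from the geometric side: the bracket is the volume of a Minkowski sum, which is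
  commutative.\<close>

lemma zdet_Nil_mset_cong:
  fixes us vs :: "(real^'n) list"
  assumes "mset us = mset vs" shows "zdet [] us = zdet [] vs"
  using seg_sum_mset_cong[OF assms] by (simp flip: measure_seg_sum)

text \<open>Multiply the two product inequalities and cancel \<open>b * c\<close>. This replaces a
  chain of quotients: if \<open>a\<close> is positive then so are \<open>b\<close> and
  \<open>c\<close>, and if \<open>a\<close> is 0 there is nothing to cancel.\<close>

lemma ratio_chain:
  fixes a :: real
  assumes "0 \<le> a" "a \<le> b" "a \<le> c" "a * c \<le> b * d" "b * e \<le> f * c" "0 \<le> f" "0 \<le> d"
  shows "a * e \<le> f * d"
proof (cases "a = 0")
  case False
  then have pos: "a > 0" "b > 0" "c > 0" using assms by auto
  show ?thesis
  proof (cases "e \<ge> 0")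
    case True
    have "(a * c) * (b * e) \<le> (b * d) * (f * c)" using assms pos True by (intro mult_mono assms) auto
    then have "(b * c) * (a * e) \<le> (b * c) * (f * d)" by (simp add: mult_ac)
    then show ?thesis using pos by (metis mult_le_cancel_left_pos mult_pos_pos)
  next
    case False
    then have "a * e \<le> 0" using pos by (simp add: mult_nonneg_nonpos)
    then show ?thesis using assms by (meson mult_nonneg_nonneg order_trans)
  qed
qed (use assms in simp)

definition pair_ineq :: "(real^'n) list \<Rightarrow> real^'n \<Rightarrow> real^'n \<Rightarrow> bool" where
  "pair_ineq us x y \<longleftrightarrow> zdet [] us * zdet [x, y] us \<le> zdet [x] us * zdet [y] us"

text \<open>Expanding the volumes with \<open>x\<close> and \<open>y\<close> added into brackets,
  all terms of the two products agree except [A] [A; x, y] on the left and [A; x] [A; y] on the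
  right.\<close>

lemma pair_ineq_iff:
  "pair_ineq us x y \<longleftrightarrow> zdet [] us * zdet [] (x # y # us) \<le> zdet [] (x # us) * zdet [] (y # us)"
proof -
  have "zdet [y, x] us = zdet [x, y] us" by (rule zdet_mset_cong) simp
  then show ?thesis by (simp add: pair_ineq_def algebra_simps)
qed

text \<open>The list \<open>cs\<close> is built up one segment at a time; the pair inequality over
  \<open>cs @ us\<close> compares the effect of \<open>x\<close> before and after adding the next
  one.\<close>

lemma submodular_step:
  fixes us :: "(real^'n) list"
  assumes loc: "\<And>us x y. pair_ineq (us :: (real^'n) list) x y"
  shows "zdet [] us * zdet [] (x # cs @ us) \<le> zdet [] (x # us) * zdet [] (cs @ us)"
proof (induction cs)
  case (Cons y cs)
  have 1: "zdet [] (cs @ us) * zdet [] (x # y # cs @ us) \<le> zdet [] (y # cs @ us) * zdet [] (x # cs @ us)"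
    using loc[of "cs @ us" x y] unfolding pair_ineq_iff by (simp only: mult.commute)
  have 2: "zdet [] us * zdet [] (x # cs @ us) \<le> zdet [] (cs @ us) * zdet [] (x # us)"
    using Cons by (simp only: mult.commute)
  have 3: "zdet [] us \<le> zdet [] (x # cs @ us)"
    using zdet_append_mono[of "[]" us "x # cs"] by (simp only: append_Cons)
  have "zdet [] us * zdet [] (x # y # cs @ us) \<le> zdet [] (y # cs @ us) * zdet [] (x # us)"
    by (rule ratio_chain[OF zdet_nonneg zdet_append_mono 3 2 1 zdet_nonneg zdet_nonneg])
  then show ?case by (simp only: append_Cons mult.commute)
qed (simp only: append_Nil mult.commute order_refl)

text \<open>The same chaining in the other list: the single-segment version is applied over the
  enlarged base \<open>bs @ us\<close>.\<close>

lemma submodular_lists: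
  fixes us :: "(real^'n) list"
  assumes loc: "\<And>us x y. pair_ineq (us :: (real^'n) list) x y"
  shows "zdet [] us * zdet [] (bs @ cs @ us) \<le> zdet [] (bs @ us) * zdet [] (cs @ us)"
proof (induction bs)
  case (Cons x bs)
  have "zdet [] (x # cs @ bs @ us) = zdet [] (x # bs @ cs @ us)"
    "zdet [] (cs @ bs @ us) = zdet [] (bs @ cs @ us)"
    by (rule zdet_Nil_mset_cong; simp)+
  with submodular_step[OF loc, of "bs @ us" x cs]
  have 1: "zdet [] (bs @ us) * zdet [] (x # bs @ cs @ us) \<le>
      zdet [] (x # bs @ us) * zdet [] (bs @ cs @ us)" by (simp only:)
  have 2: "zdet [] us \<le> zdet [] (bs @ cs @ us)"
    using zdet_append_mono[of "[]" us "bs @ cs"] by (simp only: append_assoc)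
  have "zdet [] us * zdet [] (x # bs @ cs @ us) \<le> zdet [] (x # bs @ us) * zdet [] (cs @ us)"
    by (rule ratio_chain[OF zdet_nonneg zdet_append_mono 2 Cons.IH 1 zdet_nonneg zdet_nonneg])
  then show ?case by (simp only: append_Cons)
qed simp

text \<open>The bracket is a polynomial in \<open>t\<close> of degree at most
  \<open>length vs\<close>, and the top power arises only from choosing all of \<open>vs\<close>. In
  the induction, the branch that skips \<open>v\<close> retains an extra factor
  \<open>inverse t\<close> and disappears.\<close>

lemma zdet_leading_coefficient:
  "((\<lambda>t::real. zdet M (map ((*\<^sub>R) t) vs @ us) / t ^ length vs) \<longlongrightarrow> zdet (vs @ M) us) at_top"
proof (induction vs arbitrary: M)
  case (Cons v vs)
  let ?f = "\<lambda>M t. zdet M (map ((*\<^sub>R) t) vs @ us) / t ^ length vs"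
  have "((\<lambda>t. ?f M t * inverse t + ?f (v # M) t) \<longlongrightarrow> zdet (vs @ M) us * 0 + zdet (vs @ v # M) us) at_top"
    by (intro tendsto_intros Cons.IH tendsto_inverse_0_at_top filterlim_ident)
  moreover have "zdet (vs @ v # M) us = zdet ((v # vs) @ M) us" by (rule zdet_mset_cong) simp
  moreover have "\<forall>\<^sub>F t in at_top. ?f M t * inverse t + ?f (v # M) t =
      zdet M (map ((*\<^sub>R) t) (v # vs) @ us) / t ^ length (v # vs)"
    using eventually_gt_at_top[of 0]
    by eventually_elim (simp add: zdet_scale field_simps)
  ultimately show ?case by (simp add: filterlim_cong[OF refl refl])
qed simp

lemma lists_ineq:
  fixes us :: "(real^'n) list"
  assumes loc: "\<And>us x y. pair_ineq (us :: (real^'n) list) x y"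
  shows "zdet [] us * zdet (vs @ ws) us \<le> zdet vs us * zdet ws us"
proof (rule tendsto_le)
  let ?h = "\<lambda>xs (t::real). zdet [] (map ((*\<^sub>R) t) xs @ us) / t ^ length xs"
  show "((\<lambda>t. ?h vs t * ?h ws t) \<longlongrightarrow> zdet vs us * zdet ws us) at_top"
    using zdet_leading_coefficient[of "[]" vs us] zdet_leading_coefficient[of "[]" ws us]
    by (intro tendsto_mult) simp_all
  show "((\<lambda>t. zdet [] us * ?h (vs @ ws) t) \<longlongrightarrow> zdet [] us * zdet (vs @ ws) us) at_top"
    using zdet_leading_coefficient[of "[]" "vs @ ws" us] by (intro tendsto_mult tendsto_const) simp
  show "\<forall>\<^sub>F t in at_top. zdet [] us * ?h (vs @ ws) t \<le> ?h vs t * ?h ws t"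
    using eventually_gt_at_top[of 0]
  proof eventually_elim
    case (elim t)
    have "zdet [] us * zdet [] (map ((*\<^sub>R) t) vs @ map ((*\<^sub>R) t) ws @ us)
        \<le> zdet [] (map ((*\<^sub>R) t) vs @ us) * zdet [] (map ((*\<^sub>R) t) ws @ us)"
      by (rule submodular_lists[OF loc])
    then show ?case using elim by (simp add: power_add divide_right_mono)
  qed
qed simp

text \<open>Each application of \<open>lists_ineq\<close> splits off one vector at the cost of one
  factor [A]. The last remaining vector costs nothing, whence the exponent
  \<open>length vs - 1\<close>.\<close>

lemma prod_ineq:
  fixes us :: "(real^'n) list"
  assumes loc: "\<And>us x y. pair_ineq (us :: (real^'n) list) x y" and "vs \<noteq> []"
  shows "zdet [] us ^ (length vs - 1) * zdet vs us \<le> (\<Prod>v\<leftarrow>vs. zdet [v] us)"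
  using assms(2)
proof (induction vs rule: list_nonempty_induct)
  case (cons v vs)
  have "zdet [] us ^ length vs * zdet (v # vs) us =
      zdet [] us ^ (length vs - 1) * (zdet [] us * zdet ([v] @ vs) us)"
    using cons.hyps by (cases vs) (auto simp: mult_ac)
  also have "\<dots> \<le> zdet [] us ^ (length vs - 1) * (zdet [v] us * zdet vs us)"
    by (intro mult_left_mono lists_ineq[OF loc]) simp
  also have "\<dots> = zdet [v] us * (zdet [] us ^ (length vs - 1) * zdet vs us)" by simp
  also have "\<dots> \<le> zdet [v] us * (\<Prod>v\<leftarrow>vs. zdet [v] us)"
    by (intro mult_left_mono cons.IH) simp
  finally show ?case by simp
qed simp

text \<open>Both sides of \<^const>\<open>pair_ineq\<close> are multiplied by the same factor \<open>(det T)\<^sup>2\<close> under a linear map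
  \<open>T\<close>, and linearly independent \<open>x\<close> and \<open>y\<close> can be mapped to orthonormal vectors.\<close>

lemma pair_ineq_if_orthonormal:
  fixes us :: "(real^'n) list"
  assumes orth: "\<And>us x y. orthonormal [x, y] \<Longrightarrow> pair_ineq (us :: (real^'n) list) x y"
  shows "pair_ineq us x y"
proof (cases "x \<noteq> y \<and> independent {x, y}")
  case False
  \<comment> \<open>For equal or dependent \<open>x\<close> and \<open>y\<close> the left side of
    the inequality vanishes.\<close>
  have "zdet [x, y] us = 0"
  proof (cases "x \<in> span {y}")
    case True
    then show ?thesis by (intro zdet_span_eq_0) simp
  next
    case 1: False
    then have "x \<noteq> y" by (auto intro: span_base)
    then have "y \<in> span {x} \<or> y = 0"
      using False 1 by (metis independent_insert dependent_single empty_iff singleton_iff insert_commute)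
    then have "y \<in> span {x}" using span_zero by auto
    then have "zdet [y, x] us = 0" by (intro zdet_span_eq_0) simp
    moreover have "zdet [x, y] us = zdet [y, x] us" by (rule zdet_mset_cong) simp
    ultimately show ?thesis by simp
  qed
  then show ?thesis by (simp add: pair_ineq_def)
next
  case True
  \<comment> \<open>Completing \<open>x\<close> and \<open>y\<close> to a basis and sending it to
    the standard basis gives an invertible map under which they become orthonormal.\<close>
  obtain B where B: "{x, y} \<subseteq> B" "independent B" "span B = (UNIV :: (real^'n) set)"
    using maximal_independent_subset_extend[of "{x, y}" UNIV] True by (auto simp: top.extremum_unique)
  have finB: "finite B" using independent_bound[OF B(2)] by simp
  have "card B = card (Basis :: (real^'n) set)"
    using B by (metis dim_UNIV dim_span_eq_card_independent)
  then obtain g where g: "bij_betw g B (Basis :: (real^'n) set)"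
    using finite_same_card_bij[OF finB finite_Basis] by blast
  obtain T where T: "linear T" "\<And>b. b \<in> B \<Longrightarrow> T b = g b"
    using linear_independent_extend[OF B(2), of g] by blast
  have "T ` B = Basis" using T(2) g by (auto simp: bij_betw_def)
  then have "surj T" using linear_span_image[OF T(1), of B] B(3) span_Basis by auto
  then have "inj T" using T(1) linear_surjective_imp_injective by blast
  then have det: "det (matrix T) \<noteq> 0" using det_nz_iff_inj[OF T(1)] by simp
  have "T x \<noteq> T y" using True \<open>inj T\<close> by (simp add: inj_eq)
  moreover have "T x \<in> Basis" "T y \<in> Basis" using B(1) \<open>T ` B = Basis\<close> by auto
  ultimately have "orthonormal [T x, T y]"
    by (auto simp: orthonormal_def pairwise_def orthogonal_def inner_not_same_Basis)
  then have "pair_ineq (map T us) (T x) (T y)" by (rule orth)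
  then have "(\<bar>det (matrix T)\<bar> * zdet [] us) * (\<bar>det (matrix T)\<bar> * zdet [x, y] us) \<le>
      (\<bar>det (matrix T)\<bar> * zdet [x] us) * (\<bar>det (matrix T)\<bar> * zdet [y] us)"
    using zdet_linear[OF T(1), of "[]" us] zdet_linear[OF T(1), of "[x]" us]
      zdet_linear[OF T(1), of "[y]" us] zdet_linear[OF T(1), of "[x, y]" us]
    by (simp add: pair_ineq_def)
  then have "(\<bar>det (matrix T)\<bar> * \<bar>det (matrix T)\<bar>) * (zdet [] us * zdet [x, y] us) \<le>
      (\<bar>det (matrix T)\<bar> * \<bar>det (matrix T)\<bar>) * (zdet [x] us * zdet [y] us)"
    by (simp only: mult_ac)
  moreover have "\<bar>det (matrix T)\<bar> * \<bar>det (matrix T)\<bar> > 0" using det by (intro mult_pos_pos) auto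
  ultimately show ?thesis unfolding pair_ineq_def by (metis mult_le_cancel_left_pos)
qed

section \<open>Mixed volumes\<close>

text \<open>The full expansion of a multilinear expression: \<open>g\<close> is summed over all ways
  to pick one entry from each list. With \<open>g\<close> equal to \<open>absdet\<close> and n lists
  of generators it is n! times the mixed volume of the zonotopes they generate.\<close>

primrec list_choice_sum :: "('a list \<Rightarrow> real) \<Rightarrow> 'a list list \<Rightarrow> real" where
  "list_choice_sum g [] = g []"
| "list_choice_sum g (L # Ls) = (\<Sum>x\<leftarrow>L. list_choice_sum (\<lambda>l. g (x # l)) Ls)"

lemma list_choice_sum_cong:
  assumes "\<And>l. length l = length Ls \<Longrightarrow> g l = h l"
  shows "list_choice_sum g Ls = list_choice_sum h Ls"
  using assms
proof (induction Ls arbitrary: g h)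
  case (Cons L Ls)
  have "list_choice_sum (\<lambda>l. g (x # l)) Ls = list_choice_sum (\<lambda>l. h (x # l)) Ls" for x
    using Cons.prems by (intro Cons.IH) simp
  then show ?case by simp
qed simp

lemma list_choice_sum_mono:
  assumes "\<And>l. length l = length Ls \<Longrightarrow> g l \<le> h l"
  shows "list_choice_sum g Ls \<le> list_choice_sum h Ls"
  using assms
proof (induction Ls arbitrary: g h)
  case (Cons L Ls)
  have "list_choice_sum (\<lambda>l. g (x # l)) Ls \<le> list_choice_sum (\<lambda>l. h (x # l)) Ls" for x
    using Cons.prems by (intro Cons.IH) simp
  then show ?case by (simp add: sum_list_mono)
qed simp

lemma list_choice_sum_mult: "list_choice_sum (\<lambda>l. c * g l) Ls = c * list_choice_sum g Ls"
  by (induction Ls arbitrary: g) (simp_all add: sum_list_const_mult)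

lemma list_choice_sum_sum:
  "list_choice_sum (\<lambda>l. \<Sum>y\<in>Y. g y l) Ls = (\<Sum>y\<in>Y. list_choice_sum (g y) Ls)"
proof (induction Ls arbitrary: g)
  case (Cons L Ls)
  have "(\<Sum>x\<leftarrow>L. \<Sum>y\<in>Y. f x y) = (\<Sum>y\<in>Y. \<Sum>x\<leftarrow>L. f x y)" for f :: "_ \<Rightarrow> _ \<Rightarrow> real"
    by (induction L) (simp_all add: sum.distrib)
  then show ?case by (simp add: Cons)
qed simp

lemma list_choice_sum_append:
  "list_choice_sum g (Ls @ Ks) = list_choice_sum (\<lambda>l. list_choice_sum (\<lambda>k. g (l @ k)) Ks) Ls"
  by (induction Ls arbitrary: g) simp_all

lemma list_choice_sum_prod_list:
  "list_choice_sum (\<lambda>l. \<Prod>x\<leftarrow>l. f x) Ls = (\<Prod>L\<leftarrow>Ls. \<Sum>x\<leftarrow>L. f x)"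
  by (induction Ls) (simp_all add: list_choice_sum_mult sum_list_mult_const)

lemma list_choice_sum_move:
  assumes "\<And>xs ys. mset xs = mset ys \<Longrightarrow> g xs = g ys"
  shows "list_choice_sum g (As @ L # Bs) = list_choice_sum g (L # As @ Bs)"
  using assms
proof (induction As arbitrary: g)
  case Nil
  show ?case by (simp only: append_Nil)
next
  case (Cons K As)
  have swap: "(\<Sum>x\<leftarrow>xs. \<Sum>y\<leftarrow>ys. f x y) = (\<Sum>y\<leftarrow>ys. \<Sum>x\<leftarrow>xs. f x y)"
    for f :: "'a \<Rightarrow> 'a \<Rightarrow> real" and xs ys
    by (induction xs) (simp_all add: sum_list_addf)
  have "list_choice_sum (\<lambda>l. g (k # l)) (As @ L # Bs) = list_choice_sum (\<lambda>l. g (k # l)) (L # As @ Bs)" for k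
    using Cons.prems by (intro Cons.IH) auto
  then have "list_choice_sum g ((K # As) @ L # Bs) =
      (\<Sum>k\<leftarrow>K. \<Sum>x\<leftarrow>L. list_choice_sum (\<lambda>l. g (k # x # l)) (As @ Bs))" by simp
  also have "\<dots> = (\<Sum>k\<leftarrow>K. \<Sum>x\<leftarrow>L. list_choice_sum (\<lambda>l. g (x # k # l)) (As @ Bs))"
  proof -
    have "(\<lambda>l. g (k # x # l)) = (\<lambda>l. g (x # k # l))" for k x
      by (intro ext Cons.prems) simp
    then show ?thesis by simp
  qed
  also have "\<dots> = (\<Sum>x\<leftarrow>L. \<Sum>k\<leftarrow>K. list_choice_sum (\<lambda>l. g (x # k # l)) (As @ Bs))" by (rule swap)
  also have "\<dots> = list_choice_sum g (L # (K # As) @ Bs)" by simp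
  finally show ?case .
qed

lemma list_choice_sum_mset_cong:
  assumes "\<And>xs ys. mset xs = mset ys \<Longrightarrow> g xs = g ys" and "mset Ls = mset Ks"
  shows "list_choice_sum g Ls = list_choice_sum g Ks"
  using assms
proof (induction Ls arbitrary: g Ks)
  case Nil
  have "Ks = []" using Nil(2) by simp
  then show ?case by (simp only:)
next
  case (Cons L Ls)
  have "L \<in> set Ks" using Cons.prems(2) by (metis list.set_intros(1) set_mset_mset)
  then obtain As Bs where Ks: "Ks = As @ L # Bs" by (meson split_list)
  have "list_choice_sum (\<lambda>l. g (x # l)) Ls = list_choice_sum (\<lambda>l. g (x # l)) (As @ Bs)" for x
    using Cons.prems by (intro Cons.IH) (auto simp: Ks)
  then have "list_choice_sum g (L # Ls) = list_choice_sum g (L # As @ Bs)" by simp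
  also have "\<dots> = list_choice_sum g Ks"
    unfolding Ks by (rule list_choice_sum_move[symmetric]) (rule Cons.prems(1))
  finally show ?case .
qed

text \<open>Picking \<open>k\<close> entries of a concatenation means picking the blocks, recorded
  by \<open>\<phi>\<close>, and then an entry in each block. This is where the index functions of
  Minkowski's expansion come from.\<close>

lemma list_choice_sum_concat:
  "list_choice_sum g (replicate k (concat (map X [0..<N]))) =
    (\<Sum>\<phi>\<in>{..<k} \<rightarrow>\<^sub>E {..<N}. list_choice_sum g (map (\<lambda>j. X (\<phi> j)) [0..<k]))"
proof (induction k arbitrary: g)
  case (Suc k)
  define C where "C = concat (map X [0..<N])"
  have sumC: "(\<Sum>x\<leftarrow>C. f x) = (\<Sum>y<N. \<Sum>x\<leftarrow>X y. f x)" for f :: "'a \<Rightarrow> real"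
    unfolding C_def by (induction N) simp_all
  have fun_eq: "{..<Suc k} \<rightarrow>\<^sub>E {..<N} = (\<lambda>(y, \<phi>). \<phi>(k := y)) ` ({..<N} \<times> ({..<k} \<rightarrow>\<^sub>E {..<N}))"
    by (simp add: lessThan_Suc PiE_insert_eq)
  have inj: "inj_on (\<lambda>(y, \<phi>). \<phi>(k := y)) ({..<N} \<times> ({..<k} \<rightarrow>\<^sub>E {..<N}))"
    by (rule inj_combinator) simp
  have maps: "map (\<lambda>j. X ((\<phi>(k := y)) j)) [0..<Suc k] = map (\<lambda>j. X (\<phi> j)) [0..<k] @ [X y]" for \<phi> y
    by simp
  \<comment> \<open>The replicated list is split at its end, since a function on
    \<open>{..<Suc k}\<close> extends one on \<open>{..<k}\<close> by its value at
    \<open>k\<close>.\<close>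
  have "list_choice_sum g (replicate (Suc k) C) = list_choice_sum g (replicate k C @ [C])"
    by (simp add: replicate_append_same)
  also have "\<dots> = list_choice_sum (\<lambda>l. \<Sum>x\<leftarrow>C. g (l @ [x])) (replicate k C)"
    by (simp add: list_choice_sum_append)
  also have "\<dots> = (\<Sum>\<phi>\<in>{..<k} \<rightarrow>\<^sub>E {..<N}. list_choice_sum (\<lambda>l. \<Sum>x\<leftarrow>C. g (l @ [x])) (map (\<lambda>j. X (\<phi> j)) [0..<k]))"
    unfolding C_def by (rule Suc)
  also have "\<dots> = (\<Sum>\<phi>\<in>{..<k} \<rightarrow>\<^sub>E {..<N}. \<Sum>y<N.
      list_choice_sum g (map (\<lambda>j. X (\<phi> j)) [0..<k] @ [X y]))"
    by (simp add: sumC list_choice_sum_sum list_choice_sum_append)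
  also have "\<dots> = (\<Sum>y<N. \<Sum>\<phi>\<in>{..<k} \<rightarrow>\<^sub>E {..<N}.
      list_choice_sum g (map (\<lambda>j. X ((\<phi>(k := y)) j)) [0..<Suc k]))"
    unfolding maps by (rule sum.swap)
  also have "\<dots> = (\<Sum>\<phi>\<in>{..<Suc k} \<rightarrow>\<^sub>E {..<N}. list_choice_sum g (map (\<lambda>j. X (\<phi> j)) [0..<Suc k]))"
    unfolding fun_eq sum.reindex[OF inj] sum.cartesian_product o_def by (simp add: case_prod_unfold)
  finally show ?case unfolding C_def .
qed simp

section \<open>Homogeneity and counting for sums of absolute determinants\<close>

lemma prod_list_upt: "(\<Prod>j\<leftarrow>[0..<k]. f j) = (\<Prod>j<k. f j :: 'a::comm_monoid_mult)"
  by (induction k) (simp_all add: mult.commute)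

lemma list_choice_sum_absdet_scaleR:
  assumes "\<And>j. j \<in> set js \<Longrightarrow> 0 \<le> c j"
  shows "list_choice_sum (\<lambda>l. absdet (M @ l)) (map (\<lambda>j. map ((*\<^sub>R) (c j)) (L j)) js) =
    (\<Prod>j\<leftarrow>js. c j) * list_choice_sum (\<lambda>l. absdet (M @ l)) (map L js)"
  using assms
proof (induction js arbitrary: M)
  case (Cons j js)
  have abs: "absdet (M @ (c j *\<^sub>R x) # l) = c j * absdet (M @ x # l)" for x l
  proof -
    have "absdet (M @ (c j *\<^sub>R x) # l) = absdet ((c j *\<^sub>R x) # M @ l)" by (rule absdet_mset_cong) simp
    also have "\<dots> = c j * absdet (x # M @ l)" using Cons.prems by (simp add: absdet_scale)
    also have "absdet (x # M @ l) = absdet (M @ x # l)" by (rule absdet_mset_cong) simp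
    finally show ?thesis .
  qed
  have "list_choice_sum (\<lambda>l. absdet (M @ x # l)) (map (\<lambda>j. map ((*\<^sub>R) (c j)) (L j)) js) =
      (\<Prod>j\<leftarrow>js. c j) * list_choice_sum (\<lambda>l. absdet (M @ x # l)) (map L js)" for x
    using Cons.IH[of "M @ [x]"] Cons.prems by simp
  then show ?case
    by (simp add: o_def abs list_choice_sum_mult sum_list_const_mult mult.assoc)
qed simp

lemma zdet_full_length:
  assumes "length M = CARD('n)" shows "zdet (M :: (real^'n) list) us = absdet M"
  by (induction us) (simp_all add: zdet_length_gt assms)

text \<open>Double counting, or Euler's identity for homogeneous polynomials: a family in [A; M]
  uses n - |M| generators, and each of them can play the role of \<open>x\<close>. Using a generator
  twice gives determinant 0.\<close>

lemma zdet_euler: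
  fixes M us :: "(real^'n) list"
  shows "(\<Sum>x\<leftarrow>us. zdet (x # M) us) = (real CARD('n) - real (length M)) * zdet M us"
proof (induction us arbitrary: M)
  case (Cons u us)
  have zero: "zdet (u # u # M) us = 0" by (intro zdet_span_eq_0 span_base) simp
  have swap: "zdet (u # x # M) us = zdet (x # u # M) us" for x by (rule zdet_mset_cong) simp
  have body: "zdet (x # M) (u # us) = zdet (x # M) us + zdet (x # u # M) us" for x
    using swap[of x] by simp
  have "(\<Sum>x\<leftarrow>u # us. zdet (x # M) (u # us)) =
      zdet (u # M) us + ((\<Sum>x\<leftarrow>us. zdet (x # M) us) + (\<Sum>x\<leftarrow>us. zdet (x # u # M) us))"
    by (simp only: list.map sum_list.Cons body sum_list_addf zero add_0_right)
  also have "\<dots> = (real CARD('n) - real (length M)) * zdet M (u # us)"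
    unfolding Cons by (simp add: algebra_simps)
  finally show ?case .
qed (simp add: absdet_def)

text \<open>Ordered choices count each family of \<open>k\<close> generators \<open>fact k\<close>
  times, and choices with a repetition contribute 0. Formally, Euler's identity is used once per
  slot.\<close>

lemma list_choice_sum_replicate_absdet:
  fixes M us :: "(real^'n) list"
  assumes "length M + k = CARD('n)"
  shows "list_choice_sum (\<lambda>l. absdet (M @ l)) (replicate k us) = fact k * zdet M us"
  using assms
proof (induction k arbitrary: M)
  case (Suc k)
  have "list_choice_sum (\<lambda>l. absdet (M @ x # l)) (replicate k us) = fact k * zdet (x # M) us" for x
  proof -
    have "list_choice_sum (\<lambda>l. absdet ((M @ [x]) @ l)) (replicate k us) = fact k * zdet (M @ [x]) us"
      using Suc.prems by (intro Suc.IH) simp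
    also have "zdet (M @ [x]) us = zdet (x # M) us" by (rule zdet_mset_cong) simp
    finally show ?thesis by simp
  qed
  then have "list_choice_sum (\<lambda>l. absdet (M @ l)) (replicate (Suc k) us) =
      fact k * ((real CARD('n) - real (length M)) * zdet M us)"
    by (simp add: sum_list_const_mult zdet_euler)
  also have "real CARD('n) - real (length M) = real (Suc k)" using Suc.prems by simp
  finally show ?case by (simp add: algebra_simps)
qed (simp add: zdet_full_length)

text \<open>The polarization formula for the mixed volume. Being a finite combination of volumes of
  Minkowski sums, it is accessible to limits, unlike a definite description.\<close>

definition polar_volume :: "(real^'n) set list \<Rightarrow> real" where
  "polar_volume Ks = (\<Sum>J\<in>Pow {..<CARD('n)}.
     (-1) ^ (CARD('n) + card J) * measure lborel (\<Sum>j\<in>J. Ks ! j)) / fact CARD('n)"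

text \<open>The condition on the coefficient family inside \<open>mixed_volume\<close>, separated
  from the choice of the value at the identity so that existence and uniqueness can be treated
  apart.\<close>

definition mixed_coeffs :: "(real^'n) set list \<Rightarrow> ((nat \<Rightarrow> nat) \<Rightarrow> real) \<Rightarrow> bool" where
  "mixed_coeffs Ks W \<longleftrightarrow>
     (\<forall>\<phi>\<in>{..<CARD('n)} \<rightarrow>\<^sub>E {..<CARD('n)}. \<forall>p. p permutes {..<CARD('n)} \<longrightarrow> W (\<phi> \<circ> p) = W \<phi>) \<and>
     (\<forall>t :: nat \<Rightarrow> real. (\<forall>i<CARD('n). 0 \<le> t i) \<longrightarrow>
        measure lborel (\<Sum>i<CARD('n). (\<lambda>x. t i *\<^sub>R x) ` (Ks ! i)) =
        (\<Sum>\<phi>\<in>{..<CARD('n)} \<rightarrow>\<^sub>E {..<CARD('n)}. W \<phi> * (\<Prod>j<CARD('n). t (\<phi> j))))"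

text \<open>If some \<open>a\<close> lies in \<open>N\<close> but not in \<open>I\<close>, inserting
  \<open>a\<close> pairs the sets \<open>J\<close> with opposite signs, so everything
  cancels.\<close>

lemma alternating_sum_supersets:
  assumes "finite N" "I \<subseteq> N"
  shows "(\<Sum>J\<in>Pow N. (-1) ^ (card N + card J) * (if I \<subseteq> J then 1 else 0 :: real)) = (if I = N then 1 else 0)"
proof (cases "I = N")
  case True
  have "(\<Sum>J\<in>Pow N. (-1) ^ (card N + card J) * (if I \<subseteq> J then 1 else 0 :: real)) =
      (\<Sum>J\<in>{N}. (-1) ^ (card N + card J) * (if I \<subseteq> J then 1 else 0 :: real))"
    using assms True by (intro sum.mono_neutral_right) auto
  then show ?thesis using True by (simp flip: mult_2)
next
  case False
  then obtain a where a: "a \<in> N" "a \<notin> I" using assms(2) by blast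
  define N' where "N' = N - {a}"
  have N: "N = insert a N'" "a \<notin> N'" "finite N'" using a assms by (auto simp: N'_def)
  let ?f = "\<lambda>J. (-1) ^ (card N + card J) * (if I \<subseteq> J then 1 else 0 :: real)"
  have "sum ?f (Pow N) = sum ?f (Pow N') + sum ?f (insert a ` Pow N')"
    unfolding N(1) Pow_insert using N by (intro sum.union_disjoint) auto
  also have "sum ?f (insert a ` Pow N') = (\<Sum>J\<in>Pow N'. ?f (insert a J))"
    using N by (subst sum.reindex) (auto simp: inj_on_def)
  also have "\<dots> = (\<Sum>J\<in>Pow N'. - ?f J)"
  proof (intro sum.cong refl)
    fix J assume "J \<in> Pow N'"
    then have "finite J" "a \<notin> J" using N finite_subset by blast+
    moreover have "I \<subseteq> insert a J \<longleftrightarrow> I \<subseteq> J" using a by blast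
    ultimately show "?f (insert a J) = - ?f J" by simp
  qed
  finally show ?thesis using False by (simp add: sum_negf)
qed

text \<open>Evaluating the expansion at the indicator of \<open>J\<close> keeps the coefficients of
  those \<open>\<phi>\<close> with image in \<open>J\<close>. The alternating sum over
  \<open>J\<close> then retains only the surjective \<open>\<phi>\<close>, which are the n!
  permutations, and by symmetry all have the coefficient of the identity.\<close>

lemma mixed_coeffs_polar_volume:
  fixes Ks :: "(real^'n) set list"
  assumes W: "mixed_coeffs Ks W" and ne: "\<And>i. i < CARD('n) \<Longrightarrow> Ks ! i \<noteq> {}"
  shows "W (restrict id {..<CARD('n)}) = polar_volume Ks"
proof -
  define n where "n = CARD('n)"
  define F where "F = {..<n} \<rightarrow>\<^sub>E {..<n}"
  have finF: "finite F" by (simp add: F_def finite_PiE)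
  have sym: "W (\<phi> \<circ> p) = W \<phi>" if "\<phi> \<in> F" "p permutes {..<n}" for \<phi> p
    using W that by (simp add: mixed_coeffs_def F_def n_def)
  have W2: "measure lborel (\<Sum>i<n. (\<lambda>x. t i *\<^sub>R x) ` (Ks ! i)) = (\<Sum>\<phi>\<in>F. W \<phi> * (\<Prod>j<n. t (\<phi> j)))"
    if "\<And>i. 0 \<le> t i" for t :: "nat \<Rightarrow> real"
    using W that unfolding mixed_coeffs_def F_def n_def by blast
  have vol: "measure lborel (\<Sum>j\<in>J. Ks ! j) = (\<Sum>\<phi>\<in>F. W \<phi> * (if \<phi> ` {..<n} \<subseteq> J then 1 else 0))"
    if J: "J \<in> Pow {..<n}" for J
  proof -
    define t where "t i = (if i \<in> J then 1 else 0 :: real)" for i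
    \<comment> \<open>Scaling a nonempty set by 0 gives {0}, the neutral element of Minkowski
      addition; the empty set would stay empty.\<close>
    have "(\<Sum>i<n. (\<lambda>x. t i *\<^sub>R x) ` (Ks ! i)) = (\<Sum>i<n. if i \<in> J then Ks ! i else 0)"
      using ne by (intro sum.cong) (auto simp: t_def n_def image_constant_conv)
    also have "\<dots> = (\<Sum>j\<in>J. Ks ! j)"
      using J by (subst sum.inter_restrict[symmetric]) (auto intro!: arg_cong2[where f = sum])
    finally have "measure lborel (\<Sum>j\<in>J. Ks ! j) = (\<Sum>\<phi>\<in>F. W \<phi> * (\<Prod>j<n. t (\<phi> j)))"
      using W2[of t] by (simp add: t_def)
    also have "\<dots> = (\<Sum>\<phi>\<in>F. W \<phi> * (if \<phi> ` {..<n} \<subseteq> J then 1 else 0))"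
    proof (intro sum.cong refl arg_cong2[where f = "(*)"])
      fix \<phi> assume "\<phi> \<in> F"
      show "(\<Prod>j<n. t (\<phi> j)) = (if \<phi> ` {..<n} \<subseteq> J then 1 else 0)"
      proof (cases "\<phi> ` {..<n} \<subseteq> J")
        case True
        then show ?thesis by (auto simp: t_def intro!: prod.neutral)
      next
        case False
        then show ?thesis by (auto simp: t_def intro!: prod_zero)
      qed
    qed
    finally show ?thesis .
  qed
  have "fact n * polar_volume Ks = (\<Sum>J\<in>Pow {..<n}. (-1) ^ (n + card J) * measure lborel (\<Sum>j\<in>J. Ks ! j))"
    by (simp add: polar_volume_def flip: n_def)
  also have "\<dots> = (\<Sum>J\<in>Pow {..<n}. \<Sum>\<phi>\<in>F. W \<phi> * ((-1) ^ (n + card J) * (if \<phi> ` {..<n} \<subseteq> J then 1 else 0)))"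
    by (intro sum.cong refl) (simp only: vol sum_distrib_left mult.left_commute)
  also have "\<dots> = (\<Sum>\<phi>\<in>F. W \<phi> * (\<Sum>J\<in>Pow {..<n}. (-1) ^ (n + card J) * (if \<phi> ` {..<n} \<subseteq> J then 1 else 0)))"
    by (subst sum.swap) (simp add: sum_distrib_left)
  also have "\<dots> = (\<Sum>\<phi>\<in>F. W \<phi> * (if \<phi> ` {..<n} = {..<n} then 1 else 0))"
  proof (intro sum.cong refl arg_cong2[where f = "(*)"])
    fix \<phi> assume "\<phi> \<in> F"
    then have "\<phi> ` {..<n} \<subseteq> {..<n}" by (auto simp: F_def)
    then show "(\<Sum>J\<in>Pow {..<n}. (-1) ^ (n + card J) * (if \<phi> ` {..<n} \<subseteq> J then 1 else 0 :: real)) =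
        (if \<phi> ` {..<n} = {..<n} then 1 else 0)"
      using alternating_sum_supersets[of "{..<n}" "\<phi> ` {..<n}"] by simp
  qed
  also have "\<dots> = (\<Sum>\<phi>\<in>{\<phi>\<in>F. \<phi> ` {..<n} = {..<n}}. W \<phi>)"
    using finF by (subst sum.inter_filter) (auto intro!: sum.cong)
  \<comment> \<open>A surjective self-map of a finite set is a permutation. Composing with the
    restricted identity converts between permutations, which are the identity outside
    \<open>{..<n}\<close>, and extensional functions, which are undefined there.\<close>
  also have "{\<phi>\<in>F. \<phi> ` {..<n} = {..<n}} = (\<lambda>p. restrict id {..<n} \<circ> p) ` {p. p permutes {..<n}}"
  proof (intro set_eqI iffI)
    fix \<phi> assume "\<phi> \<in> {\<phi>\<in>F. \<phi> ` {..<n} = {..<n}}"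
    then have \<phi>: "\<phi> \<in> F" "\<phi> ` {..<n} = {..<n}" by auto
    define p where "p i = (if i < n then \<phi> i else i)" for i
    have "p ` {..<n} = {..<n}" using \<phi>(2) by (auto simp: p_def image_iff)
    then have "bij_betw p {..<n} {..<n}"
      by (simp add: bij_betw_def eq_card_imp_inj_on)
    then have p: "p permutes {..<n}" by (intro bij_imp_permutes) (auto simp: p_def)
    have "\<phi> = restrict id {..<n} \<circ> p"
      using \<phi> by (auto simp: fun_eq_iff p_def F_def PiE_iff extensional_def)
    then show "\<phi> \<in> (\<lambda>p. restrict id {..<n} \<circ> p) ` {p. p permutes {..<n}}" using p by blast
  next
    fix \<phi> assume "\<phi> \<in> (\<lambda>p. restrict id {..<n} \<circ> p) ` {p. p permutes {..<n}}"
    then obtain p where p: "p permutes {..<n}" "\<phi> = restrict id {..<n} \<circ> p" by blast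
    have lt: "p i < n \<longleftrightarrow> i < n" for i using permutes_in_image[OF p(1), of i] by simp
    have "\<phi> i = p i" if "i < n" for i using that lt p(2) by simp
    then have "\<phi> ` {..<n} = p ` {..<n}" by (intro image_cong) auto
    then have "\<phi> ` {..<n} = {..<n}" using permutes_image[OF p(1)] by simp
    moreover have "\<phi> i = undefined" if "\<not> i < n" for i using that lt p(2) by simp
    ultimately show "\<phi> \<in> {\<phi>\<in>F. \<phi> ` {..<n} = {..<n}}"
      by (auto simp: F_def PiE_iff extensional_def)
  qed
  also have "sum W \<dots> = (\<Sum>p\<in>{p. p permutes {..<n}}. W (restrict id {..<n} \<circ> p))"
  proof (subst sum.reindex)
    show "inj_on (\<lambda>p. restrict id {..<n} \<circ> p) {p. p permutes {..<n}}"
    proof (rule inj_onI, rule ext)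
      fix p q i assume p: "p \<in> {p. p permutes {..<n}}" and q: "q \<in> {p. p permutes {..<n}}"
        and eq: "restrict id {..<n} \<circ> p = restrict id {..<n} \<circ> q"
      show "p i = q i"
      proof (cases "i < n")
        case True
        then have "p i < n" "q i < n" using p q permutes_in_image[of _ "{..<n}" i] by auto
        then show ?thesis using fun_cong[OF eq, of i] by simp
      next
        case False
        then show ?thesis using p q by (simp add: permutes_not_in)
      qed
    qed
  qed simp
  also have "\<dots> = (\<Sum>p\<in>{p. p permutes {..<n}}. W (restrict id {..<n}))"
    by (intro sum.cong refl sym) (auto simp: F_def)
  also have "\<dots> = fact n * W (restrict id {..<n})"
    by (simp add: card_permutations[of "{..<n}" n])
  finally show ?thesis by (simp add: n_def)
qed

text \<open>All admissible families agree at the identity, so the definite description denotes as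
  soon as one such family exists.\<close>

lemma mixed_volume_eq_polar_volume:
  fixes Ks :: "(real^'n) set list"
  assumes W: "mixed_coeffs Ks W" and ne: "\<And>i. i < CARD('n) \<Longrightarrow> Ks ! i \<noteq> {}"
  shows "mixed_volume Ks = polar_volume Ks"
proof -
  have "mixed_volume Ks = (THE v. \<exists>W. mixed_coeffs Ks W \<and> v = W (restrict id {..<CARD('n)}))"
    by (simp add: mixed_volume_def mixed_coeffs_def Let_def conj_assoc)
  also have "\<dots> = polar_volume Ks"
  proof (rule the_equality)
    show "\<exists>W. mixed_coeffs Ks W \<and> polar_volume Ks = W (restrict id {..<CARD('n)})"
      using W mixed_coeffs_polar_volume[OF W ne] by (intro exI[of _ W] conjI) (auto simp only:)
    show "v = polar_volume Ks" if "\<exists>W. mixed_coeffs Ks W \<and> v = W (restrict id {..<CARD('n)})" for v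
      using that mixed_coeffs_polar_volume[OF _ ne] by (elim exE conjE) (simp only:)
  qed
  finally show ?thesis .
qed

text \<open>The scaled sum is a translate of the zonotope generated by all scaled generators. Its
  volume is 1/n! times a sum over ordered choices of n generators; sorting them by the body they
  come from and extracting the scalars gives the expansion. Symmetry is that of
  \<open>absdet\<close>.\<close>

lemma mixed_coeffs_zonotopes:
  fixes Ks :: "(real^'n) set list"
  assumes K: "\<And>i. i < CARD('n) \<Longrightarrow> Ks ! i = {a i} + seg_sum (L i)"
  shows "mixed_coeffs Ks (\<lambda>\<phi>. list_choice_sum absdet (map (\<lambda>j. L (\<phi> j)) [0..<CARD('n)]) / fact CARD('n))"
  unfolding mixed_coeffs_def
proof (intro conjI ballI allI impI)
  let ?n = "CARD('n)"
  fix \<phi> p assume "p permutes {..<?n}"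
  then have "mset (map (\<lambda>j. L ((\<phi> \<circ> p) j)) [0..<?n]) = mset (map (\<lambda>j. L (\<phi> j)) [0..<?n])"
  proof -
    assume p: "p permutes {..<?n}"
    have "image_mset p (mset_set {..<?n}) = mset_set {..<?n}"
      using p by (simp add: image_mset_mset_set permutes_inj_on permutes_image)
    then have "image_mset (\<lambda>j. L (\<phi> j)) (image_mset p (mset_set {..<?n})) =
        image_mset (\<lambda>j. L (\<phi> j)) (mset_set {..<?n})" by simp
    then show ?thesis
      by (simp add: image_mset.compositionality o_def atLeast0LessThan)
  qed
  then show "list_choice_sum absdet (map (\<lambda>j. L ((\<phi> \<circ> p) j)) [0..<?n]) / fact ?n =
      list_choice_sum absdet (map (\<lambda>j. L (\<phi> j)) [0..<?n]) / fact ?n"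
    using list_choice_sum_mset_cong[of absdet, OF absdet_mset_cong] by metis
next
  let ?n = "CARD('n)"
  fix t :: "nat \<Rightarrow> real" assume t: "\<forall>i<?n. 0 \<le> t i"
  define U where "U = concat (map (\<lambda>i. map ((*\<^sub>R) (t i)) (L i)) [0..<?n])"
  have lin: "linear (\<lambda>x::real^'n. c *\<^sub>R x)" for c by (intro linearI) (auto simp: algebra_simps)
  have img: "(\<lambda>x. t i *\<^sub>R x) ` (Ks ! i) = {t i *\<^sub>R a i} + seg_sum (map ((*\<^sub>R) (t i)) (L i))" if "i < ?n" for i
    using that by (simp add: K linear_image_set_plus[OF lin] seg_sum_linear_image[OF lin])
  have sumk: "(\<Sum>i<k. {t i *\<^sub>R a i} + seg_sum (map ((*\<^sub>R) (t i)) (L i))) =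
      {\<Sum>i<k. t i *\<^sub>R a i} + seg_sum (concat (map (\<lambda>i. map ((*\<^sub>R) (t i)) (L i)) [0..<k]))" for k
  proof (induction k)
    case (Suc k)
    have "{x} + {y} = {x + y}" for x y :: "real^'n" by (auto simp: set_plus_def)
    then have "{\<Sum>i<Suc k. t i *\<^sub>R a i} = {\<Sum>i<k. t i *\<^sub>R a i} + {t k *\<^sub>R a k}" by simp
    then show ?case using Suc by (simp add: seg_sum_append ac_simps)
  qed simp
  have "(\<Sum>i<?n. (\<lambda>x. t i *\<^sub>R x) ` (Ks ! i)) = (\<Sum>i<?n. {t i *\<^sub>R a i} + seg_sum (map ((*\<^sub>R) (t i)) (L i)))"
    by (intro sum.cong) (auto simp: img)
  then have "measure lborel (\<Sum>i<?n. (\<lambda>x. t i *\<^sub>R x) ` (Ks ! i)) = zdet [] U"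
    unfolding sumk U_def[symmetric] by (simp add: measure_translate_seg_sum)
  also have "\<dots> = list_choice_sum absdet (replicate ?n U) / fact ?n"
    using list_choice_sum_replicate_absdet[of "[]" ?n U] by simp
  also have "list_choice_sum absdet (replicate ?n U) =
      (\<Sum>\<phi>\<in>{..<?n} \<rightarrow>\<^sub>E {..<?n}. list_choice_sum absdet (map (\<lambda>j. map ((*\<^sub>R) (t (\<phi> j))) (L (\<phi> j))) [0..<?n]))"
    unfolding U_def by (rule list_choice_sum_concat)
  also have "\<dots> = (\<Sum>\<phi>\<in>{..<?n} \<rightarrow>\<^sub>E {..<?n}. (\<Prod>j<?n. t (\<phi> j)) * list_choice_sum absdet (map (\<lambda>j. L (\<phi> j)) [0..<?n]))"
  proof (intro sum.cong refl)
    fix \<phi> assume "\<phi> \<in> {..<?n} \<rightarrow>\<^sub>E {..<?n}"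
    then have "0 \<le> t (\<phi> j)" if "j \<in> set [0..<?n]" for j using t that by (auto simp: PiE_iff)
    from list_choice_sum_absdet_scaleR[of "[0..<?n]" "\<lambda>j. t (\<phi> j)" "[]" "\<lambda>j. L (\<phi> j)", OF this]
    show "list_choice_sum absdet (map (\<lambda>j. map ((*\<^sub>R) (t (\<phi> j))) (L (\<phi> j))) [0..<?n]) =
        (\<Prod>j<?n. t (\<phi> j)) * list_choice_sum absdet (map (\<lambda>j. L (\<phi> j)) [0..<?n])"
      by (simp add: prod_list_upt)
  qed
  finally show "measure lborel (\<Sum>i<?n. (\<lambda>x. t i *\<^sub>R x) ` (Ks ! i)) =
      (\<Sum>\<phi>\<in>{..<?n} \<rightarrow>\<^sub>E {..<?n}. list_choice_sum absdet (map (\<lambda>j. L (\<phi> j)) [0..<?n]) / fact ?n * (\<Prod>j<?n. t (\<phi> j)))"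
    by (simp add: sum_divide_distrib mult.commute)
qed

lemma mixed_volume_zonotopes:
  fixes Ks :: "(real^'n) set list"
  assumes K: "\<And>i. i < CARD('n) \<Longrightarrow> Ks ! i = {a i} + seg_sum (L i)"
  shows "polar_volume Ks = list_choice_sum absdet (map L [0..<CARD('n)]) / fact CARD('n)"
    and "mixed_volume Ks = list_choice_sum absdet (map L [0..<CARD('n)]) / fact CARD('n)"
proof -
  have ne: "Ks ! i \<noteq> {}" if "i < CARD('n)" for i by (simp add: K[OF that] singleton_set_plus)
  have id: "map (\<lambda>j. L (restrict id {..<CARD('n)} j)) [0..<CARD('n)] = map L [0..<CARD('n)]"
    by (intro map_cong) auto
  show pol: "polar_volume Ks = list_choice_sum absdet (map L [0..<CARD('n)]) / fact CARD('n)"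
    using mixed_coeffs_polar_volume[OF mixed_coeffs_zonotopes[OF K] ne] unfolding id by (rule sym)
  show "mixed_volume Ks = list_choice_sum absdet (map L [0..<CARD('n)]) / fact CARD('n)"
    using mixed_volume_eq_polar_volume[OF mixed_coeffs_zonotopes[OF K] ne] unfolding pol .
qed

section \<open>Mixed volumes of limits of zonotopes\<close>

lemma zonotope_sum: "(\<And>i. i \<in> J \<Longrightarrow> zonotope (X i)) \<Longrightarrow> zonotope (\<Sum>i\<in>J. X i)"
proof (induction J rule: infinite_finite_induct)
  case (insert i J)
  then show ?case by (auto intro: zonotope_plus)
qed (use zonotope_seg_sum[of "[]"] in auto)

lemma compact_sum_sets: "(\<And>i. i \<in> J \<Longrightarrow> compact (X i)) \<Longrightarrow> compact (\<Sum>i\<in>J. X i :: 'a::real_normed_vector set)"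
proof (induction J rule: infinite_finite_induct)
  case (insert i J)
  then show ?case by (auto intro: compact_set_plus)
qed auto

lemma polar_volume_tendsto:
  fixes K :: "nat \<Rightarrow> (real^'n) set"
  assumes "\<And>i. i < CARD('n) \<Longrightarrow> compact (K i)" "\<And>i j. i < CARD('n) \<Longrightarrow> zonotope (X i j)"
    "\<And>i. i < CARD('n) \<Longrightarrow> hconv (X i) (K i)"
  shows "(\<lambda>j. polar_volume (map (\<lambda>i. X i j) [0..<CARD('n)])) \<longlonglongrightarrow> polar_volume (map K [0..<CARD('n)])"
proof -
  have "(\<lambda>j. measure lborel (\<Sum>i\<in>J. map (\<lambda>i. X i j) [0..<CARD('n)] ! i)) \<longlonglongrightarrow>
      measure lborel (\<Sum>i\<in>J. map K [0..<CARD('n)] ! i)" if J: "J \<in> Pow {..<CARD('n)}" for J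
  proof -
    have fin: "finite J" using J finite_subset by blast
    have "(\<Sum>i\<in>J. map (\<lambda>i. X i j) [0..<CARD('n)] ! i) = (\<Sum>i\<in>J. X i j)" for j
      using J by (intro sum.cong) auto
    moreover have "(\<Sum>i\<in>J. map K [0..<CARD('n)] ! i) = (\<Sum>i\<in>J. K i)"
      using J by (intro sum.cong) auto
    moreover have "(\<lambda>j. measure lborel (\<Sum>i\<in>J. X i j)) \<longlonglongrightarrow> measure lborel (\<Sum>i\<in>J. K i)"
    proof (rule measure_tendsto_zonotopes)
      show "zonotope (\<Sum>i\<in>J. X i j)" for j
        using J assms(2) by (intro zonotope_sum) auto
      show "compact (\<Sum>i\<in>J. K i)"
        using J assms(1) by (intro compact_sum_sets) auto
      show "hconv (\<lambda>j. \<Sum>i\<in>J. X i j) (\<Sum>i\<in>J. K i)"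
        using J assms(3) by (intro hconv_sum[OF fin]) auto
    qed
    ultimately show ?thesis by simp
  qed
  then show ?thesis unfolding polar_volume_def by (intro tendsto_intros) auto
qed

text \<open>Minkowski's expansion passes to Hausdorff limits because its coefficients, by polarization, do.\<close>

lemma mixed_volume_limit:
  fixes K :: "nat \<Rightarrow> (real^'n) set"
  assumes K: "\<And>i. i < CARD('n) \<Longrightarrow> compact (K i)" and ne: "\<And>i. i < CARD('n) \<Longrightarrow> K i \<noteq> {}"
    and X: "\<And>i j. i < CARD('n) \<Longrightarrow> zonotope (X i j)" and conv: "\<And>i. i < CARD('n) \<Longrightarrow> hconv (X i) (K i)"
  shows "mixed_volume (map K [0..<CARD('n)]) = polar_volume (map K [0..<CARD('n)])"
    and "(\<lambda>j. mixed_volume (map (\<lambda>i. X i j) [0..<CARD('n)])) \<longlonglongrightarrow> mixed_volume (map K [0..<CARD('n)])"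
proof -
  let ?n = "CARD('n)"
  let ?F = "{..<?n} \<rightarrow>\<^sub>E {..<?n}"
  have "\<forall>i j. \<exists>a us. i < ?n \<longrightarrow> X i j = {a} + seg_sum us" using X zonotope_iff by metis
  then obtain a L where L: "\<And>i j. i < ?n \<Longrightarrow> X i j = {a i j} + seg_sum (L i j)" by metis
  have polX: "polar_volume (map (\<lambda>i. X (\<phi> i) j) [0..<?n]) =
      list_choice_sum absdet (map (\<lambda>i. L (\<phi> i) j) [0..<?n]) / fact ?n" if "\<phi> ` {..<?n} \<subseteq> {..<?n}" for \<phi> j
    using that L by (intro mixed_volume_zonotopes[where a = "\<lambda>i. a (\<phi> i) j"]) auto
  have mvX: "mixed_volume (map (\<lambda>i. X i j) [0..<?n]) = polar_volume (map (\<lambda>i. X i j) [0..<?n])" for j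
    using mixed_volume_zonotopes[of "map (\<lambda>i. X i j) [0..<?n]" "\<lambda>i. a i j" "\<lambda>i. L i j"] L by simp
  have coeffsX: "mixed_coeffs (map (\<lambda>i. X i j) [0..<?n])
      (\<lambda>\<phi>. list_choice_sum absdet (map (\<lambda>i. L (\<phi> i) j) [0..<?n]) / fact ?n)" for j
    using L by (intro mixed_coeffs_zonotopes[where a = "\<lambda>i. a i j"]) auto
  \<comment> \<open>The coefficient for \<open>\<phi>\<close> is the polarization of the bodies
    reindexed by \<open>\<phi>\<close>, possibly with repetitions. As a limit of the coefficients
    for zonotopes it keeps their symmetry and the expansion.\<close>
  define W where "W \<phi> = polar_volume (map (\<lambda>i. K (\<phi> i)) [0..<?n])" for \<phi>
  have limW: "(\<lambda>j. list_choice_sum absdet (map (\<lambda>i. L (\<phi> i) j) [0..<?n]) / fact ?n) \<longlonglongrightarrow> W \<phi>"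
    if \<phi>: "\<phi> ` {..<?n} \<subseteq> {..<?n}" for \<phi>
  proof -
    have "(\<lambda>j. polar_volume (map (\<lambda>i. X (\<phi> i) j) [0..<?n])) \<longlonglongrightarrow> W \<phi>"
      unfolding W_def using \<phi> K X conv by (intro polar_volume_tendsto) auto
    then show ?thesis by (simp add: polX[OF \<phi>])
  qed
  have "mixed_coeffs (map K [0..<?n]) W"
    unfolding mixed_coeffs_def
  proof (intro conjI ballI allI impI)
    fix \<phi> p assume \<phi>: "\<phi> \<in> ?F" and p: "p permutes {..<?n}"
    have sub: "\<phi> ` {..<?n} \<subseteq> {..<?n}" using \<phi> by auto
    moreover have "(\<phi> \<circ> p) ` {..<?n} = \<phi> ` {..<?n}"
      unfolding image_comp[symmetric] permutes_image[OF p] ..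
    ultimately have "(\<lambda>j. list_choice_sum absdet (map (\<lambda>i. L ((\<phi> \<circ> p) i) j) [0..<?n]) / fact ?n) \<longlonglongrightarrow> W (\<phi> \<circ> p)"
      by (intro limW) simp
    moreover have "list_choice_sum absdet (map (\<lambda>i. L ((\<phi> \<circ> p) i) j) [0..<?n]) / fact ?n =
        list_choice_sum absdet (map (\<lambda>i. L (\<phi> i) j) [0..<?n]) / fact ?n" for j
      using coeffsX[of j] \<phi> p unfolding mixed_coeffs_def by blast
    ultimately show "W (\<phi> \<circ> p) = W \<phi>" using limW[OF sub] LIMSEQ_unique by simp
  next
    fix t :: "nat \<Rightarrow> real" assume t: "\<forall>i<?n. 0 \<le> t i"
    have lin: "linear (\<lambda>x::real^'n. c *\<^sub>R x)" for c by (intro linearI) (auto simp: algebra_simps)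
    have eq: "(\<Sum>i<?n. (\<lambda>x. t i *\<^sub>R x) ` (map Y [0..<?n] ! i)) = (\<Sum>i<?n. (\<lambda>x. t i *\<^sub>R x) ` Y i)"
      for Y :: "nat \<Rightarrow> (real^'n) set" by (intro sum.cong) auto
    have "(\<lambda>j. measure lborel (\<Sum>i<?n. (\<lambda>x. t i *\<^sub>R x) ` X i j)) \<longlonglongrightarrow>
        measure lborel (\<Sum>i<?n. (\<lambda>x. t i *\<^sub>R x) ` K i)"
      using K X conv
      by (intro measure_tendsto_zonotopes zonotope_sum compact_sum_sets hconv_sum hconv_linear_image
          zonotope_linear_image compact_scaling lin) auto
    moreover have "measure lborel (\<Sum>i<?n. (\<lambda>x. t i *\<^sub>R x) ` X i j) =
        (\<Sum>\<phi>\<in>?F. list_choice_sum absdet (map (\<lambda>i. L (\<phi> i) j) [0..<?n]) / fact ?n * (\<Prod>j<?n. t (\<phi> j)))" for j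
      using coeffsX[of j, unfolded mixed_coeffs_def, THEN conjunct2, THEN spec, of t] t
      unfolding eq by (rule mp)
    moreover have "(\<lambda>j. \<Sum>\<phi>\<in>?F. list_choice_sum absdet (map (\<lambda>i. L (\<phi> i) j) [0..<?n]) / fact ?n * (\<Prod>j<?n. t (\<phi> j)))
        \<longlonglongrightarrow> (\<Sum>\<phi>\<in>?F. W \<phi> * (\<Prod>j<?n. t (\<phi> j)))"
      by (intro tendsto_sum tendsto_mult tendsto_const limW) auto
    ultimately show "measure lborel (\<Sum>i<?n. (\<lambda>x. t i *\<^sub>R x) ` (map K [0..<?n] ! i)) =
        (\<Sum>\<phi>\<in>?F. W \<phi> * (\<Prod>j<?n. t (\<phi> j)))"
      unfolding eq using LIMSEQ_unique by simp
  qed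
  then show mvK: "mixed_volume (map K [0..<?n]) = polar_volume (map K [0..<?n])"
    using ne by (intro mixed_volume_eq_polar_volume) auto
  show "(\<lambda>j. mixed_volume (map (\<lambda>i. X i j) [0..<?n])) \<longlonglongrightarrow> mixed_volume (map K [0..<?n])"
    unfolding mvK mvX using K X conv by (rule polar_volume_tendsto)
qed

section \<open>The equivalences\<close>

lemma sum_segments_eq_seg_sum:
  fixes S :: "nat set"
  assumes "finite S"
  shows "(\<Sum>i\<in>S. closed_segment 0 (u i)) = seg_sum (map u (sorted_list_of_set S))"
  using sum.distinct_set_conv_list[of "sorted_list_of_set S" "\<lambda>i. closed_segment 0 (u i)"] assms
  by (simp add: seg_sum_def o_def)

lemma measure_sum_segments:
  fixes u :: "nat \<Rightarrow> real^'n"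
  assumes "finite S"
  shows "measure lborel (\<Sum>i\<in>S. closed_segment 0 (u i)) = zdet [] (map u (sorted_list_of_set S))"
  by (simp add: sum_segments_eq_seg_sum[OF assms] measure_seg_sum)

text \<open>Appending n zero vectors guarantees k \<ge> n without changing any bracket. The shift by
  1 is due to families being indexed from 1 and lists from 0.\<close>

lemma obtain_family:
  fixes us :: "(real^'n) list"
  obtains k and u :: "nat \<Rightarrow> real^'n"
  where "k \<ge> CARD('n)" "\<And>vs. zdet vs (map u (sorted_list_of_set {1..k})) = zdet vs us"
proof -
  define ys where "ys = us @ replicate CARD('n) 0"
  define u where "u i = ys ! (i - 1)" for i
  have "sorted_list_of_set {1..length ys} = [1..<Suc (length ys)]"
    by (metis atLeastLessThanSuc_atLeastAtMost sorted_list_of_set_range)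
  moreover have "map u [1..<Suc (length ys)] = ys"
    by (intro nth_equalityI) (auto simp: u_def simp del: upt_Suc)
  ultimately have "zdet vs (map u (sorted_list_of_set {1..length ys})) = zdet vs us" for vs
    by (simp add: ys_def zdet_zeros)
  moreover have "length ys \<ge> CARD('n)" by (simp add: ys_def)
  ultimately show ?thesis using that by blast
qed

text \<open>The value \<open>-\<infinity>\<close> absorbs every other value of \<open>elog\<close>,
  just as 0 absorbs factors in a product, so the equivalence persists for vanishing volumes.\<close>

lemma elog_add_le_iff:
  assumes "0 \<le> a" "0 \<le> b" "0 \<le> c" "0 \<le> d"
  shows "elog a + elog b \<le> elog c + elog d \<longleftrightarrow> a * b \<le> c * d"
proof (cases "a = 0 \<or> b = 0")
  case True
  then have "elog a + elog b = -\<infinity>" by (auto simp: elog_def)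
  moreover have "a * b \<le> c * d" using True assms by auto
  ultimately show ?thesis by (simp only: ereal_less_eq)
next
  case False
  then have ab: "a > 0" "b > 0" using assms by auto
  show ?thesis
  proof (cases "c = 0 \<or> d = 0")
    case True
    then have "elog c + elog d = -\<infinity>" by (auto simp: elog_def)
    moreover have "\<not> a * b \<le> c * d" using True ab by (auto simp: not_le)
    ultimately show ?thesis using ab by (auto simp: elog_def)
  next
    case False
    then have cd: "c > 0" "d > 0" using assms by auto
    have "ln a + ln b \<le> ln c + ln d \<longleftrightarrow> ln (a * b) \<le> ln (c * d)"
      using ab cd by (simp add: ln_mult)
    also have "\<dots> \<longleftrightarrow> a * b \<le> c * d" using ab cd by (intro ln_le_cancel_iff) auto
    finally show ?thesis using ab cd by (simp add: elog_def)
  qed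
qed

lemma obtain_orthonormal_list:
  assumes "subspace (G :: 'a::euclidean_space set)"
  obtains vs where "orthonormal vs" "span (set vs) = G"
proof -
  obtain B where B: "B \<subseteq> G" "pairwise orthogonal B" "\<And>x. x \<in> B \<Longrightarrow> norm x = 1" "independent B" "span B = G"
    using orthonormal_basis_subspace[OF assms] by metis
  obtain vs where "set vs = B" "distinct vs"
    using finite_distinct_list independent_imp_finite[OF B(4)] by blast
  then show ?thesis using B that[of vs] by (auto simp: orthonormal_def)
qed

lemma zonoid_approximation:
  assumes "zonoid A"
  shows "\<exists>X. compact A \<and> A \<noteq> {} \<and> (\<forall>j. zonotope (X j)) \<and> hconv X A"
  using zonoidE[OF assms] assms unfolding zonoid_def by metis

text \<open>For the pair inequality, \<open>x\<close> and \<open>y\<close> are placed at two new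
  indices, and submodularity is used for the two sets that add one of them each to
  \<open>{1..k}\<close>. Conversely, the generators with indices in the intersection of
  \<open>S\<close> and \<open>T\<close> form the base, and those in the two differences are the
  added lists.\<close>

lemma submodular_iff_pair_ineq:
  "(\<forall>k\<ge>CARD('n). \<forall>u::nat \<Rightarrow> real^'n.
      submodular_on {1..k} (\<lambda>S. elog (measure lborel (\<Sum>i\<in>S. closed_segment 0 (u i))))) \<longleftrightarrow>
   (\<forall>us x y. pair_ineq (us :: (real^'n) list) x y)"
proof (intro iffI allI impI)
  fix us :: "(real^'n) list" and x y :: "real^'n"
  assume H: "\<forall>k\<ge>CARD('n). \<forall>u::nat \<Rightarrow> real^'n.
      submodular_on {1..k} (\<lambda>S. elog (measure lborel (\<Sum>i\<in>S. closed_segment 0 (u i))))"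
  obtain k v where k: "k \<ge> CARD('n)" and v: "\<And>vs. zdet vs (map v (sorted_list_of_set {1..k})) = zdet vs us"
    using obtain_family[of us] by blast
  define u where "u i = (if i = Suc k then x else if i = Suc (Suc k) then y else v i)" for i
  have base: "(\<Sum>i\<in>{1..k}. closed_segment 0 (u i)) = seg_sum (map v (sorted_list_of_set {1..k}))"
    unfolding sum_segments_eq_seg_sum[OF finite_atLeastAtMost, symmetric] by (intro sum.cong) (auto simp: u_def)
  define W where "W = map v (sorted_list_of_set {1..k})"
  have sums: "(\<Sum>i\<in>{1..k}. closed_segment 0 (u i)) = seg_sum W"
    "(\<Sum>i\<in>insert (Suc k) {1..k}. closed_segment 0 (u i)) = seg_sum (x # W)"
    "(\<Sum>i\<in>insert (Suc (Suc k)) {1..k}. closed_segment 0 (u i)) = seg_sum (y # W)"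
    "(\<Sum>i\<in>insert (Suc k) (insert (Suc (Suc k)) {1..k}). closed_segment 0 (u i)) = seg_sum (x # y # W)"
  proof -
    have u: "u (Suc k) = x" "u (Suc (Suc k)) = y" by (simp_all add: u_def)
    have notin: "Suc k \<notin> {1..k}" "Suc (Suc k) \<notin> {1..k}" "Suc k \<notin> insert (Suc (Suc k)) {1..k}" by auto
    show 1: "(\<Sum>i\<in>{1..k}. closed_segment 0 (u i)) = seg_sum W" unfolding W_def by (rule base)
    show "(\<Sum>i\<in>insert (Suc k) {1..k}. closed_segment 0 (u i)) = seg_sum (x # W)"
      "(\<Sum>i\<in>insert (Suc (Suc k)) {1..k}. closed_segment 0 (u i)) = seg_sum (y # W)"
      "(\<Sum>i\<in>insert (Suc k) (insert (Suc (Suc k)) {1..k}). closed_segment 0 (u i)) = seg_sum (x # y # W)"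
      by (simp_all only: sum.insert finite_insert finite_atLeastAtMost notin not_False_eq_True u 1 seg_sum_simps)
  qed
  have "zdet vs W = zdet vs us" for vs unfolding W_def by (rule v)
  then have vol: "measure lborel (\<Sum>i\<in>{1..k}. closed_segment 0 (u i)) = zdet [] us"
    "measure lborel (\<Sum>i\<in>insert (Suc k) {1..k}. closed_segment 0 (u i)) = zdet [] (x # us)"
    "measure lborel (\<Sum>i\<in>insert (Suc (Suc k)) {1..k}. closed_segment 0 (u i)) = zdet [] (y # us)"
    "measure lborel (\<Sum>i\<in>insert (Suc k) (insert (Suc (Suc k)) {1..k}). closed_segment 0 (u i)) = zdet [] (x # y # us)"
    unfolding sums by (simp_all only: measure_seg_sum zdet.simps)
  have "elog (measure lborel (\<Sum>i\<in>insert (Suc k) {1..k} \<union> insert (Suc (Suc k)) {1..k}. closed_segment 0 (u i))) +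
      elog (measure lborel (\<Sum>i\<in>insert (Suc k) {1..k} \<inter> insert (Suc (Suc k)) {1..k}. closed_segment 0 (u i))) \<le>
      elog (measure lborel (\<Sum>i\<in>insert (Suc k) {1..k}. closed_segment 0 (u i))) +
      elog (measure lborel (\<Sum>i\<in>insert (Suc (Suc k)) {1..k}. closed_segment 0 (u i)))"
  proof -
    have "submodular_on {1..Suc (Suc k)} (\<lambda>S. elog (measure lborel (\<Sum>i\<in>S. closed_segment 0 (u i))))"
      using H k by simp
    moreover have "insert (Suc k) {1..k} \<subseteq> {1..Suc (Suc k)}" "insert (Suc (Suc k)) {1..k} \<subseteq> {1..Suc (Suc k)}"
      by auto
    ultimately show ?thesis unfolding submodular_on_def by blast
  qed
  moreover have "insert (Suc k) {1..k} \<union> insert (Suc (Suc k)) {1..k} = insert (Suc k) (insert (Suc (Suc k)) {1..k})"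
    "insert (Suc k) {1..k} \<inter> insert (Suc (Suc k)) {1..k} = {1..k}" by auto
  ultimately have "elog (zdet [] (x # y # us)) + elog (zdet [] us) \<le> elog (zdet [] (x # us)) + elog (zdet [] (y # us))"
    by (simp only: vol)
  then have "zdet [] (x # y # us) * zdet [] us \<le> zdet [] (x # us) * zdet [] (y # us)"
    by (subst (asm) elog_add_le_iff) (auto simp del: zdet.simps)
  then show "pair_ineq us x y" unfolding pair_ineq_iff by (simp only: mult.commute)
next
  fix k and u :: "nat \<Rightarrow> real^'n"
  assume H: "\<forall>us x y. pair_ineq (us :: (real^'n) list) x y"
  define L where "L S = map u (sorted_list_of_set S)" for S
  define f where "f S = (\<Sum>i\<in>S. closed_segment 0 (u i))" for S
  have f: "f S = seg_sum (L S)" if "finite S" for S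
    unfolding f_def L_def using that by (rule sum_segments_eq_seg_sum)
  have "elog (measure lborel (f (S \<union> T))) + elog (measure lborel (f (S \<inter> T))) \<le>
      elog (measure lborel (f S)) + elog (measure lborel (f T))"
    if "S \<subseteq> {1..k}" "T \<subseteq> {1..k}" for S T
  proof -
    have fin: "finite S" "finite T" using that finite_subset by blast+
    define a b c where "a = L (S \<inter> T)" and "b = L (S - T)" and "c = L (T - S)"
    have S: "f S = seg_sum (b @ a)"
      using fin sum.Int_Diff[of S "\<lambda>i. closed_segment 0 (u i)" T] f[of "S \<inter> T"] f[of "S - T"]
      by (simp add: f_def a_def b_def seg_sum_append add.commute)
    have T: "f T = seg_sum (c @ a)"
      using fin sum.Int_Diff[of T "\<lambda>i. closed_segment 0 (u i)" S] f[of "S \<inter> T"] f[of "T - S"]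
      by (simp add: f_def a_def c_def seg_sum_append add.commute Int_commute)
    have "f (S \<union> T) = f (S - T) + f T"
    proof -
      have "(S - T) \<inter> T = {}" by blast
      then show ?thesis
        using fin sum.union_disjoint[of "S - T" T "\<lambda>i. closed_segment 0 (u i)"]
        by (simp add: f_def Un_Diff_cancel2)
    qed
    then have U: "f (S \<union> T) = seg_sum (b @ c @ a)"
      using fin f[of "S - T"] by (simp add: T b_def seg_sum_append)
    have I: "f (S \<inter> T) = seg_sum a" using fin f[of "S \<inter> T"] by (simp add: a_def)
    have "zdet [] (b @ c @ a) * zdet [] a \<le> zdet [] (b @ a) * zdet [] (c @ a)"
      using submodular_lists[of a b c] H by (simp add: mult.commute)
    then show ?thesis unfolding S T U I measure_seg_sum by (subst elog_add_le_iff) auto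
  qed
  then show "submodular_on {1..k} (\<lambda>S. elog (measure lborel (\<Sum>i\<in>S. closed_segment 0 (u i))))"
    unfolding f_def[symmetric] submodular_on_def by (auto simp: elog_def)
qed

text \<open>Single segments are admissible as \<open>B\<close> and \<open>C\<close>. Conversely,
  volumes ignore the translations of zonotopes, which reduces them to lists, and both products are
  continuous along approximating zonotopes.\<close>

lemma zonoid_volume_iff_pair_ineq:
  "(\<forall>A B C :: (real^'n) set. zonoid A \<longrightarrow> zonoid B \<longrightarrow> zonoid C \<longrightarrow>
     measure lborel A * measure lborel (A + B + C) \<le> measure lborel (A + B) * measure lborel (A + C)) \<longleftrightarrow>
   (\<forall>us x y. pair_ineq (us :: (real^'n) list) x y)"
proof (intro iffI allI impI)
  fix us :: "(real^'n) list" and x y :: "real^'n"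
  assume H: "\<forall>A B C :: (real^'n) set. zonoid A \<longrightarrow> zonoid B \<longrightarrow> zonoid C \<longrightarrow>
     measure lborel A * measure lborel (A + B + C) \<le> measure lborel (A + B) * measure lborel (A + C)"
  have Z: "zonoid (seg_sum vs)" for vs :: "(real^'n) list" by (simp add: zonotope_imp_zonoid)
  have "measure lborel (seg_sum us) * measure lborel (seg_sum us + seg_sum [x] + seg_sum [y]) \<le>
      measure lborel (seg_sum us + seg_sum [x]) * measure lborel (seg_sum us + seg_sum [y])"
    using H Z by blast
  moreover have "seg_sum us + seg_sum [x] + seg_sum [y] = seg_sum (x # y # us)"
    "seg_sum us + seg_sum [x] = seg_sum (x # us)" "seg_sum us + seg_sum [y] = seg_sum (y # us)"
    unfolding seg_sum_append[symmetric] by (rule seg_sum_mset_cong; simp)+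
  ultimately show "pair_ineq us x y" unfolding pair_ineq_iff by (simp only: measure_seg_sum)
next
  fix A B C :: "(real^'n) set"
  assume H: "\<forall>us x y. pair_ineq (us :: (real^'n) list) x y" and ABC: "zonoid A" "zonoid B" "zonoid C"
  have zonotopes: "measure lborel A * measure lborel (A + B + C) \<le> measure lborel (A + B) * measure lborel (A + C)"
    if "zonotope A" "zonotope B" "zonotope C" for A B C :: "(real^'n) set"
  proof -
    obtain a us b vs c ws where A: "A = {a} + seg_sum us" and B: "B = {b} + seg_sum vs" and C: "C = {c} + seg_sum ws"
      using \<open>zonotope A\<close> \<open>zonotope B\<close> \<open>zonotope C\<close> zonotope_iff by metis
    have sing: "{x} + {y} = {x + y}" for x y :: "real^'n" by (auto simp: set_plus_def)
    have "A + B = ({a} + {b}) + seg_sum (vs @ us)" "A + C = ({a} + {c}) + seg_sum (ws @ us)"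
      "A + B + C = (({a} + {b}) + {c}) + seg_sum (vs @ ws @ us)"
      by (simp_all only: A B C seg_sum_append ac_simps)
    then have "measure lborel A = zdet [] us" "measure lborel (A + B) = zdet [] (vs @ us)"
      "measure lborel (A + C) = zdet [] (ws @ us)" "measure lborel (A + B + C) = zdet [] (vs @ ws @ us)"
      by (simp_all only: A sing measure_translate_seg_sum)
    then show ?thesis using submodular_lists[of us vs ws] H by (simp only:)
  qed
  obtain X where X: "compact A" "\<And>j. zonotope (X j)" "hconv X A" using zonoidE[OF ABC(1)] by blast
  obtain Y where Y: "compact B" "\<And>j. zonotope (Y j)" "hconv Y B" using zonoidE[OF ABC(2)] by blast
  obtain Z where Z: "compact C" "\<And>j. zonotope (Z j)" "hconv Z C" using zonoidE[OF ABC(3)] by blast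
  note intros = measure_tendsto_zonotopes compact_set_plus zonotope_plus hconv_plus X Y Z
  have "(\<lambda>j. measure lborel (X j) * measure lborel (X j + Y j + Z j)) \<longlonglongrightarrow>
      measure lborel A * measure lborel (A + B + C)"
    by (intro tendsto_mult intros)
  moreover have "(\<lambda>j. measure lborel (X j + Y j) * measure lborel (X j + Z j)) \<longlonglongrightarrow>
      measure lborel (A + B) * measure lborel (A + C)"
    by (intro tendsto_mult intros)
  ultimately show "measure lborel A * measure lborel (A + B + C) \<le> measure lborel (A + B) * measure lborel (A + C)"
    by (rule LIMSEQ_le) (use zonotopes X Y Z in blast)
qed

text \<open>The four sums are exactly the brackets in \<open>pair_ineq\<close>. For n = 1 the sum
  with two prescribed vectors is empty, in agreement with the vanishing bracket.\<close>

lemma det_sums_iff_pair_ineq: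
  "(\<forall>k\<ge>CARD('n). \<forall>u::nat \<Rightarrow> real^'n. \<forall>x y :: real^'n.
     (\<Sum>I\<in>{I. I \<subseteq> {1..k} \<and> card I = CARD('n)}. \<bar>det_vecs (map u (sorted_list_of_set I))\<bar>) *
     (\<Sum>I\<in>{I. I \<subseteq> {1..k} \<and> int (card I) = int CARD('n) - 2}.
        \<bar>det_vecs (x # y # map u (sorted_list_of_set I))\<bar>)
     \<le>
     (\<Sum>I\<in>{I. I \<subseteq> {1..k} \<and> int (card I) = int CARD('n) - 1}.
        \<bar>det_vecs (x # map u (sorted_list_of_set I))\<bar>) *
     (\<Sum>I\<in>{I. I \<subseteq> {1..k} \<and> int (card I) = int CARD('n) - 1}.
        \<bar>det_vecs (y # map u (sorted_list_of_set I))\<bar>)) \<longleftrightarrow>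
   (\<forall>us x y. pair_ineq (us :: (real^'n) list) x y)"
proof -
  have sums:
    "(\<Sum>I\<in>{I. I \<subseteq> {1..k} \<and> card I = CARD('n)}. \<bar>det_vecs (map u (sorted_list_of_set I))\<bar>) =
      zdet [] (map u (sorted_list_of_set {1..k}))"
    "(\<Sum>I\<in>{I. I \<subseteq> {1..k} \<and> int (card I) = int CARD('n) - 1}. \<bar>det_vecs (x # map u (sorted_list_of_set I))\<bar>) =
      zdet [x] (map u (sorted_list_of_set {1..k}))"
    "(\<Sum>I\<in>{I. I \<subseteq> {1..k} \<and> int (card I) = int CARD('n) - 2}. \<bar>det_vecs (x # y # map u (sorted_list_of_set I))\<bar>) =
      zdet [x, y] (map u (sorted_list_of_set {1..k}))"
    for u :: "nat \<Rightarrow> real^'n" and k x y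
    using zdet_card_sum[of "{1..k}" "[]" u] zdet_card_sum[of "{1..k}" "[x]" u]
      zdet_card_sum[of "{1..k}" "[x, y]" u]
    by simp_all
  show ?thesis
    unfolding sums pair_ineq_def[symmetric]
  proof (intro iffI allI impI)
    fix us :: "(real^'n) list" and x y :: "real^'n"
    assume H: "\<forall>k\<ge>CARD('n). \<forall>u x y. pair_ineq (map u (sorted_list_of_set {1..k})) x (y :: real^'n)"
    obtain k u where k: "k \<ge> CARD('n)" and u: "\<And>vs. zdet vs (map u (sorted_list_of_set {1..k})) = zdet vs us"
      using obtain_family[of us] by blast
    then have "pair_ineq (map u (sorted_list_of_set {1..k})) x y" using H by blast
    then show "pair_ineq us x y" unfolding pair_ineq_def u .
  qed blast
qed

text \<open>The inclusion hypothesis says that the orthogonal complements of \<open>E\<close> and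
  \<open>F\<close> are orthogonal to each other. Hence orthonormal bases \<open>vs\<close> and
  \<open>ws\<close> of them join to one of the complement of \<open>E \<inter> F\<close>, and
  \<open>lists_ineq\<close> applies. In the other direction the complements are the lines through
  orthonormal \<open>x\<close> and \<open>y\<close>.\<close>

lemma projections_iff_pair_ineq:
  "(\<forall>(A :: (real^'n) set) E F. zonoid A \<longrightarrow> subspace E \<longrightarrow> subspace F \<longrightarrow>
     orthogonal_comp E \<subseteq> F \<longrightarrow>
     measure lborel A * proj_vol (E \<inter> F) A \<le> proj_vol E A * proj_vol F A) \<longleftrightarrow>
   (\<forall>us x y. pair_ineq (us :: (real^'n) list) x y)"
proof (intro iffI allI impI)
  fix us :: "(real^'n) list" and x y :: "real^'n"
  assume H: "\<forall>(A :: (real^'n) set) E F. zonoid A \<longrightarrow> subspace E \<longrightarrow> subspace F \<longrightarrow>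
     orthogonal_comp E \<subseteq> F \<longrightarrow>
     measure lborel A * proj_vol (E \<inter> F) A \<le> proj_vol E A * proj_vol F A"
  show "pair_ineq us x y"
  proof (rule pair_ineq_if_orthonormal)
    fix us :: "(real^'n) list" and x y :: "real^'n" assume xy: "orthonormal [x, y]"
    then have x: "orthonormal [x]" and y: "orthonormal [y]" and "x \<bullet> y = 0"
      by (auto simp: orthonormal_def pairwise_def orthogonal_def)
    define E where "E = orthogonal_comp (span (set [x]))"
    define F where "F = orthogonal_comp (span (set [y]))"
    have "x \<in> F" using \<open>x \<bullet> y = 0\<close> by (simp add: F_def mem_orthogonal_comp_span)
    then have "span {x} \<subseteq> F" unfolding F_def by (intro span_minimal subspace_orthogonal_comp) auto
    then have sub: "orthogonal_comp E \<subseteq> F" by (simp add: E_def orthogonal_comp_self)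
    have EF: "E \<inter> F = orthogonal_comp (span (set [x, y]))"
      by (rule set_eqI) (simp only: Int_iff E_def F_def mem_orthogonal_comp_span; simp)
    have "measure lborel (seg_sum us) * proj_vol (E \<inter> F) (seg_sum us) \<le>
        proj_vol E (seg_sum us) * proj_vol F (seg_sum us)"
      using H sub subspace_orthogonal_comp zonotope_imp_zonoid[OF zonotope_seg_sum]
      unfolding E_def F_def by blast
    then show "pair_ineq us x y"
      unfolding EF unfolding E_def F_def measure_seg_sum pair_ineq_def
      using proj_vol_zonotope[OF x, of 0 us] proj_vol_zonotope[OF y, of 0 us] proj_vol_zonotope[OF xy, of 0 us]
      by (simp only: set_add_0)
  qed
next
  fix A E F :: "(real^'n) set"
  assume H: "\<forall>us x y. pair_ineq (us :: (real^'n) list) x y" and A: "zonoid A"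
    and E: "subspace E" and F: "subspace F" and sub: "orthogonal_comp E \<subseteq> F"
  obtain vs where vs: "orthonormal vs" "span (set vs) = orthogonal_comp E"
    using obtain_orthonormal_list[OF subspace_orthogonal_comp] .
  obtain ws where ws: "orthonormal ws" "span (set ws) = orthogonal_comp F"
    using obtain_orthonormal_list[OF subspace_orthogonal_comp] .
  have E': "E = orthogonal_comp (span (set vs))" and F': "F = orthogonal_comp (span (set ws))"
    using E F by (simp_all add: vs ws orthogonal_comp_self)
  have vw: "v \<bullet> w = 0" if "v \<in> set vs" "w \<in> set ws" for v w
  proof -
    have "v \<in> F" using that(1) vs(2) sub span_base by blast
    then show ?thesis using that(2) by (simp add: F' mem_orthogonal_comp_span)
  qed
  have "set vs \<inter> set ws = {}"
  proof -
    have False if "v \<in> set vs" "v \<in> set ws" for v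
      using vw[OF that] orthonormal_inner[OF vs(1) that(1) that(1)] by simp
    then show ?thesis by blast
  qed
  then have vsws: "orthonormal (vs @ ws)"
    using vs(1) ws(1) vw inner_commute[of _ "_ :: real^'n"]
    by (auto simp: orthonormal_def pairwise_def orthogonal_def) metis
  have EF: "E \<inter> F = orthogonal_comp (span (set (vs @ ws)))"
    by (rule set_eqI) (simp only: Int_iff E' F' mem_orthogonal_comp_span; auto)
  obtain X where X: "compact A" "\<And>j. zonotope (X j)" "hconv X A" using zonoidE[OF A] by blast
  show "measure lborel A * proj_vol (E \<inter> F) A \<le> proj_vol E A * proj_vol F A"
  proof (rule LIMSEQ_le)
    show "(\<lambda>j. measure lborel (X j) * proj_vol (E \<inter> F) (X j)) \<longlonglongrightarrow> measure lborel A * proj_vol (E \<inter> F) A"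
      unfolding EF by (intro tendsto_mult measure_tendsto_zonotopes proj_vol_tendsto X vsws)
    show "(\<lambda>j. proj_vol E (X j) * proj_vol F (X j)) \<longlonglongrightarrow> proj_vol E A * proj_vol F A"
      unfolding E' F' by (intro tendsto_mult proj_vol_tendsto X vs(1) ws(1))
    have "measure lborel (X j) * proj_vol (E \<inter> F) (X j) \<le> proj_vol E (X j) * proj_vol F (X j)" for j
    proof -
      obtain a us where "X j = {a} + seg_sum us" using X(2) zonotope_iff by metis
      then show ?thesis
        unfolding EF unfolding E' F'
        using lists_ineq[of us vs ws] H
        by (simp only: proj_vol_zonotope[OF vs(1)] proj_vol_zonotope[OF ws(1)] proj_vol_zonotope[OF vsws]
            measure_translate_seg_sum)
    qed
    then show "\<exists>N. \<forall>j\<ge>N. measure lborel (X j) * proj_vol (E \<inter> F) (X j) \<le> proj_vol E (X j) * proj_vol F (X j)"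
      by blast
  qed
qed


text \<open>The case m = 2 is the pair inequality for orthonormal vectors, which implies the general
  one; \<open>prod_ineq\<close> gives all m.\<close>

lemma orthonormal_projections_iff_pair_ineq:
  "(\<forall>m\<in>{1..CARD('n)}. \<forall>(A :: (real^'n) set) (u :: nat \<Rightarrow> real^'n).
     zonoid A \<longrightarrow>
     (\<forall>i\<in>{1..m}. \<forall>j\<in>{1..m}. u i \<bullet> u j = (if i = j then 1 else 0)) \<longrightarrow>
     measure lborel A ^ (m - 1) * proj_vol (orthogonal_comp (span (u ` {1..m}))) A
       \<le> (\<Prod>i=1..m. proj_vol (orthogonal_comp (span {u i})) A)) \<longleftrightarrow>
   (\<forall>us x y. pair_ineq (us :: (real^'n) list) x y)" (is "?P \<longleftrightarrow> _")
proof (intro iffI allI impI ballI)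
  fix us :: "(real^'n) list" and x y :: "real^'n"
  assume H: ?P
  show "pair_ineq us x y"
  proof (rule pair_ineq_if_orthonormal)
    fix us :: "(real^'n) list" and x y :: "real^'n" assume xy: "orthonormal [x, y]"
    then have x: "orthonormal [x]" and y: "orthonormal [y]"
      by (auto simp: orthonormal_def pairwise_def orthogonal_def)
    have "x \<noteq> y" "pairwise orthogonal {x, y}" "0 \<notin> {x, y}" using xy by (auto simp: orthonormal_def)
    then have "independent {x, y}" "x \<noteq> y"
      using pairwise_orthogonal_independent[of "{x, y}"] by blast+
    \<comment> \<open>Two orthonormal vectors exist only for n \<ge> 2, so m = 2 lies in the allowed
      range.\<close>
    then have card: "CARD('n) \<ge> 2" using independent_bound[of "{x, y}"] by simp
    define u where "u i = (if i = 1 then x else y)" for i :: nat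
    have two: "{1..2} = {1, 2::nat}" by auto
    have ortho: "\<forall>i\<in>{1..2}. \<forall>j\<in>{1..2}. u i \<bullet> u j = (if i = j then 1 else 0)"
      unfolding two using orthonormal_inner[OF xy] \<open>x \<noteq> y\<close> by (simp add: u_def)
    have img: "u ` {1..2} = set [x, y]" unfolding two by (auto simp: u_def)
    have zon: "zonoid (seg_sum us)" by (simp add: zonotope_imp_zonoid)
    have two_mem: "2 \<in> {1..CARD('n)}" using card by simp
    have "measure lborel (seg_sum us) ^ (2 - 1) * proj_vol (orthogonal_comp (span (u ` {1..2}))) (seg_sum us)
       \<le> (\<Prod>i=1..2. proj_vol (orthogonal_comp (span {u i})) (seg_sum us))"
      by (rule bspec[OF H two_mem, THEN spec, THEN spec, THEN mp, THEN mp, OF zon ortho])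
    also have "(\<Prod>i=1..2. proj_vol (orthogonal_comp (span {u i})) (seg_sum us)) =
        proj_vol (orthogonal_comp (span (set [x]))) (seg_sum us) *
        proj_vol (orthogonal_comp (span (set [y]))) (seg_sum us)"
      unfolding two by (simp add: u_def)
    finally show "pair_ineq us x y"
      unfolding img
      using proj_vol_zonotope[OF x, of 0 us] proj_vol_zonotope[OF y, of 0 us] proj_vol_zonotope[OF xy, of 0 us]
      by (simp add: pair_ineq_def measure_seg_sum)
  qed
next
  fix m and A :: "(real^'n) set" and u :: "nat \<Rightarrow> real^'n"
  assume H: "\<forall>us x y. pair_ineq (us :: (real^'n) list) x y" and m: "m \<in> {1..CARD('n)}"
    and A: "zonoid A" and u: "\<forall>i\<in>{1..m}. \<forall>j\<in>{1..m}. u i \<bullet> u j = (if i = j then 1 else 0)"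
  define vs where "vs = map u [1..<Suc m]"
  have set_vs: "set vs = u ` {1..m}" by (auto simp: vs_def simp del: upt_Suc)
  \<comment> \<open>Equal vectors at distinct indices would have inner product both 1 and 0.\<close>
  have inj: "inj_on u {1..m}"
    using u by (intro inj_onI) (metis zero_neq_one)
  have vs: "orthonormal vs"
    unfolding orthonormal_def
  proof (intro conjI)
    show "distinct vs"
      unfolding vs_def distinct_map using inj by (simp add: atLeastLessThanSuc_atLeastAtMost del: upt_Suc)
    show "pairwise orthogonal (set vs)"
      unfolding set_vs using u by (auto simp: pairwise_def orthogonal_def)
    show "\<forall>v\<in>set vs. norm v = 1"
      unfolding set_vs using u by (auto simp: norm_eq_1)
  qed
  have ui: "orthonormal [u i]" if "i \<in> {1..m}" for i
    using u that by (simp add: orthonormal_def norm_eq_1)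
  have si: "{u i} = set [u i]" for i by simp
  obtain X where X: "compact A" "\<And>j. zonotope (X j)" "hconv X A" using zonoidE[OF A] by blast
  let ?l = "\<lambda>A. measure lborel A ^ (m - 1) * proj_vol (orthogonal_comp (span (u ` {1..m}))) A"
  let ?r = "\<lambda>A. \<Prod>i=1..m. proj_vol (orthogonal_comp (span {u i})) A"
  show "?l A \<le> ?r A"
  proof (rule LIMSEQ_le)
    show "(\<lambda>j. ?l (X j)) \<longlonglongrightarrow> ?l A"
      unfolding set_vs[symmetric]
      by (intro tendsto_mult tendsto_power measure_tendsto_zonotopes proj_vol_tendsto X vs)
    show "(\<lambda>j. ?r (X j)) \<longlonglongrightarrow> ?r A"
      unfolding si by (intro tendsto_prod proj_vol_tendsto X ui)
    have "?l (X j) \<le> ?r (X j)" for j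
    proof -
      obtain a us where Xj: "X j = {a} + seg_sum us" using X(2) zonotope_iff by metis
      have "?r (X j) = (\<Prod>i=1..m. zdet [u i] us)"
        unfolding si Xj by (intro prod.cong refl proj_vol_zonotope ui)
      also have "\<dots> = (\<Prod>v\<leftarrow>vs. zdet [v] us)"
        using prod.distinct_set_conv_list[of "[1..<Suc m]" "\<lambda>i. zdet [u i] us"]
        by (simp add: vs_def o_def atLeastLessThanSuc_atLeastAtMost del: upt_Suc)
      finally have r: "?r (X j) = (\<Prod>v\<leftarrow>vs. zdet [v] us)" .
      have "length vs = m" "vs \<noteq> []" using m by (auto simp: vs_def)
      then have "zdet [] us ^ (m - 1) * zdet vs us \<le> (\<Prod>v\<leftarrow>vs. zdet [v] us)"
        using prod_ineq[of vs us] H by blast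
      then show ?thesis
        unfolding r set_vs[symmetric]
        by (simp only: Xj proj_vol_zonotope[OF vs] measure_translate_seg_sum)
    qed
    then show "\<exists>N. \<forall>j\<ge>N. ?l (X j) \<le> ?r (X j)" by blast
  qed
qed

lemma replicate_append_map_eq:
  assumes "m \<le> n"
  shows "replicate (n - m) A @ map B [1..<m + 1] =
    map (\<lambda>i. if i < n - m then A else B (i - (n - m) + 1)) [0..<n]"
  using assms by (intro nth_equalityI) (auto simp: nth_append simp del: upt_Suc)

text \<open>By symmetry the slots of A may come last. For a fixed choice \<open>l\<close> of
  generators of the other bodies, the choices in the n - m slots of A add up to (n - m)! times the
  bracket [A; l].\<close>

lemma mixed_volume_replicate_zonotopes:
  fixes us :: "(real^'n) list" and bs :: "nat \<Rightarrow> (real^'n) list"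
  assumes m: "m \<le> CARD('n)" and B: "\<And>i. i \<in> {1..m} \<Longrightarrow> B i = {b i} + seg_sum (bs i)"
  shows "mixed_volume (replicate (CARD('n) - m) ({a} + seg_sum us) @ map B [1..<m + 1]) =
    fact (CARD('n) - m) / fact CARD('n) * list_choice_sum (\<lambda>l. zdet l us) (map bs [1..<m + 1])"
proof -
  define n where "n = CARD('n)"
  define L where "L i = (if i < n - m then us else bs (i - (n - m) + 1))" for i
  define c where "c i = (if i < n - m then a else b (i - (n - m) + 1))" for i
  have "mixed_volume (replicate (n - m) ({a} + seg_sum us) @ map B [1..<m + 1]) =
      list_choice_sum absdet (map L [0..<n]) / fact n"
    unfolding n_def
  proof (rule mixed_volume_zonotopes(2)[where a = c])
    fix i assume i: "i < CARD('n)"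
    have "i - (n - m) + 1 \<in> {1..m}" if "\<not> i < n - m" using i that m by (auto simp: n_def)
    then show "(replicate (CARD('n) - m) ({a} + seg_sum us) @ map B [1..<m + 1]) ! i = {c i} + seg_sum (L i)"
      unfolding replicate_append_map_eq[OF m] using i B by (auto simp: c_def L_def n_def)
  qed
  also have "map L [0..<n] = replicate (n - m) us @ map bs [1..<m + 1]"
    unfolding L_def using m by (intro replicate_append_map_eq[symmetric]) (simp add: n_def)
  also have "list_choice_sum absdet (replicate (n - m) us @ map bs [1..<m + 1]) =
      list_choice_sum absdet (map bs [1..<m + 1] @ replicate (n - m) us)"
    by (intro list_choice_sum_mset_cong absdet_mset_cong) auto
  also have "\<dots> = list_choice_sum (\<lambda>l. list_choice_sum (\<lambda>k. absdet (l @ k)) (replicate (n - m) us)) (map bs [1..<m + 1])"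
    by (rule list_choice_sum_append)
  also have "\<dots> = list_choice_sum (\<lambda>l. fact (n - m) * zdet l us) (map bs [1..<m + 1])"
    using m by (intro list_choice_sum_cong list_choice_sum_replicate_absdet) (simp add: n_def del: upt_Suc)
  finally show ?thesis by (simp add: list_choice_sum_mult n_def del: upt_Suc)
qed

lemma mixed_volume_replicate_tendsto:
  fixes A :: "(real^'n) set"
  assumes m: "m \<le> CARD('n)"
    and A: "compact A" "A \<noteq> {}" "\<And>j. zonotope (X j)" "hconv X A"
    and B: "\<And>i. i \<in> {1..m} \<Longrightarrow> compact (B i)" "\<And>i. i \<in> {1..m} \<Longrightarrow> B i \<noteq> {}"
      "\<And>i j. i \<in> {1..m} \<Longrightarrow> zonotope (Y i j)" "\<And>i. i \<in> {1..m} \<Longrightarrow> hconv (Y i) (B i)"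
  shows "(\<lambda>j. mixed_volume (replicate (CARD('n) - m) (X j) @ map (\<lambda>i. Y i j) [1..<m + 1]))
    \<longlonglongrightarrow> mixed_volume (replicate (CARD('n) - m) A @ map B [1..<m + 1])"
proof -
  define n where "n = CARD('n)"
  define K where "K i = (if i < n - m then A else B (i - (n - m) + 1))" for i
  define Z where "Z i = (if i < n - m then X else Y (i - (n - m) + 1))" for i
  have idx: "i - (n - m) + 1 \<in> {1..m}" if "\<not> i < n - m" "i < n" for i using that m by (auto simp: n_def)
  have "(\<lambda>j. mixed_volume (map (\<lambda>i. Z i j) [0..<CARD('n)])) \<longlonglongrightarrow> mixed_volume (map K [0..<CARD('n)])"
    using A B idx by (intro mixed_volume_limit(2)) (auto simp: K_def Z_def n_def)
  moreover have "map (\<lambda>i. Z i j) [0..<CARD('n)] = replicate (CARD('n) - m) (X j) @ map (\<lambda>i. Y i j) [1..<m + 1]" for j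
    unfolding replicate_append_map_eq[OF m] by (simp add: Z_def n_def)
  moreover have "map K [0..<CARD('n)] = replicate (CARD('n) - m) A @ map B [1..<m + 1]"
    unfolding replicate_append_map_eq[OF m] by (simp add: K_def n_def)
  ultimately show ?thesis by simp
qed

text \<open>The constant comes from the normalization. The mixed volume on the left is (n - m)!/n!
  times a sum of brackets [A; l], and each V(A[n-1], B_i) is 1/n times the sum of [A; v] over the
  generators v of B_i. After the powers of n cancel, the same factor remains on both sides. The
  product of sums on the right expands over the same choices l as the left side, so
  \<open>prod_ineq\<close> can be applied term by term. The converse takes m = 2 and single
  segments.\<close>

lemma mixed_volumes_iff_pair_ineq:
  "(\<forall>m\<in>{1..CARD('n)}. \<forall>(A :: (real^'n) set) (B :: nat \<Rightarrow> (real^'n) set).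
     zonoid A \<longrightarrow> (\<forall>i\<in>{1..m}. zonoid (B i)) \<longrightarrow>
     measure lborel A ^ (m - 1) *
       mixed_volume (replicate (CARD('n) - m) A @ map B [1..<m + 1])
     \<le> real CARD('n) ^ m * fact (CARD('n) - m) / fact CARD('n) *
        (\<Prod>i=1..m. mixed_volume (replicate (CARD('n) - 1) A @ [B i]))) \<longleftrightarrow>
   (\<forall>us x y. pair_ineq (us :: (real^'n) list) x y)" (is "?P \<longleftrightarrow> _")
proof (intro iffI allI impI ballI)
  have single: "mixed_volume (replicate (CARD('n) - 1) ({a} + seg_sum us) @ [{b} + seg_sum bs]) =
      (\<Sum>x\<leftarrow>bs. zdet [x] us) / real CARD('n)" for a b :: "real^'n" and us bs
  proof -
    have "mixed_volume (replicate (CARD('n) - 1) ({a} + seg_sum us) @ map (\<lambda>_. {b} + seg_sum bs) [1..<1 + 1]) =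
        fact (CARD('n) - 1) / fact CARD('n) * list_choice_sum (\<lambda>l. zdet l us) (map (\<lambda>_. bs) [1..<1 + 1])"
      by (rule mixed_volume_replicate_zonotopes) (auto simp: Suc_leI)
    moreover have "fact CARD('n) = real CARD('n) * fact (CARD('n) - 1)" by (simp add: fact_reduce)
    ultimately show ?thesis by simp
  qed
  {
    fix us :: "(real^'n) list" and x y :: "real^'n"
    assume H: ?P
    show "pair_ineq us x y"
    proof (cases "CARD('n) \<ge> 2")
      case False
      then have "zdet [x, y] us = 0" by (intro zdet_length_gt) simp
      then show ?thesis by (simp add: pair_ineq_def)
    next
      case True
      define n where "n = CARD('n)"
      define bs where "bs i = (if i = 1 then [x] else [y])" for i :: nat
      define B where "B i = {0} + seg_sum (bs i)" for i
      have two: "{1..2} = {1, 2::nat}" "[1..<2 + 1] = [1, 2::nat]" by (auto simp: upt_rec)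
      have zon: "zonoid ({0} + seg_sum us)" "\<forall>i\<in>{1..2}. zonoid (B i)"
        by (simp_all add: B_def zonotope_imp_zonoid)
      have two_mem: "2 \<in> {1..CARD('n)}" using True by simp
      have "measure lborel ({0} + seg_sum us) ^ (2 - 1) *
            mixed_volume (replicate (CARD('n) - 2) ({0} + seg_sum us) @ map B [1..<2 + 1])
          \<le> real CARD('n) ^ 2 * fact (CARD('n) - 2) / fact CARD('n) *
            (\<Prod>i=1..2. mixed_volume (replicate (CARD('n) - 1) ({0} + seg_sum us) @ [B i]))"
        by (rule bspec[OF H two_mem, THEN spec, THEN spec, THEN mp, THEN mp, OF zon])
      also have "mixed_volume (replicate (CARD('n) - 2) ({0} + seg_sum us) @ map B [1..<2 + 1]) =
          fact (CARD('n) - 2) / fact CARD('n) * list_choice_sum (\<lambda>l. zdet l us) (map bs [1..<2 + 1])"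
        by (rule mixed_volume_replicate_zonotopes[OF True, where b = "\<lambda>_. 0"]) (simp add: B_def)
      also have "list_choice_sum (\<lambda>l. zdet l us) (map bs [1..<2 + 1]) = zdet [x, y] us"
        unfolding two by (simp add: bs_def)
      also have "(\<Prod>i=1..2. mixed_volume (replicate (CARD('n) - 1) ({0} + seg_sum us) @ [B i])) =
          (zdet [x] us / n) * (zdet [y] us / n)"
        unfolding B_def single two by (simp add: bs_def n_def)
      finally have "fact (n - 2) / fact n * (zdet [] us * zdet [x, y] us) \<le>
          fact (n - 2) / fact n * (zdet [x] us * zdet [y] us)"
        unfolding measure_translate_seg_sum n_def[symmetric] using True
        by (simp add: n_def power2_eq_square field_simps)
      moreover have "fact (n - 2) / fact n > (0::real)" by simp
      ultimately show ?thesis unfolding pair_ineq_def by (metis mult_le_cancel_left_pos)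
    qed
  next
    fix m and A :: "(real^'n) set" and B :: "nat \<Rightarrow> (real^'n) set"
    assume H: "\<forall>us x y. pair_ineq (us :: (real^'n) list) x y" and m: "m \<in> {1..CARD('n)}"
      and A: "zonoid A" and B: "\<forall>i\<in>{1..m}. zonoid (B i)"
    let ?l = "\<lambda>A B. measure lborel A ^ (m - 1) * mixed_volume (replicate (CARD('n) - m) A @ map B [1..<m + 1])"
    let ?r = "\<lambda>A B. real CARD('n) ^ m * fact (CARD('n) - m) / fact CARD('n) *
        (\<Prod>i=1..m. mixed_volume (replicate (CARD('n) - 1) A @ [B i]))"
    have m': "1 \<le> m" "m \<le> CARD('n)" using m by auto
    obtain X where X: "compact A" "A \<noteq> {}" "\<And>j. zonotope (X j)" "hconv X A"
      using zonoid_approximation[OF A] by blast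
    have "\<forall>i\<in>{1..m}. \<exists>Y. compact (B i) \<and> B i \<noteq> {} \<and> (\<forall>j. zonotope (Y j)) \<and> hconv Y (B i)"
      using B zonoid_approximation by blast
    then obtain Y where "\<forall>i\<in>{1..m}. compact (B i) \<and> B i \<noteq> {} \<and> (\<forall>j. zonotope (Y i j)) \<and> hconv (Y i) (B i)"
      by (rule bchoice[THEN exE])
    then have Y: "\<And>i. i \<in> {1..m} \<Longrightarrow> compact (B i)" "\<And>i. i \<in> {1..m} \<Longrightarrow> B i \<noteq> {}"
      "\<And>i j. i \<in> {1..m} \<Longrightarrow> zonotope (Y i j)" "\<And>i. i \<in> {1..m} \<Longrightarrow> hconv (Y i) (B i)" by blast+
    show "?l A B \<le> ?r A B"
    proof (rule LIMSEQ_le)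
      show "(\<lambda>j. ?l (X j) (\<lambda>i. Y i j)) \<longlonglongrightarrow> ?l A B"
        by (intro tendsto_mult tendsto_power measure_tendsto_zonotopes mixed_volume_replicate_tendsto X Y m'(2))
      have "(\<lambda>j. mixed_volume (replicate (CARD('n) - 1) (X j) @ map (\<lambda>_. Y i j) [1..<1 + 1])) \<longlonglongrightarrow>
          mixed_volume (replicate (CARD('n) - 1) A @ map (\<lambda>_. B i) [1..<1 + 1])" if "i \<in> {1..m}" for i
        using m' by (intro mixed_volume_replicate_tendsto X Y that) auto
      then have "(\<lambda>j. mixed_volume (replicate (CARD('n) - 1) (X j) @ [Y i j])) \<longlonglongrightarrow>
          mixed_volume (replicate (CARD('n) - 1) A @ [B i])" if "i \<in> {1..m}" for i
        using that by simp
      then show "(\<lambda>j. ?r (X j) (\<lambda>i. Y i j)) \<longlonglongrightarrow> ?r A B"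
        by (intro tendsto_mult tendsto_const tendsto_prod)
      have "?l (X j) (\<lambda>i. Y i j) \<le> ?r (X j) (\<lambda>i. Y i j)" for j
      proof -
        obtain a us where Xj: "X j = {a} + seg_sum us" using X(3) zonotope_iff by metis
        have "\<forall>i\<in>{1..m}. \<exists>p. Y i j = {fst p} + seg_sum (snd p)"
          using Y(3) zonotope_iff by (metis fst_conv snd_conv)
        then obtain p where p: "\<forall>i\<in>{1..m}. Y i j = {fst (p i)} + seg_sum (snd (p i))"
          by (rule bchoice[THEN exE])
        define bs where "bs i = snd (p i)" for i
        define f where "f = (fact (CARD('n) - m) / fact CARD('n) :: real)"
        have "?l (X j) (\<lambda>i. Y i j) = zdet [] us ^ (m - 1) * (f * list_choice_sum (\<lambda>l. zdet l us) (map bs [1..<m + 1]))"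
          unfolding Xj measure_translate_seg_sum f_def
          using p mixed_volume_replicate_zonotopes[OF m'(2), of "\<lambda>i. Y i j" "\<lambda>i. fst (p i)" bs a us]
          by (simp add: bs_def del: upt_Suc)
        also have "\<dots> = f * list_choice_sum (\<lambda>l. zdet [] us ^ (m - 1) * zdet l us) (map bs [1..<m + 1])"
          by (simp add: list_choice_sum_mult del: upt_Suc)
        also have "\<dots> \<le> f * list_choice_sum (\<lambda>l. \<Prod>v\<leftarrow>l. zdet [v] us) (map bs [1..<m + 1])"
        proof (intro mult_left_mono list_choice_sum_mono)
          fix l :: "(real^'n) list" assume "length l = length (map bs [1..<m + 1])"
          then have l: "length l = m" "l \<noteq> []" using m' by auto
          show "zdet [] us ^ (m - 1) * zdet l us \<le> (\<Prod>v\<leftarrow>l. zdet [v] us)"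
            using prod_ineq[OF _ l(2), of us] H l(1) by blast
        qed (simp add: f_def)
        also have "list_choice_sum (\<lambda>l. \<Prod>v\<leftarrow>l. zdet [v] us) (map bs [1..<m + 1]) =
            (\<Prod>i=1..m. \<Sum>v\<leftarrow>bs i. zdet [v] us)"
          using prod.distinct_set_conv_list[of "[1..<Suc m]" "\<lambda>i. \<Sum>v\<leftarrow>bs i. zdet [v] us"]
          by (simp add: list_choice_sum_prod_list o_def atLeastLessThanSuc_atLeastAtMost del: upt_Suc)
        also have "\<dots> = (\<Prod>i=1..m. real CARD('n) * mixed_volume (replicate (CARD('n) - 1) (X j) @ [Y i j]))"
        proof (intro prod.cong refl)
          fix i assume "i \<in> {1..m}"
          then have "Y i j = {fst (p i)} + seg_sum (bs i)" using p by (simp add: bs_def)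
          then show "(\<Sum>v\<leftarrow>bs i. zdet [v] us) = real CARD('n) * mixed_volume (replicate (CARD('n) - 1) (X j) @ [Y i j])"
            unfolding Xj by (simp only: single) simp
        qed
        also have "f * \<dots> = ?r (X j) (\<lambda>i. Y i j)"
          by (simp add: f_def prod.distrib)
        finally show ?thesis .
      qed
      then show "\<exists>N. \<forall>j\<ge>N. ?l (X j) (\<lambda>i. Y i j) \<le> ?r (X j) (\<lambda>i. Y i j)" by blast
    qed
  }
qed

text \<open>The first conjunct justifies the two expressions for f. The list has six entries because
  submodularity and its formulation for zonoids are kept apart; each entry rewrites to the same pair
  inequality, whereupon the equivalence is trivial.\<close>

theorem theorem5p2:
  shows
   "(\<forall>k\<ge>CARD('n). \<forall>u::nat \<Rightarrow> real^'n. \<forall>S\<subseteq>{1..k}.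
       elog (measure lborel (\<Sum>i\<in>S. closed_segment 0 (u i))) =
       elog (\<Sum>I\<in>{I. I \<subseteq> S \<and> card I = CARD('n)}. \<bar>det_vecs (map u (sorted_list_of_set I))\<bar>))
    \<and>
    all_equivalent [
      (\<forall>k\<ge>CARD('n). \<forall>u::nat \<Rightarrow> real^'n.
         submodular_on {1..k} (\<lambda>S. elog (measure lborel (\<Sum>i\<in>S. closed_segment 0 (u i))))),

      (\<forall>A B C :: (real^'n) set. zonoid A \<longrightarrow> zonoid B \<longrightarrow> zonoid C \<longrightarrow>
         measure lborel A * measure lborel (A + B + C)
           \<le> measure lborel (A + B) * measure lborel (A + C)),

      (\<forall>k\<ge>CARD('n). \<forall>u::nat \<Rightarrow> real^'n. \<forall>x y :: real^'n.
         (\<Sum>I\<in>{I. I \<subseteq> {1..k} \<and> card I = CARD('n)}. \<bar>det_vecs (map u (sorted_list_of_set I))\<bar>) *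
         (\<Sum>I\<in>{I. I \<subseteq> {1..k} \<and> int (card I) = int CARD('n) - 2}.
            \<bar>det_vecs (x # y # map u (sorted_list_of_set I))\<bar>)
         \<le>
         (\<Sum>I\<in>{I. I \<subseteq> {1..k} \<and> int (card I) = int CARD('n) - 1}.
            \<bar>det_vecs (x # map u (sorted_list_of_set I))\<bar>) *
         (\<Sum>I\<in>{I. I \<subseteq> {1..k} \<and> int (card I) = int CARD('n) - 1}.
            \<bar>det_vecs (y # map u (sorted_list_of_set I))\<bar>)),

      (\<forall>(A :: (real^'n) set) E F. zonoid A \<longrightarrow> subspace E \<longrightarrow> subspace F \<longrightarrow>
         orthogonal_comp E \<subseteq> F \<longrightarrow>
         measure lborel A * proj_vol (E \<inter> F) A \<le> proj_vol E A * proj_vol F A),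

      (\<forall>m\<in>{1..CARD('n)}. \<forall>(A :: (real^'n) set) (u :: nat \<Rightarrow> real^'n).
         zonoid A \<longrightarrow>
         (\<forall>i\<in>{1..m}. \<forall>j\<in>{1..m}. u i \<bullet> u j = (if i = j then 1 else 0)) \<longrightarrow>
         measure lborel A ^ (m - 1) * proj_vol (orthogonal_comp (span (u ` {1..m}))) A
           \<le> (\<Prod>i=1..m. proj_vol (orthogonal_comp (span {u i})) A)),

      (\<forall>m\<in>{1..CARD('n)}. \<forall>(A :: (real^'n) set) (B :: nat \<Rightarrow> (real^'n) set).
         zonoid A \<longrightarrow> (\<forall>i\<in>{1..m}. zonoid (B i)) \<longrightarrow>
         measure lborel A ^ (m - 1) *
           mixed_volume (replicate (CARD('n) - m) A @ map B [1..<m + 1])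
         \<le> real CARD('n) ^ m * fact (CARD('n) - m) / fact CARD('n) *
            (\<Prod>i=1..m. mixed_volume (replicate (CARD('n) - 1) A @ [B i])))]"
proof
  show "\<forall>k\<ge>CARD('n). \<forall>u::nat \<Rightarrow> real^'n. \<forall>S\<subseteq>{1..k}.
       elog (measure lborel (\<Sum>i\<in>S. closed_segment 0 (u i))) =
       elog (\<Sum>I\<in>{I. I \<subseteq> S \<and> card I = CARD('n)}. \<bar>det_vecs (map u (sorted_list_of_set I))\<bar>)"
  proof (intro allI impI)
    fix k :: nat and u :: "nat \<Rightarrow> real^'n" and S assume "S \<subseteq> {1..k}"
    then have "finite S" by (rule finite_subset) simp
    from measure_sum_segments[OF this, of u] zdet_card_sum[OF this, of "[]" u]
    show "elog (measure lborel (\<Sum>i\<in>S. closed_segment 0 (u i))) =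
       elog (\<Sum>I\<in>{I. I \<subseteq> S \<and> card I = CARD('n)}. \<bar>det_vecs (map u (sorted_list_of_set I))\<bar>)"
      by simp
  qed
qed (simp only: all_equivalent_def submodular_iff_pair_ineq zonoid_volume_iff_pair_ineq
    det_sums_iff_pair_ineq projections_iff_pair_ineq orthonormal_projections_iff_pair_ineq
    mixed_volumes_iff_pair_ineq, simp)

end
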